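(* Let $G$ be a group. Then $G$ is word hyperbolic as a semigroup (in the language-theoretic sense defined in the context) if and only if $G$ is hyperbolic as a group (in the usual geometric sense).
   Context: For a finite alphabet $\Sigma$, $\Sigma^+$ is the free semigroup of nonempty words over $\Sigma$, and $w^r$ denotes the word $w$ written from right to left. A choice of generators for a semigroup $S$ is a surjective semigroup homomorphism $f:\Sigma^+\to S$ with $\Sigma$ a finite alphabet; write $\overline{w}$ for $f(w)$. A regular combing with respect to this choice is a regular language $R\subset\Sigma^+$ with $f(R)=S$. Let $\#$ be a symbol not in $\Sigma$. A semigroup $S$ is word hyperbolic if for some choice of generators $f:\Sigma^+\to S$ and some regular combing $R\subset\Sigma^+$ the language $T=\{u\#v\#w^r \mid u,v,w\in R \text{ and } \overline{u}\,\overline{v}=\overline{w}\}$ over $\Sigma\cup\{\#\}$ is context-free. A group is hyperbolic as a group if it is finitely generated and word hyperbolic in the usual geometric sense: for a finite generating set there is a constant $\delta$ such that in every geodesic triangle of the Cayley graph each side is contained in the $\delta$-neighbourhood of the union of the other two sides. *)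

theory Defs
  imports Complex_Main "HOL-Algebra.Generated_Groups"
begin

section \<open>Regular and context-free languages\<close>

text \<open>
  State sets and sets of nonterminals are finite, so they may be taken to be sets of natural
  numbers without loss of generality.
\<close>

definition regular_language :: "'c set \<Rightarrow> 'c list set \<Rightarrow> bool" where
  "regular_language \<Sigma> L \<longleftrightarrow>
     (\<exists>(Q :: nat set) q\<^sub>0 F \<delta>.
        finite Q \<and> q\<^sub>0 \<in> Q \<and> F \<subseteq> Q \<and> (\<forall>q\<in>Q. \<forall>a\<in>\<Sigma>. \<delta> q a \<in> Q) \<and>
        L = {w \<in> lists \<Sigma>. foldl \<delta> q\<^sub>0 w \<in> F})"

datatype ('n, 't) grammar_symbol = Nonterminal 'n | Terminal 't

inductive derives_step ::
  "('n \<times> ('n, 't) grammar_symbol list) set \<Rightarrow>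
   ('n, 't) grammar_symbol list \<Rightarrow> ('n, 't) grammar_symbol list \<Rightarrow> bool"
  for P where
  "(A, \<alpha>) \<in> P \<Longrightarrow> derives_step P (\<beta> @ [Nonterminal A] @ \<gamma>) (\<beta> @ \<alpha> @ \<gamma>)"

definition generated_language ::
  "('n \<times> ('n, 't) grammar_symbol list) set \<Rightarrow> 'n \<Rightarrow> 't list set" where
  "generated_language P S =
     {w. (derives_step P)\<^sup>*\<^sup>* [Nonterminal S] (map Terminal w)}"

definition context_free_language :: "'t set \<Rightarrow> 't list set \<Rightarrow> bool" where
  "context_free_language \<Gamma> L \<longleftrightarrow>
     (\<exists>(N :: nat set) S P.
        finite N \<and> S \<in> N \<and> finite P \<and>
        (\<forall>(A, \<alpha>)\<in>P. A \<in> N \<and> set \<alpha> \<subseteq> Nonterminal ` N \<union> Terminal ` \<Gamma>) \<and>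
        L = generated_language P S)"

section \<open>Word hyperbolic semigroups\<close>

text \<open>
  A semigroup is given by the carrier and the multiplication of a monoid record; the
  field \<^const>\<open>one\<close> plays no role below. In particular the empty word is not an element of the
  free semigroup and \<^const>\<open>epi\<close> means surjective semigroup homomorphism.
\<close>

definition free_semigroup :: "'c set \<Rightarrow> 'c list monoid" where
  "free_semigroup \<Sigma> = \<lparr>carrier = lists \<Sigma> - {[]}, mult = (@), one = []\<rparr>"

definition choice_of_generators ::
  "('a, 'b) monoid_scheme \<Rightarrow> 'c set \<Rightarrow> ('c list \<Rightarrow> 'a) \<Rightarrow> bool" where
  "choice_of_generators S \<Sigma> f \<longleftrightarrow> finite \<Sigma> \<and> f \<in> epi (free_semigroup \<Sigma>) S"

definition regular_combing ::
  "('a, 'b) monoid_scheme \<Rightarrow> 'c set \<Rightarrow> ('c list \<Rightarrow> 'a) \<Rightarrow> 'c list set \<Rightarrow> bool" where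
  "regular_combing S \<Sigma> f R \<longleftrightarrow>
     R \<subseteq> carrier (free_semigroup \<Sigma>) \<and> regular_language \<Sigma> R \<and> f ` R = carrier S"

text \<open>The letter \<open>a\<close> of the alphabet is represented by \<open>Some a\<close> and the separator \<open>#\<close> by \<open>None\<close>.\<close>

definition multiplication_language ::
  "('a, 'b) monoid_scheme \<Rightarrow> ('c list \<Rightarrow> 'a) \<Rightarrow> 'c list set \<Rightarrow> 'c option list set" where
  "multiplication_language S f R =
     {map Some u @ [None] @ map Some v @ [None] @ map Some (rev w) | u v w.
        u \<in> R \<and> v \<in> R \<and> w \<in> R \<and> f u \<otimes>\<^bsub>S\<^esub> f v = f w}"

text \<open>Finite alphabets are, up to renaming of letters, finite sets of natural numbers.\<close>

definition word_hyperbolic_semigroup :: "('a, 'b) monoid_scheme \<Rightarrow> bool" where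
  "word_hyperbolic_semigroup S \<longleftrightarrow>
     (\<exists>(\<Sigma> :: nat set) f R.
        choice_of_generators S \<Sigma> f \<and> regular_combing S \<Sigma> f R \<and>
        context_free_language (insert None (Some ` \<Sigma>)) (multiplication_language S f R))"

section \<open>Hyperbolic groups\<close>

definition cayley_adjacent :: "('a, 'b) monoid_scheme \<Rightarrow> 'a set \<Rightarrow> 'a \<Rightarrow> 'a \<Rightarrow> bool" where
  "cayley_adjacent G A x y \<longleftrightarrow> (\<exists>a\<in>A. y = x \<otimes>\<^bsub>G\<^esub> a \<or> x = y \<otimes>\<^bsub>G\<^esub> a)"

text \<open>Paths are represented by their vertex sequences; a path with \<open>n + 1\<close> vertices has length \<open>n\<close>.\<close>

definition cayley_path ::
  "('a, 'b) monoid_scheme \<Rightarrow> 'a set \<Rightarrow> 'a \<Rightarrow> 'a list \<Rightarrow> 'a \<Rightarrow> bool" where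
  "cayley_path G A x p y \<longleftrightarrow>
     p \<noteq> [] \<and> hd p = x \<and> last p = y \<and> set p \<subseteq> carrier G \<and>
     successively (cayley_adjacent G A) p"

text \<open>Meaningful when \<open>A\<close> generates \<open>G\<close>, so that the Cayley graph is connected.\<close>

definition cayley_dist :: "('a, 'b) monoid_scheme \<Rightarrow> 'a set \<Rightarrow> 'a \<Rightarrow> 'a \<Rightarrow> nat" where
  "cayley_dist G A x y = (LEAST n. \<exists>p. cayley_path G A x p y \<and> length p = n + 1)"

definition cayley_geodesic ::
  "('a, 'b) monoid_scheme \<Rightarrow> 'a set \<Rightarrow> 'a \<Rightarrow> 'a list \<Rightarrow> 'a \<Rightarrow> bool" where
  "cayley_geodesic G A x p y \<longleftrightarrow>
     cayley_path G A x p y \<and> length p = cayley_dist G A x y + 1"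

definition cayley_nbhd :: "('a, 'b) monoid_scheme \<Rightarrow> 'a set \<Rightarrow> real \<Rightarrow> 'a set \<Rightarrow> 'a set" where
  "cayley_nbhd G A \<delta> Y = {x \<in> carrier G. \<exists>y\<in>Y. real (cayley_dist G A x y) \<le> \<delta>}"

definition geodesic_triangle ::
  "('a, 'b) monoid_scheme \<Rightarrow> 'a set \<Rightarrow> 'a list \<Rightarrow> 'a list \<Rightarrow> 'a list \<Rightarrow> bool" where
  "geodesic_triangle G A p q r \<longleftrightarrow>
     (\<exists>x y z. cayley_geodesic G A x p y \<and> cayley_geodesic G A y q z \<and> cayley_geodesic G A z r x)"

text \<open>
  Finite generation is part of the definition. As usual, the condition on triangles is required
  for some finite generating set; it does not depend on which one is chosen.
\<close>

definition hyperbolic_group :: "('a, 'b) monoid_scheme \<Rightarrow> bool" where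
  "hyperbolic_group G \<longleftrightarrow>
     (\<exists>A. finite A \<and> A \<subseteq> carrier G \<and> generate G A = carrier G \<and>
        (\<exists>\<delta> :: real. \<forall>p q r. geodesic_triangle G A p q r \<longrightarrow>
           set p \<subseteq> cayley_nbhd G A \<delta> (set q \<union> set r) \<and>
           set q \<subseteq> cayley_nbhd G A \<delta> (set r \<union> set p) \<and>
           set r \<subseteq> cayley_nbhd G A \<delta> (set p \<union> set q)))"

end

theory Submission
  imports Defs
begin

text \<open>
  Suppose that the multiplication table is generated by a grammar. In a word \<open>u#v#w\<^sup>r\<close> of the
  table with \<open>w\<close> a shortest representative, a part of \<open>w\<^sup>r\<close> that is the yield of a
  single node of the derivation tree cannot be replaced by a shorter yield of the same symbol, so it
  has bounded length. Hence from every point of the path \<open>w\<close> one reaches, within bounded distance, the end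
  of the yield of a node spanning the last separator; replacing this yield by a bounded one shows that
  its two ends are close in the group. So the side \<open>w\<close> of the triangle is close to the sides \<open>u\<close>
  and \<open>v\<close>, and a family of paths with slim triangles forces geodesic triangles to be slim
  (``guessing geodesics'').

  Conversely, in a hyperbolic group take the geodesic words, prefixed by a letter that represents the
  identity so that no word is empty. They form a regular language by Cannon's argument on cone types.
  The closed polygon spelled by \<open>u#v#w\<^sup>r\<close> can be triangulated by chords of bounded length, and
  a grammar whose nonterminals are a pair of states of an automaton for \<open>R#R#R\<^sup>r\<close> together
  with a group element of a fixed ball generates exactly the words with such a triangulation.
\<close>

section \<open>Slim triangles and guessed geodesics\<close>

text \<open>The combing is arbitrary, so nothing compares its shortest words with geodesics of the
  Cayley graph directly; they need not be quasigeodesics. The table only says that in a triangle of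
  such words the third side is near the other two. Halving a geodesic repeatedly turns this into a
  bound logarithmic in its length, and localising near a single point then removes the dependence on
  the length. One-sided statements suffice, since the vertices of a triangle are arbitrary and
  geodesics can be reversed.

  In the other direction the chords come from cutting a triangle at a centre, a point of the third
  side near both others. The sides of each of the three corners fellow-travel, so a corner can be
  zipped up by short chords. The order is dictated by the word, which starts and ends at the vertex
  shared by \<open>u\<close> and \<open>w\<close>: the other two corners are zipped from their tips
  inwards and joined, and the last one is zipped around them from the centre outwards.\<close>

locale graph_metric =
  fixes V :: "'a set" and d :: "'a \<Rightarrow> 'a \<Rightarrow> nat"
  assumes dist_self: "x \<in> V \<Longrightarrow> d x x = 0"
    and dist_commute: "x \<in> V \<Longrightarrow> y \<in> V \<Longrightarrow> d x y = d y x"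
    and dist_triangle: "x \<in> V \<Longrightarrow> y \<in> V \<Longrightarrow> z \<in> V \<Longrightarrow> d x z \<le> d x y + d y z"
    and ex_geodesic: "x \<in> V \<Longrightarrow> y \<in> V \<Longrightarrow>
      \<exists>\<alpha> n. \<alpha> 0 = x \<and> \<alpha> n = y \<and> (\<forall>i\<le>n. \<alpha> i \<in> V) \<and> (\<forall>i j. i \<le> j \<and> j \<le> n \<longrightarrow> d (\<alpha> i) (\<alpha> j) = j - i)"
begin

definition geod :: "(nat \<Rightarrow> 'a) \<Rightarrow> nat \<Rightarrow> 'a \<Rightarrow> 'a \<Rightarrow> bool" where
  "geod \<alpha> n x y \<longleftrightarrow> \<alpha> 0 = x \<and> \<alpha> n = y \<and> (\<forall>i\<le>n. \<alpha> i \<in> V) \<and>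
     (\<forall>i j. i \<le> j \<and> j \<le> n \<longrightarrow> d (\<alpha> i) (\<alpha> j) = j - i)"

text \<open>Only the side from \<open>x\<close> to \<open>z\<close> is constrained: reversing
  geodesics and permuting the vertices gives the condition for the other two sides.\<close>

definition slim :: "nat \<Rightarrow> bool" where
  "slim \<delta> \<longleftrightarrow> (\<forall>x y z \<alpha> l \<beta> m \<gamma> n. geod \<alpha> l x y \<longrightarrow> geod \<beta> m y z \<longrightarrow> geod \<gamma> n x z \<longrightarrow>
     (\<forall>i\<le>n. (\<exists>j\<le>l. d (\<gamma> i) (\<alpha> j) \<le> \<delta>) \<or> (\<exists>j\<le>m. d (\<gamma> i) (\<beta> j) \<le> \<delta>)))"

lemma geod_exists: "x \<in> V \<Longrightarrow> y \<in> V \<Longrightarrow> \<exists>\<alpha> n. geod \<alpha> n x y"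
  using ex_geodesic unfolding geod_def .

lemma geod_in: "geod \<alpha> n x y \<Longrightarrow> i \<le> n \<Longrightarrow> \<alpha> i \<in> V"
  by (auto simp: geod_def)

lemma geod_ends:
  assumes "geod \<alpha> n x y"
  shows "\<alpha> 0 = x" "\<alpha> n = y" "x \<in> V" "y \<in> V"
  using assms by (auto simp: geod_def)

lemma geod_dist:
  assumes "geod \<alpha> n x y" "i \<le> n" "j \<le> n"
  shows "d (\<alpha> i) (\<alpha> j) = (if i \<le> j then j - i else i - j)"
  using assms dist_commute[of "\<alpha> i" "\<alpha> j"] by (auto simp: geod_def)

lemma geod_length: "geod \<alpha> n x y \<Longrightarrow> n = d x y"
  by (auto simp: geod_def)

lemma geod_rev:
  assumes g: "geod \<alpha> n x y"
  shows "geod (\<lambda>i. \<alpha> (n - i)) n y x"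
proof -
  have "d (\<alpha> (n - i)) (\<alpha> (n - j)) = j - i" if "i \<le> j" "j \<le> n" for i j
    using geod_dist[OF g, of "n - i" "n - j"] that by auto
  then show ?thesis
    using g by (auto simp: geod_def)
qed

lemma geod_prefix: "geod \<alpha> n x y \<Longrightarrow> m \<le> n \<Longrightarrow> geod \<alpha> m x (\<alpha> m)"
  by (auto simp: geod_def)

lemma slimD:
  "slim \<delta> \<Longrightarrow> geod \<alpha> l x y \<Longrightarrow> geod \<beta> m y z \<Longrightarrow> geod \<gamma> n x z \<Longrightarrow> i \<le> n \<Longrightarrow>
    (\<exists>j\<le>l. d (\<gamma> i) (\<alpha> j) \<le> \<delta>) \<or> (\<exists>j\<le>m. d (\<gamma> i) (\<beta> j) \<le> \<delta>)"
  unfolding slim_def by blast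

lemma dist_triangle_le:
  "x \<in> V \<Longrightarrow> y \<in> V \<Longrightarrow> z \<in> V \<Longrightarrow> d x y \<le> a \<Longrightarrow> d y z \<le> b \<Longrightarrow> d x z \<le> a + b"
  using dist_triangle[of x y z] by linarith

text \<open>Slimness of the triangle whose third side joins \<open>p\<close> and \<open>q\<close>
  puts a point of \<alpha> within \<open>\<delta> + C\<close> of some \<open>\<beta> j\<close>. Both
  geodesics issue from \<open>o'\<close>, so the times \<open>t\<close> and \<open>j\<close> differ
  by no more than that. Clamping by \<open>min\<close> lets \<open>t\<close> run past the end of
  either geodesic.\<close>

lemma fellow_travel:
  assumes slim: "slim \<delta>" and a: "geod \<alpha> m o' p" and b: "geod \<beta> n o' q" and pq: "d p q \<le> C"
  shows "d (\<alpha> (min m t)) (\<beta> (min n t)) \<le> 2 * (\<delta> + C)"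
proof -
  note V = geod_ends[OF a] geod_ends[OF b] geod_in[OF a] geod_in[OF b]
  have m: "m = d o' p" and n: "n = d o' q"
    using geod_length a b by auto
  have mn: "m \<le> n + C" "n \<le> m + C"
    using dist_triangle[of o' q p] dist_triangle[of o' p q] V pq m n dist_commute[of p q] by auto
  show ?thesis
  proof (cases "m \<le> t")
    case True
    have "d q (\<beta> (min n t)) \<le> C"
      using geod_dist[OF b, of n "min n t"] V mn True by auto
    then have "d p (\<beta> (min n t)) \<le> C + C"
      using dist_triangle_le[of p q "\<beta> (min n t)"] pq V by auto
    then show ?thesis
      using True V by (auto simp: min_def)
  next
    case False
    obtain \<sigma> k where s: "geod \<sigma> k q p"
      using geod_exists V by metis
    have k: "k \<le> C"
      using geod_length[OF s] pq dist_commute V by auto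
    have "(\<exists>j\<le>n. d (\<alpha> t) (\<beta> j) \<le> \<delta>) \<or> (\<exists>j\<le>k. d (\<alpha> t) (\<sigma> j) \<le> \<delta>)"
      using slimD[OF slim b s a] False by auto
    then have "\<exists>j\<le>n. d (\<alpha> t) (\<beta> j) \<le> \<delta> + C"
    proof (elim disjE exE conjE)
      fix j assume j: "j \<le> k" "d (\<alpha> t) (\<sigma> j) \<le> \<delta>"
      have "d (\<sigma> j) q \<le> C"
        using geod_dist[OF s, of j 0] geod_ends[OF s] j k by auto
      then have "d (\<alpha> t) q \<le> \<delta> + C"
        using dist_triangle_le[of "\<alpha> t" "\<sigma> j" q] j V geod_in[OF s] False by auto
      then show ?thesis
        using V by auto
    qed (meson le_add1 order_trans)
    then obtain j where j: "j \<le> n" "d (\<alpha> t) (\<beta> j) \<le> \<delta> + C"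
      by blast
    have ta: "d o' (\<alpha> t) = t"
      using geod_dist[OF a, of 0 t] V False by auto
    have tb: "d o' (\<beta> j) = j"
      using geod_dist[OF b, of 0 j] V j by auto
    have tj: "t \<le> j + (\<delta> + C)" "j \<le> t + (\<delta> + C)"
      using dist_triangle[of o' "\<beta> j" "\<alpha> t"] dist_triangle[of o' "\<alpha> t" "\<beta> j"] ta tb j V False
        dist_commute[of "\<alpha> t" "\<beta> j"] by auto
    have "d (\<beta> j) (\<beta> (min n t)) \<le> \<delta> + C"
      using geod_dist[OF b, of j "min n t"] j tj by auto
    then have "d (\<alpha> t) (\<beta> (min n t)) \<le> (\<delta> + C) + (\<delta> + C)"
      using dist_triangle_le[of "\<alpha> t" "\<beta> j" "\<beta> (min n t)"] j V False by auto
    then show ?thesis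
      using False by (auto simp: min_def)
  qed
qed

lemma discrete_crossing:
  assumes "P (0::nat)" "Q n" "\<And>i. i \<le> n \<Longrightarrow> P i \<or> Q i"
  shows "\<exists>i\<le>n. P i \<and> (Q i \<or> (i < n \<and> Q (Suc i)))"
  using assms
proof (induction n)
  case (Suc n)
  show ?case
  proof (cases "Q n")
    case True
    then have "\<exists>i\<le>n. P i \<and> (Q i \<or> (i < n \<and> Q (Suc i)))"
      using Suc by auto
    then show ?thesis
      by (meson le_SucI less_SucI)
  next
    case False
    then show ?thesis
      using Suc.prems by (metis le_SucI le_refl lessI)
  qed
qed auto

text \<open>Along \<gamma> the points are close to \<alpha> at the start and to \<beta> at the end,
  so some point close to \<alpha> is also close to \<beta> or is followed by one that is. The extra
  1 pays for that step.\<close>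

lemma triangle_center:
  assumes slim: "slim \<delta>" and a: "geod \<alpha> l x y" and b: "geod \<beta> m y z" and c: "geod \<gamma> n x z"
  shows "\<exists>i\<le>l. \<exists>j\<le>m. \<exists>k\<le>n. d (\<gamma> k) (\<alpha> i) \<le> \<delta> + 1 \<and> d (\<gamma> k) (\<beta> j) \<le> \<delta> + 1"
proof -
  note V = geod_ends[OF a] geod_ends[OF b] geod_ends[OF c] geod_in[OF a] geod_in[OF b] geod_in[OF c]
  let ?P = "\<lambda>i. \<exists>j\<le>l. d (\<gamma> i) (\<alpha> j) \<le> \<delta>" and ?Q = "\<lambda>i. \<exists>j\<le>m. d (\<gamma> i) (\<beta> j) \<le> \<delta>"
  have "\<exists>i\<le>n. ?P i \<and> (?Q i \<or> (i < n \<and> ?Q (Suc i)))"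
  proof (rule discrete_crossing)
    have "d (\<gamma> 0) (\<alpha> 0) \<le> \<delta>" "d (\<gamma> n) (\<beta> m) \<le> \<delta>"
      using dist_self V by auto
    then show "?P 0" "?Q n"
      by blast+
  qed (rule slimD[OF slim a b c])
  then obtain k i where k: "k \<le> n" "?Q k \<or> (k < n \<and> ?Q (Suc k))" and i: "i \<le> l" "d (\<gamma> k) (\<alpha> i) \<le> \<delta>"
    by blast
  have "\<exists>j\<le>m. d (\<gamma> k) (\<beta> j) \<le> \<delta> + 1"
    using k(2)
  proof (elim disjE exE conjE)
    fix j assume j: "k < n" "j \<le> m" "d (\<gamma> (Suc k)) (\<beta> j) \<le> \<delta>"
    have "d (\<gamma> k) (\<gamma> (Suc k)) \<le> 1"
      using geod_dist[OF c, of k "Suc k"] j by auto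
    then have "d (\<gamma> k) (\<beta> j) \<le> 1 + \<delta>"
      using dist_triangle_le[of "\<gamma> k" "\<gamma> (Suc k)" "\<beta> j" 1 \<delta>] j V by auto
    then show ?thesis
      using j by auto
  qed (meson le_add1 order_trans)
  then show ?thesis
    using k i by (metis le_add1 order_trans)
qed

end

section \<open>The guessing-geodesics criterion for hyperbolicity\<close>

lemma eventually_linear_le_power2: "\<exists>k0. \<forall>k\<ge>k0. A + B * k \<le> (2::nat) ^ k"
proof -
  \<comment> \<open>At \<open>2 * m\<close> the left side is at most
    \<open>(m + 1) * (m + 1)\<close>, and \<open>m + 1 \<le> 2 ^ m\<close>. From there on each step
    adds only \<open>B\<close> to the left side and doubles the right side.\<close>
  define m where "m = A + 2 * B"
  have pw: "n < 2 ^ n" for n :: nat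
    by simp
  have base: "A + B * (2 * m) \<le> 2 ^ (2 * m)"
  proof -
    have "A + B * (2 * m) \<le> (m + 1) * (m + 1)"
      by (auto simp: m_def algebra_simps)
    also have "\<dots> \<le> 2 ^ m * 2 ^ m"
      using pw[of m] by (intro mult_mono) (auto simp: Suc_le_eq)
    finally show ?thesis
      by (simp add: mult_2 power_add)
  qed
  have "A + B * (2 * m + j) \<le> 2 ^ (2 * m + j)" for j
  proof (induction j)
    case (Suc j)
    have "B \<le> 2 * m + j" by (auto simp: m_def)
    then have "B \<le> 2 ^ (2 * m + j)"
      using pw[of "2 * m + j"] by linarith
    then show ?case
      using Suc by (simp add: algebra_simps)
  qed (use base in auto)
  then have "\<forall>k\<ge>2 * m. A + B * k \<le> 2 ^ k"
    by (metis le_Suc_ex)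
  then show ?thesis ..
qed

text \<open>The paths \<open>L x y\<close> need not be geodesic, and \<open>L x y\<close> and
  \<open>L y x\<close> may be unrelated. \<open>L_short\<close> excludes long detours between
  neighbours and starts a dyadic induction; \<open>L_slim\<close> is its induction step.\<close>

locale guessed_geodesics = graph_metric +
  fixes L :: "'a \<Rightarrow> 'a \<Rightarrow> nat \<Rightarrow> 'a" and len :: "'a \<Rightarrow> 'a \<Rightarrow> nat" and h c :: nat
  assumes L_in: "x \<in> V \<Longrightarrow> y \<in> V \<Longrightarrow> i \<le> len x y \<Longrightarrow> L x y i \<in> V"
    and L_start: "x \<in> V \<Longrightarrow> y \<in> V \<Longrightarrow> L x y 0 = x"
    and L_end: "x \<in> V \<Longrightarrow> y \<in> V \<Longrightarrow> L x y (len x y) = y"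
    and L_step: "x \<in> V \<Longrightarrow> y \<in> V \<Longrightarrow> i < len x y \<Longrightarrow> d (L x y i) (L x y (Suc i)) \<le> 1"
    and L_short: "x \<in> V \<Longrightarrow> y \<in> V \<Longrightarrow> d x y \<le> 1 \<Longrightarrow> i \<le> len x y \<Longrightarrow> d (L x y i) x \<le> c"
    and L_slim: "x \<in> V \<Longrightarrow> y \<in> V \<Longrightarrow> z \<in> V \<Longrightarrow> i \<le> len x z \<Longrightarrow>
      (\<exists>j\<le>len x y. d (L x z i) (L x y j) \<le> h) \<or> (\<exists>j\<le>len y z. d (L x z i) (L y z j) \<le> h)"
begin

definition close :: "nat \<Rightarrow> (nat \<Rightarrow> 'a) \<Rightarrow> nat \<Rightarrow> nat \<Rightarrow> 'a \<Rightarrow> bool" where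
  "close D \<alpha> a b p \<longleftrightarrow> (\<exists>i. a \<le> i \<and> i \<le> b \<and> d p (\<alpha> i) \<le> D)"

lemma L_split:
  assumes g: "geod \<alpha> n x y" and ab: "a \<le> e" "e \<le> b" "b \<le> n" and i: "i \<le> len (\<alpha> a) (\<alpha> b)"
  shows "(\<exists>j\<le>len (\<alpha> a) (\<alpha> e). d (L (\<alpha> a) (\<alpha> b) i) (L (\<alpha> a) (\<alpha> e) j) \<le> h) \<or>
    (\<exists>j\<le>len (\<alpha> e) (\<alpha> b). d (L (\<alpha> a) (\<alpha> b) i) (L (\<alpha> e) (\<alpha> b) j) \<le> h)"
  using L_slim[of "\<alpha> a" "\<alpha> e" "\<alpha> b" i] geod_in[OF g] ab i by auto

lemma close_trans:
  assumes g: "geod \<alpha> n x y" and "a \<le> b" "b \<le> n" "p \<in> V" "q \<in> V" "d p q \<le> E" "close D \<alpha> a' b' q"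
    "a \<le> a'" "b' \<le> b" "E + D \<le> F"
  shows "close F \<alpha> a b p"
proof -
  from assms obtain i where i: "a' \<le> i" "i \<le> b'" "d q (\<alpha> i) \<le> D"
    by (auto simp: close_def)
  have "d p (\<alpha> i) \<le> E + D"
    using dist_triangle_le[of p q "\<alpha> i" E D] i assms geod_in[OF g] by auto
  then show ?thesis
    using i assms by (auto simp: close_def intro!: exI[of _ i])
qed

text \<open>Halve the interval \<open>k\<close> times. Each halving is one use of
  \<open>L_slim\<close> and costs \<open>h\<close>; the intervals of length at most 1 that remain
  cost \<open>c\<close> by \<open>L_short\<close>.\<close>

lemma close_log:
  assumes g: "geod \<alpha> n x y"
  shows "a \<le> b \<Longrightarrow> b \<le> n \<Longrightarrow> b - a \<le> 2 ^ k \<Longrightarrow> i \<le> len (\<alpha> a) (\<alpha> b) \<Longrightarrow>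
    close (h * k + c) \<alpha> a b (L (\<alpha> a) (\<alpha> b) i)"
proof (induction k arbitrary: a b i)
  case 0
  then have "d (\<alpha> a) (\<alpha> b) \<le> 1"
    using geod_dist[OF g, of a b] by auto
  then have "d (L (\<alpha> a) (\<alpha> b) i) (\<alpha> a) \<le> c"
    using L_short 0 geod_in[OF g] by auto
  then show ?case
    using 0 by (auto simp: close_def)
next
  case (Suc k)
  define e where "e = (a + b) div 2"
  have e: "a \<le> e" "e \<le> b" "e - a \<le> 2 ^ k" "b - e \<le> 2 ^ k" "e \<le> n"
    using Suc.prems by (auto simp: e_def)
  have in1: "L (\<alpha> a) (\<alpha> b) i \<in> V" "j \<le> len (\<alpha> a) (\<alpha> e) \<Longrightarrow> L (\<alpha> a) (\<alpha> e) j \<in> V"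
    "j \<le> len (\<alpha> e) (\<alpha> b) \<Longrightarrow> L (\<alpha> e) (\<alpha> b) j \<in> V" for j
    using L_in geod_in[OF g] Suc.prems e by auto
  from L_split[OF g e(1,2) Suc.prems(2,4)] show ?case
  proof (elim disjE exE conjE)
    fix j assume j: "j \<le> len (\<alpha> a) (\<alpha> e)" "d (L (\<alpha> a) (\<alpha> b) i) (L (\<alpha> a) (\<alpha> e) j) \<le> h"
    show ?thesis
      by (rule close_trans[OF g Suc.prems(1,2) in1(1) in1(2)[OF j(1)] j(2) Suc.IH[OF e(1,5,3) j(1)]])
        (use e in auto)
  next
    fix j assume j: "j \<le> len (\<alpha> e) (\<alpha> b)" "d (L (\<alpha> a) (\<alpha> b) i) (L (\<alpha> e) (\<alpha> b) j) \<le> h"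
    show ?thesis
      by (rule close_trans[OF g Suc.prems(1,2) in1(1) in1(3)[OF j(1)] j(2) Suc.IH[OF e(2) Suc.prems(2) e(4) j(1)]])
        (use e in auto)
  qed
qed

text \<open>
  A point of \<open>L (\<alpha> a) (\<alpha> b)\<close> that lies within \<open>D\<close> of \<open>\<alpha> e\<close> can only be shadowed by the
  part of the geodesic at distance \<open>O(D + h)\<close> from \<open>\<alpha> e\<close>; on that part the logarithmic
  bound applies, and it is smaller than \<open>D\<close> as soon as \<open>D\<close> is large.
\<close>

lemma close_improve:
  assumes g: "geod \<alpha> n x y"
    and D: "\<And>a b i. a \<le> b \<Longrightarrow> b \<le> n \<Longrightarrow> i \<le> len (\<alpha> a) (\<alpha> b) \<Longrightarrow> close D \<alpha> a b (L (\<alpha> a) (\<alpha> b) i)"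
    and k: "4 * D + 4 * h + 2 \<le> 2 ^ k"
    and ab: "a \<le> b" "b \<le> n" and i: "i \<le> len (\<alpha> a) (\<alpha> b)"
  shows "close (2 * h + c + h * k) \<alpha> a b (L (\<alpha> a) (\<alpha> b) i)"
proof -
  let ?p = "L (\<alpha> a) (\<alpha> b) i"
  obtain e where e: "a \<le> e" "e \<le> b" "d ?p (\<alpha> e) \<le> D"
    using D[OF ab i] by (auto simp: close_def)
  \<comment> \<open>If a point within \<open>2 * h\<close> of \<open>?p\<close> were shadowed by
    \<open>\<alpha> j\<close> with \<open>j\<close> at least \<open>s\<close> away from
    \<open>e\<close>, then \<open>d (\<alpha> e) (\<alpha> j)\<close> would be at most
    \<open>2 * D + 2 * h\<close>, which is less than \<open>s\<close>. So only the window from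
    \<open>a'\<close> to \<open>b'\<close> can matter; its width \<open>2 * s\<close> is the
    quantity bounded by \<open>2 ^ k\<close>.\<close>
  define s where "s = 2 * D + 2 * h + 1"
  define a' where "a' = max a (e - s)"
  define b' where "b' = min b (e + s)"
  have ab': "a \<le> a'" "a' \<le> e" "e \<le> b'" "b' \<le> b" "a' \<le> b'" "a' \<le> b" "a' \<le> n" "b' \<le> n" "e \<le> n"
    using e ab by (auto simp: a'_def b'_def)
  have "b' - a' \<le> 2 * s"
    by (auto simp: a'_def b'_def)
  also have "\<dots> = 4 * D + 4 * h + 2"
    by (simp add: s_def)
  finally have len: "b' - a' \<le> 2 ^ k"
    using k by (rule order_trans)
  have V: "\<alpha> a \<in> V" "\<alpha> b \<in> V" "\<alpha> a' \<in> V" "\<alpha> b' \<in> V" "\<alpha> e \<in> V"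
    using geod_in[OF g] ab ab' e by auto
  have pV: "?p \<in> V"
    using L_in V i by auto
  have far: False if q: "q \<in> V" "d ?p q \<le> 2 * h" "close D \<alpha> a'' b'' q" and
    out: "b'' \<le> n" "\<And>j. a'' \<le> j \<Longrightarrow> j \<le> b'' \<Longrightarrow> e + s \<le> j \<or> j + s \<le> e" for q a'' b''
  proof -
    obtain j where j: "a'' \<le> j" "j \<le> b''" "d q (\<alpha> j) \<le> D"
      using q by (auto simp: close_def)
    have jV: "\<alpha> j \<in> V"
      using geod_in[OF g] j out by auto
    have "d ?p (\<alpha> j) \<le> 2 * h + D"
      using dist_triangle_le[OF pV q(1) jV q(2) j(3)] by simp
    then have "d (\<alpha> e) (\<alpha> j) \<le> D + (2 * h + D)"
      using dist_triangle_le[of "\<alpha> e" ?p "\<alpha> j" D "2 * h + D"] e V pV jV dist_commute[of "\<alpha> e" ?p] by auto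
    then show False
      using geod_dist[OF g, of e j] j out(1) out(2)[OF j(1,2)] ab' by (auto simp: s_def split: if_splits)
  qed
  \<comment> \<open>When the window reaches \<open>a\<close> or \<open>b\<close>, the outer piece on
    that side degenerates to a path from a point to itself. There \<open>far\<close> does not apply,
    and \<open>L_short\<close> takes over.\<close>
  have short: "close (2 * h + c + h * k) \<alpha> a b ?p"
    if q: "j \<le> len (\<alpha> f) (\<alpha> f)" "d ?p (L (\<alpha> f) (\<alpha> f) j) \<le> 2 * h" and f: "a \<le> f" "f \<le> b" for j f
  proof -
    have fV: "\<alpha> f \<in> V"
      using geod_in[OF g] f ab by auto
    have "d (L (\<alpha> f) (\<alpha> f) j) (\<alpha> f) \<le> c"
      using L_short[OF fV fV _ q(1)] dist_self[OF fV] by auto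
    then have "d ?p (\<alpha> f) \<le> 2 * h + c"
      using dist_triangle_le[OF pV L_in[OF fV fV q(1)] fV q(2)] by auto
    then show ?thesis
      using f by (auto simp: close_def intro!: exI[of _ f])
  qed
  \<comment> \<open>Cutting first at \<open>a'\<close> and then at \<open>b'\<close> uses
    \<open>L_slim\<close> twice, hence the term \<open>2 * h\<close>.\<close>
  from L_split[OF g ab'(1) ab'(6) ab(2) i] show ?thesis
  proof (elim disjE exE conjE)
    fix j assume j: "j \<le> len (\<alpha> a) (\<alpha> a')" "d ?p (L (\<alpha> a) (\<alpha> a') j) \<le> h"
    show ?thesis
    proof (cases "a' = a")
      case True
      then show ?thesis
        using short[of j a] j ab by auto
    next
      case False
      then have "a' + s \<le> e"
        by (auto simp: a'_def)
      then have False
        using far[of "L (\<alpha> a) (\<alpha> a') j" a a'] j D[OF ab'(1,7) j(1)] L_in[OF V(1,3) j(1)] ab' by auto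
      then show ?thesis ..
    qed
  next
    fix j assume j: "j \<le> len (\<alpha> a') (\<alpha> b)" "d ?p (L (\<alpha> a') (\<alpha> b) j) \<le> h"
    have qV: "L (\<alpha> a') (\<alpha> b) j \<in> V"
      using L_in V j by auto
    have 2: "d ?p r \<le> 2 * h" if "d (L (\<alpha> a') (\<alpha> b) j) r \<le> h" "r \<in> V" for r
      using dist_triangle_le[OF pV qV that(2) j(2) that(1)] by simp
    from L_split[OF g ab'(5,4) ab(2) j(1)] show ?thesis
    proof (elim disjE exE conjE)
      fix j' assume j': "j' \<le> len (\<alpha> a') (\<alpha> b')" "d (L (\<alpha> a') (\<alpha> b) j) (L (\<alpha> a') (\<alpha> b') j') \<le> h"
      have rV: "L (\<alpha> a') (\<alpha> b') j' \<in> V"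
        using L_in V j' by auto
      show ?thesis
        by (rule close_trans[OF g ab pV rV 2[OF j'(2) rV] close_log[OF g ab'(5,8) len j'(1)]])
          (use ab' in auto)
    next
      fix j' assume j': "j' \<le> len (\<alpha> b') (\<alpha> b)" "d (L (\<alpha> a') (\<alpha> b) j) (L (\<alpha> b') (\<alpha> b) j') \<le> h"
      have rV: "L (\<alpha> b') (\<alpha> b) j' \<in> V"
        using L_in V j' by auto
      note d2 = 2[OF j'(2) rV]
      show ?thesis
      proof (cases "b' = b")
        case True
        then show ?thesis
          using short[of j' b] j' ab d2 by auto
      next
        case False
        then have "e + s \<le> b'"
          by (auto simp: b'_def)
        then have False
          using far[of "L (\<alpha> b') (\<alpha> b) j'" b' b] d2 D[OF ab'(4) ab(2) j'(1)] rV ab ab' by auto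
        then show ?thesis ..
      qed
    qed
  qed
qed

text \<open>A descent on the bound \<open>2 * h + c + h * k\<close>. For \<open>k = k0 + n\<close>
  it holds by \<open>close_log\<close>, because a geodesic of length \<open>n\<close> has length at
  most \<open>2 ^ n\<close>. As long as \<open>k \<ge> k0\<close>, \<open>close_improve\<close>
  passes from \<open>Suc k\<close> to \<open>k\<close>. The descent ends at \<open>k0\<close>, which
  depends on \<open>h\<close> and \<open>c\<close> only.\<close>

lemma L_close_geodesic:
  "\<exists>D. \<forall>\<alpha> n x y. geod \<alpha> n x y \<longrightarrow> (\<forall>i\<le>len x y. \<exists>j\<le>n. d (L x y i) (\<alpha> j) \<le> D)"
proof -
  \<comment> \<open>The inequality says that the window belonging to the bound for
    \<open>Suc k\<close> has width at most \<open>2 ^ k\<close>, after expanding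
    \<open>h * Suc k\<close>.\<close>
  obtain k0 where k0: "\<And>k. k \<ge> k0 \<Longrightarrow> (4 * (2 * h + c + h) + 4 * h + 2) + (4 * h) * k \<le> 2 ^ k"
    using eventually_linear_le_power2[of "4 * (2 * h + c + h) + 4 * h + 2" "4 * h"] by blast
  have "\<exists>j\<le>n. d (L x y i) (\<alpha> j) \<le> 2 * h + c + h * k0"
    if g: "geod \<alpha> n x y" and i: "i \<le> len x y" for \<alpha> n x y i
  proof -
    let ?C = "\<lambda>k. \<forall>a b i. a \<le> b \<longrightarrow> b \<le> n \<longrightarrow> i \<le> len (\<alpha> a) (\<alpha> b) \<longrightarrow>
       close (2 * h + c + h * k) \<alpha> a b (L (\<alpha> a) (\<alpha> b) i)"
    have top: "?C (k0 + n)"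
    proof (intro allI impI)
      fix a b i assume ab: "a \<le> b" "b \<le> n" "i \<le> len (\<alpha> a) (\<alpha> b)"
      have "b - a \<le> k0 + n" using ab by auto
      also have "\<dots> \<le> 2 ^ (k0 + n)" by (simp add: less_imp_le)
      finally have "close (h * (k0 + n) + c) \<alpha> a b (L (\<alpha> a) (\<alpha> b) i)"
        using close_log[OF g] ab by blast
      then show "close (2 * h + c + h * (k0 + n)) \<alpha> a b (L (\<alpha> a) (\<alpha> b) i)"
        unfolding close_def by (elim ex_forward) auto
    qed
    have step: "?C k" if "?C (Suc k)" "k \<ge> k0" for k
    proof (intro allI impI)
      fix a b i assume ab: "a \<le> b" "b \<le> n" "i \<le> len (\<alpha> a) (\<alpha> b)"
      have "4 * (2 * h + c + h * Suc k) + 4 * h + 2 \<le> 2 ^ k"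
        using k0[OF that(2)] by (simp add: algebra_simps)
      then show "close (2 * h + c + h * k) \<alpha> a b (L (\<alpha> a) (\<alpha> b) i)"
        using close_improve[OF g _ _ ab] that(1) by blast
    qed
    have "?C (k0 + m) \<Longrightarrow> ?C k0" for m
    proof (induction m)
      case (Suc m)
      have "?C (Suc (k0 + m))"
        using Suc.prems by (simp only: add_Suc_right)
      then have "?C (k0 + m)"
        by (rule step) simp
      then show ?case
        by (rule Suc.IH)
    qed simp
    then have "?C k0"
      using top by blast
    then show ?thesis
      using geod_ends(1,2)[OF g] i unfolding close_def by blast
  qed
  then show ?thesis
    by blast
qed

text \<open>The guessed path moves in steps of length at most 1; it shadows the part of the geodesic
  before \<open>k\<close> at its start and the part after \<open>k\<close> at its end. At the change
  one of its points is within \<open>D\<close> of some \<open>\<alpha> j\<close> and within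
  \<open>D + 1\<close> of some \<open>\<alpha> j'\<close> with \<open>j \<le> k \<le> j'\<close>.
  Then \<open>j' - j\<close> is at most \<open>2 * D + 1\<close>, so \<open>\<alpha> k\<close> is
  near this point as well.\<close>

lemma geodesic_close_L:
  assumes D: "\<And>\<alpha> n x y i. geod \<alpha> n x y \<Longrightarrow> i \<le> len x y \<Longrightarrow> \<exists>j\<le>n. d (L x y i) (\<alpha> j) \<le> D"
    and g: "geod \<alpha> n x y" and k: "k \<le> n"
  shows "\<exists>i\<le>len x y. d (\<alpha> k) (L x y i) \<le> 3 * D + 1"
proof -
  note V = geod_ends[OF g] geod_in[OF g]
  note LV = L_in[OF V(3,4)]
  let ?P = "\<lambda>i. \<exists>j\<le>k. d (L x y i) (\<alpha> j) \<le> D"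
  let ?Q = "\<lambda>i. \<exists>j. k \<le> j \<and> j \<le> n \<and> d (L x y i) (\<alpha> j) \<le> D"
  have "\<exists>i\<le>len x y. ?P i \<and> (?Q i \<or> (i < len x y \<and> ?Q (Suc i)))"
  proof (rule discrete_crossing)
    show "?P 0"
      using L_start[OF V(3,4)] V dist_self[OF V(3)] by (intro exI[of _ 0]) auto
    show "?Q (len x y)"
      using L_end[OF V(3,4)] V dist_self[OF V(4)] k by (intro exI[of _ n]) auto
  next
    fix i assume "i \<le> len x y"
    then obtain j where "j \<le> n" "d (L x y i) (\<alpha> j) \<le> D"
      using D[OF g] by blast
    then show "?P i \<or> ?Q i"
      by (meson nat_le_linear)
  qed
  then obtain i j where i: "i \<le> len x y" "?Q i \<or> (i < len x y \<and> ?Q (Suc i))"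
    and j: "j \<le> k" "d (L x y i) (\<alpha> j) \<le> D"
    by blast
  obtain j' where j': "k \<le> j'" "j' \<le> n" "d (L x y i) (\<alpha> j') \<le> D + 1"
    using i(2)
  proof (elim disjE exE conjE)
    fix j' assume a: "i < len x y" "k \<le> j'" "j' \<le> n" "d (L x y (Suc i)) (\<alpha> j') \<le> D"
    have "d (L x y i) (\<alpha> j') \<le> 1 + D"
      using dist_triangle_le[of "L x y i" "L x y (Suc i)" "\<alpha> j'" 1 D] L_step[OF V(3,4) a(1)] a LV V by auto
    then show ?thesis
      using that a by auto
  qed (use that in auto)
  have "d (\<alpha> j) (\<alpha> j') \<le> D + (D + 1)"
    using dist_triangle_le[of "\<alpha> j" "L x y i" "\<alpha> j'" D "D + 1"] j j' LV i k V
      dist_commute[of "\<alpha> j" "L x y i"] by auto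
  then have "d (\<alpha> k) (\<alpha> j) \<le> 2 * D + 1"
    using geod_dist[OF g, of j j'] geod_dist[OF g, of k j] j j' k by (auto split: if_splits)
  then have "d (\<alpha> k) (L x y i) \<le> (2 * D + 1) + D"
    using dist_triangle_le[of "\<alpha> k" "\<alpha> j" "L x y i" "2 * D + 1" D] j LV i k V
      dist_commute[of "\<alpha> j" "L x y i"] by auto
  then show ?thesis
    using i by auto
qed

theorem ex_slim: "\<exists>\<delta>. slim \<delta>"
proof -
  obtain D where D: "\<And>\<alpha> n x y i. geod \<alpha> n x y \<Longrightarrow> i \<le> len x y \<Longrightarrow> \<exists>j\<le>n. d (L x y i) (\<alpha> j) \<le> D"
    using L_close_geodesic by blast
  \<comment> \<open>The summands lead from the geodesic \<gamma> to its guessed path, across to the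
    guessed path of another side, and back to the geodesic on that side.\<close>
  have "slim ((3 * D + 1) + h + D)"
    unfolding slim_def
  proof (intro allI impI)
    fix x y z \<alpha> l \<beta> m \<gamma> n i
    assume a: "geod \<alpha> l x y" and b: "geod \<beta> m y z" and c: "geod \<gamma> n x z" and i: "i \<le> n"
    note V = geod_ends(3,4)[OF a] geod_ends(3,4)[OF b] geod_in[OF a] geod_in[OF b] geod_in[OF c]
    obtain k where k: "k \<le> len x z" "d (\<gamma> i) (L x z k) \<le> 3 * D + 1"
      using geodesic_close_L[OF D c i] by blast
    have kV: "L x z k \<in> V"
      using L_in V k by auto
    have near: "d (\<gamma> i) r \<le> (3 * D + 1) + h + D"
      if "d (L x z k) p \<le> h" "d p r \<le> D" "p \<in> V" "r \<in> V" for p r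
    proof -
      have "d (L x z k) r \<le> h + D"
        using dist_triangle_le[of "L x z k" p r] that kV by auto
      then show ?thesis
        using dist_triangle_le[of "\<gamma> i" "L x z k" r "3 * D + 1" "h + D"] that kV k V i by auto
    qed
    show "(\<exists>j\<le>l. d (\<gamma> i) (\<alpha> j) \<le> (3 * D + 1) + h + D) \<or> (\<exists>j\<le>m. d (\<gamma> i) (\<beta> j) \<le> (3 * D + 1) + h + D)"
      using L_slim[OF V(1,2,4) k(1)]
    proof (elim disjE exE conjE)
      fix j assume j: "j \<le> len x y" "d (L x z k) (L x y j) \<le> h"
      obtain j' where "j' \<le> l" "d (L x y j) (\<alpha> j') \<le> D"
        using D[OF a j(1)] by blast
      then show ?thesis
        using near[OF j(2)] L_in[OF V(1,2) j(1)] V by blast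
    next
      fix j assume j: "j \<le> len y z" "d (L x z k) (L y z j) \<le> h"
      obtain j' where "j' \<le> m" "d (L y z j) (\<beta> j') \<le> D"
        using D[OF b j(1)] by blast
      then show ?thesis
        using near[OF j(2)] L_in[OF V(2,4) j(1)] V by blast
    qed
  qed
  then show ?thesis ..
qed

end

section \<open>Cayley graphs\<close>

definition gprod :: "('a, 'b) monoid_scheme \<Rightarrow> 'a list \<Rightarrow> 'a" where
  "gprod G xs = foldr (mult G) xs (one G)"

lemma gprod_Nil [simp]: "gprod G [] = \<one>\<^bsub>G\<^esub>"
  and gprod_Cons [simp]: "gprod G (x # xs) = x \<otimes>\<^bsub>G\<^esub> gprod G xs"
  by (simp_all add: gprod_def)

context group
begin

lemma gprod_closed [simp, intro]: "set xs \<subseteq> carrier G \<Longrightarrow> gprod G xs \<in> carrier G"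
  by (induction xs) auto

lemma gprod_append:
  "set xs \<subseteq> carrier G \<Longrightarrow> set ys \<subseteq> carrier G \<Longrightarrow> gprod G (xs @ ys) = gprod G xs \<otimes> gprod G ys"
  by (induction xs) (auto simp: m_assoc)

lemma gprod_rev_inv:
  "set xs \<subseteq> carrier G \<Longrightarrow> gprod G (rev (map (m_inv G) xs)) = inv (gprod G xs)"
proof (induction xs)
  case (Cons x xs)
  then have "set (rev (map (m_inv G) xs)) \<subseteq> carrier G"
    by auto
  then show ?case
    using Cons gprod_append[of "rev (map (m_inv G) xs)" "[inv x]"] by (simp add: inv_mult_group)
qed simp

lemma inv_mult_cancel_left [simp]:
  "x \<in> carrier G \<Longrightarrow> y \<in> carrier G \<Longrightarrow> inv x \<otimes> (x \<otimes> y) = y"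
  "x \<in> carrier G \<Longrightarrow> y \<in> carrier G \<Longrightarrow> x \<otimes> (inv x \<otimes> y) = y"
  by (simp_all flip: m_assoc)

end

section \<open>The word metric as a graph metric\<close>

locale cayley_graph = group G for G (structure) +
  fixes A :: "'a set"
  assumes gens_closed: "A \<subseteq> carrier G" and gens_generate: "generate G A = carrier G"
begin

abbreviation dist where "dist \<equiv> cayley_dist G A"

abbreviation norm where "norm \<equiv> cayley_dist G A \<one>"

text \<open>Index functions in place of vertex lists: concatenation, reversal and translation become
  arithmetic on indices, and geodesics take the form used in \<open>graph_metric\<close>.\<close>

definition walk :: "(nat \<Rightarrow> 'a) \<Rightarrow> nat \<Rightarrow> 'a \<Rightarrow> 'a \<Rightarrow> bool" where
  "walk f n x y \<longleftrightarrow> f 0 = x \<and> f n = y \<and> (\<forall>i\<le>n. f i \<in> carrier G) \<and>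
     (\<forall>i<n. cayley_adjacent G A (f i) (f (Suc i)))"

lemma adjacent_sym: "cayley_adjacent G A x y \<Longrightarrow> cayley_adjacent G A y x"
  by (auto simp: cayley_adjacent_def)

lemma adjacent_translate:
  assumes "cayley_adjacent G A x y" "x \<in> carrier G" "y \<in> carrier G" "g \<in> carrier G"
  shows "cayley_adjacent G A (g \<otimes> x) (g \<otimes> y)"
  using assms gens_closed m_assoc unfolding cayley_adjacent_def by (metis subsetD)

lemma path_walk: "cayley_path G A x p y \<Longrightarrow> walk (nth p) (length p - 1) x y"
  unfolding cayley_path_def walk_def successively_conv_nth
  by (auto simp: hd_conv_nth last_conv_nth intro!: subsetD[OF _ nth_mem] simp flip: length_greater_0_conv)

lemma walk_path: "walk f n x y \<Longrightarrow> cayley_path G A x (map f [0..<Suc n]) y"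
  unfolding cayley_path_def walk_def successively_conv_nth
  by (auto simp: hd_map last_map simp del: upt_Suc)

lemma dist_walk: "dist x y = (LEAST n. \<exists>f. walk f n x y)"
proof -
  have "(\<exists>p. cayley_path G A x p y \<and> length p = n + 1) \<longleftrightarrow> (\<exists>f. walk f n x y)" for n
  proof safe
    fix f assume "walk f n x y"
    from walk_path[OF this] show "\<exists>p. cayley_path G A x p y \<and> length p = n + 1"
      by (metis Suc_eq_plus1 diff_zero length_map length_upt)
  qed (metis path_walk add_diff_cancel_right')
  then show ?thesis
    by (simp add: cayley_dist_def)
qed

lemma walk_refl: "x \<in> carrier G \<Longrightarrow> walk (\<lambda>_. x) 0 x x"
  by (auto simp: walk_def)

lemma walk_append:
  assumes f: "walk f m x y" and g: "walk g n y z"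
  shows "walk (\<lambda>i. if i \<le> m then f i else g (i - m)) (m + n) x z"
proof -
  let ?h = "\<lambda>i. if i \<le> m then f i else g (i - m)"
  have "cayley_adjacent G A (?h i) (?h (Suc i))" if "i < m + n" for i
  proof (cases "i < m")
    case False
    then have "?h i = g (i - m)" "?h (Suc i) = g (Suc (i - m))"
      using f g by (auto simp: walk_def Suc_diff_le not_less)
    then show ?thesis
      using that g False by (auto simp: walk_def)
  qed (use f in \<open>auto simp: walk_def\<close>)
  then show ?thesis
    using f g by (auto simp: walk_def)
qed

lemma walk_rev: "walk f n x y \<Longrightarrow> walk (\<lambda>i. f (n - i)) n y x"
proof -
  assume w: "walk f n x y"
  have "cayley_adjacent G A (f (n - i)) (f (n - Suc i))" if "i < n" for i
  proof -
    have "cayley_adjacent G A (f (n - Suc i)) (f (Suc (n - Suc i)))"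
      using w that by (auto simp: walk_def)
    then show ?thesis
      using that adjacent_sym by (simp add: Suc_diff_Suc)
  qed
  then show ?thesis
    using w by (auto simp: walk_def)
qed

lemma walk_translate: "walk f n x y \<Longrightarrow> g \<in> carrier G \<Longrightarrow> walk (\<lambda>i. g \<otimes> f i) n (g \<otimes> x) (g \<otimes> y)"
  unfolding walk_def by (auto intro!: adjacent_translate)

lemma walk_sub: "walk f n x y \<Longrightarrow> i \<le> j \<Longrightarrow> j \<le> n \<Longrightarrow> walk (\<lambda>k. f (i + k)) (j - i) (f i) (f j)"
  unfolding walk_def by auto

lemma walk_edge:
  "x \<in> carrier G \<Longrightarrow> y \<in> carrier G \<Longrightarrow> cayley_adjacent G A x y \<Longrightarrow> walk (\<lambda>i. if i = 0 then x else y) 1 x y"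
  by (auto simp: walk_def)

lemma ex_walk:
  assumes "x \<in> carrier G" "y \<in> carrier G"
  shows "\<exists>f n. walk f n x y"
proof -
  have "\<exists>f n. walk f n \<one> g" if "g \<in> generate G A" for g
    using that
  proof induction
    case one
    then show ?case using walk_refl by blast
  next
    case (incl h)
    then have "cayley_adjacent G A \<one> h" "h \<in> carrier G"
      using gens_closed by (auto simp: cayley_adjacent_def intro!: bexI[of _ h])
    then show ?case using walk_edge by blast
  next
    case (inv h)
    then have "cayley_adjacent G A \<one> (inv h)" "h \<in> carrier G"
      using gens_closed by (auto simp: cayley_adjacent_def intro!: bexI[of _ h])
    then show ?case using walk_edge by blast
  next
    case (eng h1 h2)
    then obtain f1 n1 f2 n2 where w: "walk f1 n1 \<one> h1" "walk f2 n2 \<one> h2"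
      by blast
    have "h1 \<in> carrier G"
      using eng gens_generate by auto
    then have "walk (\<lambda>i. h1 \<otimes> f2 i) n2 h1 (h1 \<otimes> h2)"
      using walk_translate[OF w(2), of h1] by simp
    then show ?case
      using walk_append[OF w(1)] by blast
  qed
  then obtain f n where "walk f n \<one> (inv x \<otimes> y)"
    using assms gens_generate by (metis inv_closed m_closed)
  from walk_translate[OF this assms(1)] show ?thesis
    using assms by auto
qed

lemma dist_le_walk: "walk f n x y \<Longrightarrow> dist x y \<le> n"
  unfolding dist_walk by (rule Least_le) blast

lemma ex_shortest_walk: "x \<in> carrier G \<Longrightarrow> y \<in> carrier G \<Longrightarrow> \<exists>f. walk f (dist x y) x y"
  unfolding dist_walk using LeastI_ex[of "\<lambda>n. \<exists>f. walk f n x y"] ex_walk by blast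

lemma cayley_dist_triangle:
  assumes "x \<in> carrier G" "y \<in> carrier G" "z \<in> carrier G"
  shows "dist x z \<le> dist x y + dist y z"
  using assms by (metis ex_shortest_walk walk_append dist_le_walk)

lemma cayley_dist_commute:
  assumes "x \<in> carrier G" "y \<in> carrier G"
  shows "dist x y = dist y x"
  using assms by (metis ex_shortest_walk walk_rev dist_le_walk order_antisym)

text \<open>A subwalk that could be shortened would shorten the whole walk.\<close>

lemma shortest_walk_dist:
  assumes w: "walk f (dist x y) x y" and ij: "i \<le> j" "j \<le> dist x y"
  shows "dist (f i) (f j) = j - i"
proof -
  have V: "f k \<in> carrier G" if "k \<le> dist x y" for k
    using w that by (auto simp: walk_def)
  have 0: "f 0 = x" "f (dist x y) = y"
    using w by (auto simp: walk_def)
  have le: "dist (f i) (f j) \<le> j - i" if "i \<le> j" "j \<le> dist x y" for i j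
    using walk_sub[OF w that] by (rule dist_le_walk)
  have "dist x y \<le> dist x (f i) + dist (f i) (f j) + dist (f j) y"
    using cayley_dist_triangle[of x "f i" y] cayley_dist_triangle[of "f i" "f j" y] V[of 0] V[of "dist x y"] V[of i] V[of j] 0 ij
    by auto
  then show ?thesis
    using le[of 0 i] le[of j "dist x y"] le[of i j] ij 0 by auto
qed

sublocale graph_metric "carrier G" dist
proof
  show "dist x x = 0" if "x \<in> carrier G" for x
    using dist_le_walk[OF walk_refl[OF that]] by simp
  show "\<exists>\<alpha> n. \<alpha> 0 = x \<and> \<alpha> n = y \<and> (\<forall>i\<le>n. \<alpha> i \<in> carrier G) \<and>
      (\<forall>i j. i \<le> j \<and> j \<le> n \<longrightarrow> dist (\<alpha> i) (\<alpha> j) = j - i)" if xy: "x \<in> carrier G" "y \<in> carrier G" for x y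
  proof -
    obtain f where "walk f (dist x y) x y"
      using ex_shortest_walk xy by blast
    then show ?thesis
      using shortest_walk_dist[of f x y] unfolding walk_def by blast
  qed
qed (simp_all add: cayley_dist_triangle cayley_dist_commute)

lemma dist_translate:
  assumes "x \<in> carrier G" "y \<in> carrier G" "g \<in> carrier G"
  shows "dist (g \<otimes> x) (g \<otimes> y) = dist x y"
proof -
  have le: "dist (g \<otimes> x) (g \<otimes> y) \<le> dist x y" if "x \<in> carrier G" "y \<in> carrier G" "g \<in> carrier G" for x y g
    using that by (metis ex_shortest_walk walk_translate dist_le_walk)
  have "dist x y = dist (inv g \<otimes> (g \<otimes> x)) (inv g \<otimes> (g \<otimes> y))"
    using assms by simp
  also have "\<dots> \<le> dist (g \<otimes> x) (g \<otimes> y)"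
    using assms by (intro le) auto
  finally show ?thesis
    using le[OF assms] by simp
qed

lemma dist_norm:
  assumes "x \<in> carrier G" "y \<in> carrier G"
  shows "dist x y = norm (inv x \<otimes> y)"
  using dist_translate[of x y "inv x"] assms by simp

lemma dist_mult_right: "x \<in> carrier G \<Longrightarrow> g \<in> carrier G \<Longrightarrow> dist x (x \<otimes> g) = norm g"
  using dist_translate[of \<one> g x] by simp

lemma norm_one [simp]: "norm \<one> = 0"
  by (simp add: dist_self)

lemma norm_inv [simp]: "g \<in> carrier G \<Longrightarrow> norm (inv g) = norm g"
  using dist_mult_right[of "inv g" g] dist_commute[of "inv g" \<one>] by simp

lemma norm_mult: "g \<in> carrier G \<Longrightarrow> h \<in> carrier G \<Longrightarrow> norm (g \<otimes> h) \<le> norm g + norm h"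
  using dist_triangle[of \<one> g "g \<otimes> h"] by (simp add: dist_mult_right)

lemma dist_adjacent:
  assumes "dist x y = 1" "x \<in> carrier G" "y \<in> carrier G"
  shows "cayley_adjacent G A x y"
  using ex_shortest_walk[OF assms(2,3)] assms(1) by (auto simp: walk_def)

lemma geod_walk:
  assumes g: "geod \<gamma> n x y"
  shows "walk \<gamma> n x y"
  using geod_ends[OF g] geod_in[OF g] geod_dist[OF g] dist_adjacent by (auto simp: walk_def)

lemma geod_cayley_geodesic: "geod \<gamma> n x y \<Longrightarrow> cayley_geodesic G A x (map \<gamma> [0..<Suc n]) y"
  unfolding cayley_geodesic_def using walk_path geod_walk geod_length by (metis Suc_eq_plus1 diff_zero length_map length_upt)

lemma cayley_geodesic_geod:
  assumes "cayley_geodesic G A x p y"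
  shows "geod (nth p) (length p - 1) x y"
proof -
  have w: "walk (nth p) (dist x y) x y" and l: "length p - 1 = dist x y"
    using assms path_walk[of x p y] by (auto simp: cayley_geodesic_def)
  then show ?thesis
    using shortest_walk_dist[OF w] by (auto simp: geod_def walk_def)
qed

lemma cayley_geodesic_rev:
  assumes "cayley_geodesic G A x p y"
  shows "geod (nth (rev p)) (length (rev p) - 1) y x"
proof -
  have g: "geod (\<lambda>i. p ! (length p - 1 - i)) (length p - 1) y x"
    using geod_rev cayley_geodesic_geod[OF assms] .
  have "length p > 0"
    using assms by (auto simp: cayley_geodesic_def)
  have rev: "rev p ! i = p ! (length p - 1 - i)" if "i \<le> length p - 1" for i
  proof -
    have "i < length p"
      using that \<open>length p > 0\<close> by linarith
    then show ?thesis
      by (simp add: rev_nth)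
  qed
  then show ?thesis
    using g rev unfolding geod_def by auto
qed

lemma slim_nbhd:
  assumes s: "slim \<delta>" and p: "geod (nth p) (length p - 1) x y" and q: "geod (nth q) (length q - 1) y z"
    and r: "geod (nth r) (length r - 1) x z" and ne: "p \<noteq> []" "q \<noteq> []"
  shows "set r \<subseteq> cayley_nbhd G A (real \<delta>) (set p \<union> set q)"
proof
  fix v assume "v \<in> set r"
  then obtain i where i: "i < length r" "v = r ! i"
    by (metis in_set_conv_nth)
  have "(\<exists>j\<le>length p - 1. dist (r ! i) (p ! j) \<le> \<delta>) \<or> (\<exists>j\<le>length q - 1. dist (r ! i) (q ! j) \<le> \<delta>)"
    using slimD[OF s p q r, of i] i by auto
  moreover have "j \<le> length p - 1 \<Longrightarrow> p ! j \<in> set p" "j \<le> length q - 1 \<Longrightarrow> q ! j \<in> set q" for j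
    using ne by (metis One_nat_def Suc_pred length_greater_0_conv less_Suc_eq_le nth_mem)+
  moreover have "v \<in> carrier G"
    using geod_in[OF r, of i] i by auto
  ultimately show "v \<in> cayley_nbhd G A (real \<delta>) (set p \<union> set q)"
    using i by (auto simp: cayley_nbhd_def)
qed

text \<open>The sides of the triangle run cyclically, whereas in \<open>slim\<close> the third side
  runs from the start of the first to the end of the second. In each case the two sides forming the
  neighbourhood are therefore reversed.\<close>

lemma slim_triangles:
  assumes s: "slim \<delta>" and t: "geodesic_triangle G A p q r"
  shows "set p \<subseteq> cayley_nbhd G A \<delta> (set q \<union> set r)"
    "set q \<subseteq> cayley_nbhd G A \<delta> (set r \<union> set p)"
    "set r \<subseteq> cayley_nbhd G A \<delta> (set p \<union> set q)"
proof -
  obtain x y z where g: "cayley_geodesic G A x p y" "cayley_geodesic G A y q z" "cayley_geodesic G A z r x"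
    using t by (auto simp: geodesic_triangle_def)
  then have ne: "p \<noteq> []" "q \<noteq> []" "r \<noteq> []"
    by (auto simp: cayley_geodesic_def)
  note f = g[THEN cayley_geodesic_geod] and b = g[THEN cayley_geodesic_rev]
  show "set p \<subseteq> cayley_nbhd G A \<delta> (set q \<union> set r)"
    using slim_nbhd[OF s b(3,2) f(1)] ne by (simp add: Un_commute)
  show "set q \<subseteq> cayley_nbhd G A \<delta> (set r \<union> set p)"
    using slim_nbhd[OF s b(1,3) f(2)] ne by (simp add: Un_commute)
  show "set r \<subseteq> cayley_nbhd G A \<delta> (set p \<union> set q)"
    using slim_nbhd[OF s b(2,1) f(3)] ne by (simp add: Un_commute)
qed

text \<open>Distances are natural numbers, so a real bound may be rounded down. The third geodesic
  is reversed to close the triangle.\<close>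

lemma triangles_slim:
  fixes \<delta> :: real
  assumes t: "\<And>p q r. geodesic_triangle G A p q r \<Longrightarrow> set r \<subseteq> cayley_nbhd G A \<delta> (set p \<union> set q)"
  shows "slim (nat \<lfloor>\<delta>\<rfloor>)"
  unfolding slim_def
proof (intro allI impI)
  fix x y z \<alpha> l \<beta> m \<gamma> n i
  assume g: "geod \<alpha> l x y" "geod \<beta> m y z" "geod \<gamma> n x z" and i: "i \<le> n"
  let ?l = "\<lambda>f n. map f [0..<Suc n]"
  have "geodesic_triangle G A (?l \<alpha> l) (?l \<beta> m) (?l (\<lambda>i. \<gamma> (n - i)) n)"
    unfolding geodesic_triangle_def
    using g[THEN geod_cayley_geodesic] geod_cayley_geodesic[OF geod_rev[OF g(3)]] by blast
  from t[OF this] have "\<gamma> i \<in> cayley_nbhd G A \<delta> (set (?l \<alpha> l) \<union> set (?l \<beta> m))"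
    using i by (auto simp del: upt_Suc simp: image_subset_iff dest!: bspec[of _ _ "n - i"])
  then obtain v where v: "v \<in> set (?l \<alpha> l) \<union> set (?l \<beta> m)" "real (dist (\<gamma> i) v) \<le> \<delta>"
    by (auto simp: cayley_nbhd_def)
  have "dist (\<gamma> i) v \<le> nat \<lfloor>\<delta>\<rfloor>"
    using v(2) by linarith
  then show "(\<exists>j\<le>l. dist (\<gamma> i) (\<alpha> j) \<le> nat \<lfloor>\<delta>\<rfloor>) \<or> (\<exists>j\<le>m. dist (\<gamma> i) (\<beta> j) \<le> nat \<lfloor>\<delta>\<rfloor>)"
    using v(1) by (auto simp del: upt_Suc simp: less_Suc_eq_le)
qed

section \<open>Words over the generators and finiteness of balls\<close>

lemma norm_gprod:
  "set xs \<subseteq> {g \<in> carrier G. norm g \<le> 1} \<Longrightarrow> norm (gprod G xs) \<le> length xs"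
proof (induction xs)
  case (Cons x xs)
  then have "set xs \<subseteq> carrier G"
    by auto
  then show ?case
    using Cons norm_mult[of x "gprod G xs"] gprod_closed[of xs] by auto
qed simp

lemma dist_gprod_take:
  assumes ws: "set ws \<subseteq> {g \<in> carrier G. norm g \<le> 1}" and x: "x \<in> carrier G" and ij: "i \<le> j"
  shows "dist (x \<otimes> gprod G (take i ws)) (x \<otimes> gprod G (take j ws)) \<le> j - i"
proof -
  have C: "set (take i ws) \<subseteq> carrier G" "set (take (j - i) (drop i ws)) \<subseteq> {g \<in> carrier G. norm g \<le> 1}"
    using ws by (auto dest!: in_set_takeD in_set_dropD)
  then have C'': "set (take (j - i) (drop i ws)) \<subseteq> carrier G"
    by blast
  with C have C': "gprod G (take i ws) \<in> carrier G" "gprod G (take (j - i) (drop i ws)) \<in> carrier G"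
    by auto
  note append = gprod_append[OF C(1) C'']
  have "take j ws = take i ws @ take (j - i) (drop i ws)"
    using ij by (metis le_add_diff_inverse take_add)
  then have "x \<otimes> gprod G (take j ws) = (x \<otimes> gprod G (take i ws)) \<otimes> gprod G (take (j - i) (drop i ws))"
    using C' x append by (simp add: m_assoc)
  then have "dist (x \<otimes> gprod G (take i ws)) (x \<otimes> gprod G (take j ws)) = norm (gprod G (take (j - i) (drop i ws)))"
    using C' x by (simp add: dist_mult_right)
  also have "\<dots> \<le> length (take (j - i) (drop i ws))"
    by (rule norm_gprod[OF C(2)])
  finally show ?thesis
    by simp
qed

lemma norm_gen: "a \<in> A \<union> m_inv G ` A \<Longrightarrow> a \<in> carrier G \<and> norm a \<le> 1"
proof -
  have "a \<in> carrier G \<and> norm a \<le> 1" if "a \<in> A" for a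
  proof -
    have "cayley_adjacent G A \<one> a" "a \<in> carrier G"
      using gens_closed that by (auto simp: cayley_adjacent_def intro!: bexI[of _ a])
    then show ?thesis
      using dist_le_walk[OF walk_edge[of \<one> a]] by auto
  qed
  then show "a \<in> A \<union> m_inv G ` A \<Longrightarrow> ?thesis"
    by auto
qed

lemma walk_word:
  "walk f n x y \<Longrightarrow> \<exists>ws. set ws \<subseteq> A \<union> m_inv G ` A \<and> length ws = n \<and> y = x \<otimes> gprod G ws"
proof (induction n arbitrary: y)
  case 0
  then show ?case by (auto simp: walk_def)
next
  case (Suc n)
  then have w: "walk f n x (f n)" and y: "y \<in> carrier G" "f n \<in> carrier G" "x \<in> carrier G"
    and adj: "cayley_adjacent G A (f n) y"
    by (auto simp: walk_def)
  obtain ws where ws: "set ws \<subseteq> A \<union> m_inv G ` A" "length ws = n" "f n = x \<otimes> gprod G ws"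
    using Suc.IH[OF w] by blast
  have wsC: "set ws \<subseteq> carrier G"
    using ws norm_gen by blast
  from adj obtain a where a: "a \<in> A" "y = f n \<otimes> a \<or> f n = y \<otimes> a"
    by (auto simp: cayley_adjacent_def)
  have aC: "a \<in> carrier G"
    using a gens_closed by auto
  have "\<exists>b\<in>A \<union> m_inv G ` A. y = f n \<otimes> b"
    using a(2)
  proof
    assume "f n = y \<otimes> a"
    then have "y = f n \<otimes> inv a"
      using y aC by (simp add: m_assoc)
    then show ?thesis
      using a by blast
  qed (use a in blast)
  then obtain b where b: "b \<in> A \<union> m_inv G ` A" "y = f n \<otimes> b"
    by blast
  then show ?case
    using ws wsC y norm_gen[OF b(1)]
    by (intro exI[of _ "ws @ [b]"]) (auto simp: gprod_append m_assoc)
qed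

lemma norm_word:
  assumes "g \<in> carrier G"
  shows "\<exists>ws. set ws \<subseteq> A \<union> m_inv G ` A \<and> length ws = norm g \<and> gprod G ws = g"
proof -
  obtain f where "walk f (norm g) \<one> g"
    using ex_shortest_walk assms by blast
  from walk_word[OF this] show ?thesis
    using norm_gen by (metis gprod_closed l_one subsetI subset_eq)
qed

lemma finite_ball:
  assumes "finite A"
  shows "finite {g \<in> carrier G. norm g \<le> r}"
proof (rule finite_subset)
  show "{g \<in> carrier G. norm g \<le> r} \<subseteq> gprod G ` {ws. set ws \<subseteq> A \<union> m_inv G ` A \<and> length ws \<le> r}"
    using norm_word by fastforce
  show "finite (gprod G ` {ws. set ws \<subseteq> A \<union> m_inv G ` A \<and> length ws \<le> r})"
    using assms by (intro finite_imageI finite_lists_length_le) auto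
qed

end

section \<open>Derivation trees\<close>

text \<open>Derivation trees in big-step form: induction over them gives access to the nodes and
  their yields, which sequences of sentential forms hide.\<close>

inductive yields :: "('n \<times> ('n, 't) grammar_symbol list) set \<Rightarrow> ('n, 't) grammar_symbol \<Rightarrow> 't list \<Rightarrow> bool"
  for P where
  yields_Terminal: "yields P (Terminal a) [a]"
| yields_Nonterminal: "(A, \<alpha>) \<in> P \<Longrightarrow> list_all2 (yields P) \<alpha> ws \<Longrightarrow> yields P (Nonterminal A) (concat ws)"

lemma derives_step_append: "derives_step P u v \<Longrightarrow> derives_step P (\<beta> @ u @ \<gamma>) (\<beta> @ v @ \<gamma>)"
proof (induction rule: derives_step.induct)
  case (1 A \<alpha> \<beta>' \<gamma>')
  show ?case
    using derives_step.intros[OF 1, of "\<beta> @ \<beta>'" "\<gamma>' @ \<gamma>"] by simp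
qed

lemma derives_append: "(derives_step P)\<^sup>*\<^sup>* u v \<Longrightarrow> (derives_step P)\<^sup>*\<^sup>* (\<beta> @ u @ \<gamma>) (\<beta> @ v @ \<gamma>)"
  by (induction rule: rtranclp_induct) (auto intro: derives_step_append rtranclp.rtrancl_into_rtrancl)

lemma derives_concat:
  "list_all2 (\<lambda>X w. (derives_step P)\<^sup>*\<^sup>* [X] (map Terminal w)) \<alpha> ws \<Longrightarrow>
    (derives_step P)\<^sup>*\<^sup>* \<alpha> (map Terminal (concat ws))"
proof (induction rule: list_all2_induct)
  case (Cons X \<alpha> w ws)
  have "(derives_step P)\<^sup>*\<^sup>* ([X] @ \<alpha>) (map Terminal w @ \<alpha>)"
    using derives_append[OF Cons(1), of "[]" \<alpha>] by simp
  also have "(derives_step P)\<^sup>*\<^sup>* (map Terminal w @ \<alpha>) (map Terminal w @ map Terminal (concat ws))"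
    using derives_append[OF Cons(3), of "map Terminal w" "[]"] by simp
  finally show ?case
    by simp
qed simp

lemma yields_derives: "yields P X w \<Longrightarrow> (derives_step P)\<^sup>*\<^sup>* [X] (map Terminal w)"
proof (induction rule: yields.induct)
  case (yields_Nonterminal A \<alpha> ws)
  have "(derives_step P)\<^sup>*\<^sup>* [Nonterminal A] \<alpha>"
    using derives_step.intros[OF yields_Nonterminal(1), of "[]" "[]"] by auto
  also have "(derives_step P)\<^sup>*\<^sup>* \<alpha> (map Terminal (concat ws))"
    using yields_Nonterminal(2) by (intro derives_concat) (auto elim: list_all2_mono)
  finally show ?case .
qed simp

text \<open>Read backwards from the terminal word, each derivation step joins the trees of a
  right-hand side under a new root.\<close>

lemma derives_yields:
  "(derives_step P)\<^sup>*\<^sup>* \<alpha> (map Terminal w) \<Longrightarrow> \<exists>ws. list_all2 (yields P) \<alpha> ws \<and> w = concat ws"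
proof (induction rule: converse_rtranclp_induct)
  case base
  have "list_all2 (yields P) (map Terminal w) (map (\<lambda>a. [a]) w)"
    by (auto simp: list.rel_map intro!: list.rel_refl_strong yields_Terminal)
  moreover have "w = concat (map (\<lambda>a. [a]) w)"
    by (induction w) auto
  ultimately show ?case
    by blast
next
  case (step \<alpha>1 \<alpha>2)
  then obtain ws where ws: "list_all2 (yields P) \<alpha>2 ws" "w = concat ws"
    by blast
  from step(1) show ?case
  proof cases
    case (1 A \<alpha> \<beta> \<gamma>)
    from ws(1) 1 obtain w1 w2 w3 where w: "ws = w1 @ w2 @ w3" "list_all2 (yields P) \<beta> w1"
      "list_all2 (yields P) \<alpha> w2" "list_all2 (yields P) \<gamma> w3"
      by (auto simp: list_all2_append1)
    have "list_all2 (yields P) \<alpha>1 (w1 @ [concat w2] @ w3)"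
      using w 1 by (auto intro!: list_all2_appendI yields_Nonterminal)
    then show ?thesis
      using w ws by (intro exI[of _ "w1 @ [concat w2] @ w3"]) auto
  qed
qed

lemma generated_language_yields: "generated_language P S = {w. yields P (Nonterminal S) w}"
proof -
  have "yields P (Nonterminal S) w" if "(derives_step P)\<^sup>*\<^sup>* [Nonterminal S] (map Terminal w)" for w
    using derives_yields[OF that] by (auto simp: list_all2_Cons1)
  then show ?thesis
    by (auto simp: generated_language_def yields_derives)
qed

lemma yields_rename:
  "yields P X w \<Longrightarrow>
    yields ((\<lambda>(A, \<alpha>). (f A, map (map_grammar_symbol f id) \<alpha>)) ` P) (map_grammar_symbol f id X) w"
proof (induction rule: yields.induct)
  case (yields_Nonterminal A \<alpha> ws)
  then show ?case
    by (auto intro!: yields.yields_Nonterminal image_eqI[of _ _ "(A, \<alpha>)"] simp: list.rel_map elim: list_all2_mono)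
qed (auto intro: yields.yields_Terminal)

text \<open>Context-freeness is defined with natural numbers as nonterminals, while the grammar
  built later has structured ones. An injection on \<open>N\<close> renames them, and renaming back
  by its inverse shows that no word is gained.\<close>

lemma context_freeI:
  fixes N :: "'n set" and P :: "('n \<times> ('n, 't) grammar_symbol list) set"
  assumes N: "finite N" "S \<in> N" and P: "finite P"
    and sub: "\<And>A \<alpha>. (A, \<alpha>) \<in> P \<Longrightarrow> A \<in> N \<and> set \<alpha> \<subseteq> Nonterminal ` N \<union> Terminal ` \<Gamma>"
    and L: "L = {w. yields P (Nonterminal S) w}"
  shows "context_free_language \<Gamma> L"
proof -
  obtain f :: "'n \<Rightarrow> nat" where f: "inj_on f N"
    using finite_imp_inj_to_nat_seg[OF N(1)] by blast
  define g where "g = inv_into N f"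
  have gf: "g (f A) = A" if "A \<in> N" for A
    using f that by (simp add: g_def)
  let ?r = "\<lambda>f (A, \<alpha>). (f A, map (map_grammar_symbol f id) \<alpha>)"
  have ren_back: "?r g (?r f p) = p" if "p \<in> P" for p
  proof -
    obtain A \<alpha> where p: "p = (A, \<alpha>)"
      by (cases p)
    have "map_grammar_symbol g id (map_grammar_symbol f id X) = X" if "X \<in> set \<alpha>" for X
      using sub[of A \<alpha>] that p \<open>p \<in> P\<close> gf by auto
    then have "map (map_grammar_symbol g id \<circ> map_grammar_symbol f id) \<alpha> = \<alpha>"
      by (intro map_idI) auto
    then show ?thesis
      using p sub[of A \<alpha>] \<open>p \<in> P\<close> gf by auto
  qed
  have "?r g ` ?r f ` P = P"
    unfolding image_image using ren_back by (auto intro!: image_eqI[where f = "\<lambda>p. ?r g (?r f p)"])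
  then have yf: "yields (?r f ` P) (Nonterminal (f S)) w \<longleftrightarrow> yields P (Nonterminal S) w" for w
    using yields_rename[of P "Nonterminal S" w f] yields_rename[of "?r f ` P" "Nonterminal (f S)" w g] gf[OF N(2)]
    by auto
  show ?thesis
    unfolding context_free_language_def
  proof (intro exI conjI)
    show "finite (f ` N)" "f S \<in> f ` N" "finite (?r f ` P)"
      using N P by auto
    show "\<forall>(A, \<alpha>)\<in>?r f ` P. A \<in> f ` N \<and> set \<alpha> \<subseteq> Nonterminal ` f ` N \<union> Terminal ` \<Gamma>"
    proof clarsimp
      fix A \<alpha> assume "(A, \<alpha>) \<in> P"
      then show "f A \<in> f ` N \<and> map_grammar_symbol f id ` set \<alpha> \<subseteq> Nonterminal ` f ` N \<union> Terminal ` \<Gamma>"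
        using sub[of A \<alpha>] by (fastforce simp: image_iff)
    qed
    show "L = generated_language (?r f ` P) (f S)"
      unfolding generated_language_yields yf L ..
  qed
qed

lemma length_concat_le: "(\<And>w. w \<in> set ws \<Longrightarrow> length w \<le> K) \<Longrightarrow> length (concat ws) \<le> length ws * K"
proof (induction ws)
  case (Cons w ws)
  then have "length w \<le> K" "length (concat ws) \<le> length ws * K"
    by auto
  then show ?case
    by simp
qed simp

text \<open>
  The node found here is the lowest one above the position between \<open>x\<close> and \<open>y\<close> whose yield still
  contains the marker \<open>c\<close>: its children to the right of that position yield words without \<open>c\<close>.
\<close>

lemma yields_crossing:
  assumes "yields P X w" "w = x @ y" "c \<in> set x" "c \<notin> set y" "X \<in> S"
    and "\<And>\<alpha> \<xi> \<gamma> Y. w = \<alpha> @ \<xi> @ \<gamma> \<Longrightarrow> c \<in> set \<alpha> \<Longrightarrow> c \<notin> set \<xi> \<Longrightarrow> c \<notin> set \<gamma> \<Longrightarrow> Y \<in> S \<Longrightarrow>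
      yields P Y \<xi> \<Longrightarrow> (\<And>\<xi>'. yields P Y \<xi>' \<Longrightarrow> yields P X (\<alpha> @ \<xi>' @ \<gamma>)) \<Longrightarrow> length \<xi> \<le> K"
    and P: "\<And>A \<alpha>. (A, \<alpha>) \<in> P \<Longrightarrow> set \<alpha> \<subseteq> S \<and> length \<alpha> \<le> M"
  shows "\<exists>\<alpha> \<beta> \<gamma> Y. w = \<alpha> @ \<beta> @ \<gamma> \<and> c \<in> set \<beta> \<and> c \<notin> set \<gamma> \<and> Y \<in> S \<and> yields P Y \<beta> \<and>
    (\<forall>\<beta>'. yields P Y \<beta>' \<longrightarrow> yields P X (\<alpha> @ \<beta>' @ \<gamma>)) \<and>
    length \<gamma> \<le> length y \<and> length y \<le> length \<gamma> + M * K"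
  using assms(1-6)
proof (induction arbitrary: x y rule: yields.induct)
  case (yields_Terminal a)
  then have "x = [c]" "y = []" "a = c"
    by (auto simp: append_eq_Cons_conv Cons_eq_append_conv)
  then show ?case
    using yields_Terminal by (intro exI[of _ "[]"] exI[of _ "[c]"] exI[of _ "Terminal c"]) (auto intro: yields.intros)
next
  case (yields_Nonterminal A \<alpha> ws)
  note prems = yields_Nonterminal.prems
  have yl: "list_all2 (yields P) \<alpha> ws"
    using yields_Nonterminal(2) by (auto elim: list_all2_mono)
  have "ws \<noteq> []"
    using prems by auto
  \<comment> \<open>The cut between \<open>x\<close> and \<open>y\<close> falls into a single child,
    with yield \<open>u @ v\<close>.\<close>
  then obtain w1 u v w2 where ws: "ws = w1 @ (u @ v) # w2" and x: "x = concat w1 @ u" and y: "y = v @ concat w2"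
    using prems(1) by (auto simp: concat_eq_append_conv)
  have replace: "yields P (Nonterminal A) (concat v1 @ \<xi>' @ concat v2)"
    if "ws = v1 @ \<xi> # v2" "\<alpha> = \<alpha>1 @ Y # \<alpha>2" "length v1 = length \<alpha>1" "yields P Y \<xi>'" for v1 v2 \<xi> \<xi>' Y \<alpha>1 \<alpha>2
  proof -
    have "list_all2 (yields P) \<alpha> (v1 @ \<xi>' # v2)"
      using yl that by (auto simp: list_all2_append)
    from yields.yields_Nonterminal[OF yields_Nonterminal(1) this] show ?thesis
      by simp
  qed
  have split: "\<exists>\<alpha>1 Y \<alpha>2. \<alpha> = \<alpha>1 @ Y # \<alpha>2 \<and> length v1 = length \<alpha>1 \<and> Y \<in> S \<and> yields P Y \<xi>"
    if "ws = v1 @ \<xi> # v2" for v1 \<xi> v2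
    using yl that P[OF yields_Nonterminal(1)] by (fastforce simp: list_all2_append2 list_all2_Cons2 dest: list_all2_lengthD)
  \<comment> \<open>If the marker occurs in that child to the left of the cut, descend into the
    child; the yields of its right neighbours join the new \<gamma>. Otherwise the marker lies in
    earlier children and the present node is the one wanted: the child at the cut and those after it
    are free of \<open>c\<close>, there are at most \<open>M\<close> of them, and each yields at
    most \<open>K\<close> letters.\<close>
  show ?case
  proof (cases "c \<in> set u")
    case True
    obtain \<alpha>1 Y \<alpha>2 where Y: "\<alpha> = \<alpha>1 @ Y # \<alpha>2" "length w1 = length \<alpha>1" "Y \<in> S" "yields P Y (u @ v)"
      using split[OF ws] by blast
    have IH: "\<And>x y. u @ v = x @ y \<Longrightarrow> c \<in> set x \<Longrightarrow> c \<notin> set y \<Longrightarrow> Y \<in> S \<Longrightarrow>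
       (\<And>\<alpha> \<xi> \<gamma> Z. u @ v = \<alpha> @ \<xi> @ \<gamma> \<Longrightarrow> c \<in> set \<alpha> \<Longrightarrow> c \<notin> set \<xi> \<Longrightarrow> c \<notin> set \<gamma> \<Longrightarrow> Z \<in> S \<Longrightarrow>
      yields P Z \<xi> \<Longrightarrow> (\<And>\<xi>'. yields P Z \<xi>' \<Longrightarrow> yields P Y (\<alpha> @ \<xi>' @ \<gamma>)) \<Longrightarrow> length \<xi> \<le> K) \<Longrightarrow>
      \<exists>\<alpha> \<beta> \<gamma> Z. u @ v = \<alpha> @ \<beta> @ \<gamma> \<and> c \<in> set \<beta> \<and> c \<notin> set \<gamma> \<and> Z \<in> S \<and> yields P Z \<beta> \<and>
    (\<forall>\<beta>'. yields P Z \<beta>' \<longrightarrow> yields P Y (\<alpha> @ \<beta>' @ \<gamma>)) \<and>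
    length \<gamma> \<le> length y \<and> length y \<le> length \<gamma> + M * K"
      using yields_Nonterminal(2) Y(1,2) unfolding ws by (auto simp: list_all2_append)
    have "\<exists>\<alpha> \<beta> \<gamma> Z. u @ v = \<alpha> @ \<beta> @ \<gamma> \<and> c \<in> set \<beta> \<and> c \<notin> set \<gamma> \<and> Z \<in> S \<and> yields P Z \<beta> \<and>
      (\<forall>\<beta>'. yields P Z \<beta>' \<longrightarrow> yields P Y (\<alpha> @ \<beta>' @ \<gamma>)) \<and>
      length \<gamma> \<le> length v \<and> length v \<le> length \<gamma> + M * K"
    proof (rule IH[OF refl True _ Y(3)])
      fix \<alpha>' \<xi> \<gamma> Z
      assume a: "u @ v = \<alpha>' @ \<xi> @ \<gamma>" "c \<in> set \<alpha>'" "c \<notin> set \<xi>" "c \<notin> set \<gamma>" "Z \<in> S" "yields P Z \<xi>"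
        and r: "\<And>\<xi>'. yields P Z \<xi>' \<Longrightarrow> yields P Y (\<alpha>' @ \<xi>' @ \<gamma>)"
      show "length \<xi> \<le> K"
      proof (rule prems(5)[of "concat w1 @ \<alpha>'" \<xi> "\<gamma> @ concat w2" Z])
        show "concat ws = (concat w1 @ \<alpha>') @ \<xi> @ \<gamma> @ concat w2"
          using a(1) ws by simp
        show "yields P (Nonterminal A) ((concat w1 @ \<alpha>') @ \<xi>' @ \<gamma> @ concat w2)" if "yields P Z \<xi>'" for \<xi>'
          using replace[OF ws Y(1,2) r[OF that]] by simp
      qed (use a prems y in auto)
    qed (use prems y in auto)
    then obtain \<alpha>' \<beta> \<gamma> Z where Z: "u @ v = \<alpha>' @ \<beta> @ \<gamma>" "c \<in> set \<beta>" "c \<notin> set \<gamma>" "Z \<in> S" "yields P Z \<beta>"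
      "\<forall>\<beta>'. yields P Z \<beta>' \<longrightarrow> yields P Y (\<alpha>' @ \<beta>' @ \<gamma>)" "length \<gamma> \<le> length v" "length v \<le> length \<gamma> + M * K"
      by blast
    have "yields P (Nonterminal A) ((concat w1 @ \<alpha>') @ \<beta>' @ \<gamma> @ concat w2)" if "yields P Z \<beta>'" for \<beta>'
      using replace[OF ws Y(1,2), of "\<alpha>' @ \<beta>' @ \<gamma>"] Z(6) that by simp
    then show ?thesis
      using Z ws y prems
      by (intro exI[of _ "concat w1 @ \<alpha>'"] exI[of _ \<beta>] exI[of _ "\<gamma> @ concat w2"] exI[of _ Z]) auto
  next
    case False
    then have c1: "c \<in> set (concat w1)"
      using prems x by auto
    have short: "length \<xi> \<le> K" if ww: "ws = v1 @ \<xi> # v2" and c: "c \<in> set (concat v1)" "c \<notin> set \<xi>" "c \<notin> set (concat v2)" for v1 \<xi> v2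
    proof -
      obtain \<alpha>1 Y \<alpha>2 where Y: "\<alpha> = \<alpha>1 @ Y # \<alpha>2" "length v1 = length \<alpha>1" "Y \<in> S" "yields P Y \<xi>"
        using split[OF ww] by blast
      show ?thesis
        by (rule prems(5)[of "concat v1" \<xi> "concat v2" Y]) (use Y ww c replace[OF ww Y(1,2)] in auto)
    qed
    have "length w' \<le> K" if "w' \<in> set ((u @ v) # w2)" for w'
    proof -
      have "\<exists>a b. (u @ v) # w2 = a @ w' # b"
        using that by (rule split_list)
      then obtain a b where ab: "(u @ v) # w2 = a @ w' # b"
        by blast
      then have "concat a @ w' @ concat b = u @ v @ concat w2"
        by (metis append_assoc concat.simps(2) concat_append)
      then have "c \<notin> set w'" "c \<notin> set (concat b)"
        using False prems y by (metis Un_iff set_append)+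
      then show ?thesis
        using short[of "w1 @ a" w' b] ws ab c1 by simp
    qed
    then have "length (concat ((u @ v) # w2)) \<le> length ((u @ v) # w2) * K"
      by (rule length_concat_le)
    also have "\<dots> \<le> length \<alpha> * K"
      using list_all2_lengthD[OF yl] ws by (intro mult_le_mono1) auto
    also have "\<dots> \<le> M * K"
      using P[OF yields_Nonterminal(1)] by (intro mult_le_mono1) auto
    finally have "length y \<le> M * K"
      using y by simp
    then show ?thesis
      using prems yields.yields_Nonterminal[OF yields_Nonterminal(1) yl]
      by (intro exI[of _ "[]"] exI[of _ "concat ws"] exI[of _ "Nonterminal A"]) auto
  qed
qed

lemma ex_short_yields:
  assumes "finite S"
  shows "\<exists>K. \<forall>Y\<in>S. \<forall>\<beta>. yields P Y \<beta> \<longrightarrow> (\<exists>\<beta>'. yields P Y \<beta>' \<and> length \<beta>' \<le> K)"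
  using assms
proof induction
  case (insert X S)
  then obtain K where K: "\<forall>Y\<in>S. \<forall>\<beta>. yields P Y \<beta> \<longrightarrow> (\<exists>\<beta>'. yields P Y \<beta>' \<and> length \<beta>' \<le> K)"
    by blast
  show ?case
  proof (cases "\<exists>\<beta>. yields P X \<beta>")
    case True
    then obtain \<beta> where "yields P X \<beta>"
      by blast
    then show ?thesis
      using K by (intro exI[of _ "max K (length \<beta>)"]) (auto simp: le_max_iff_disj)
  qed (use K in auto)
qed auto

text \<open>The crossing argument in a form that no longer mentions the grammar. The inner premise
  is minimality: a factor behind the last marker cannot be exchanged within \<open>L\<close> for a
  shorter one. Each symbol that yields a word yields one of bounded length, so nodes behind the
  marker have bounded yields; \<beta>' is such a short yield of the node found. One constant serves
  both bounds, because \<open>1 \<le> M\<close>.\<close>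

lemma context_free_crossing:
  assumes "context_free_language \<Gamma> L"
  shows "\<exists>K. \<forall>x y c. x @ y \<in> L \<longrightarrow> c \<in> set x \<longrightarrow> c \<notin> set y \<longrightarrow>
    (\<forall>\<alpha> \<xi> \<gamma> \<xi>'. x @ y = \<alpha> @ \<xi> @ \<gamma> \<longrightarrow> c \<in> set \<alpha> \<longrightarrow> c \<notin> set \<xi> \<longrightarrow> c \<notin> set \<gamma> \<longrightarrow>
       \<alpha> @ \<xi>' @ \<gamma> \<in> L \<longrightarrow> length \<xi> \<le> length \<xi>') \<longrightarrow>
    (\<exists>\<alpha> \<beta> \<gamma> \<beta>'. x @ y = \<alpha> @ \<beta> @ \<gamma> \<and> c \<in> set \<beta> \<and> c \<notin> set \<gamma> \<and> \<alpha> @ \<beta>' @ \<gamma> \<in> L \<and>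
       length \<beta>' \<le> K \<and> length \<gamma> \<le> length y \<and> length y \<le> length \<gamma> + K)"
proof -
  from assms obtain P and S :: nat where P: "finite P" and gen: "L = generated_language P S"
    unfolding context_free_language_def by auto
  have L: "L = {w. yields P (Nonterminal S) w}"
    using gen by (simp add: generated_language_yields)
  define Syms where "Syms = insert (Nonterminal S) (\<Union>(A, \<alpha>)\<in>P. set \<alpha>)"
  have "finite Syms"
    using P by (auto simp: Syms_def)
  from ex_short_yields[OF this, of P] obtain K where
    K: "\<And>Y \<beta>. Y \<in> Syms \<Longrightarrow> yields P Y \<beta> \<Longrightarrow> \<exists>\<beta>'. yields P Y \<beta>' \<and> length \<beta>' \<le> K"
    by blast
  define M where "M = Max (insert 1 ((\<lambda>(A, \<alpha>). length \<alpha>) ` P))"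
  have M: "set \<alpha> \<subseteq> Syms \<and> length \<alpha> \<le> M" if "(A, \<alpha>) \<in> P" for A \<alpha>
    using that P by (force simp: Syms_def M_def intro!: Max_ge)
  have "1 \<le> M"
    using P by (auto simp: M_def intro!: Max_ge)
  then have KM: "K \<le> M * K"
    by simp
  show ?thesis
  proof (rule exI[of _ "M * K"], intro allI impI)
    fix x y c
    assume xy: "x @ y \<in> L" "c \<in> set x" "c \<notin> set y"
      and short: "\<forall>\<alpha> \<xi> \<gamma> \<xi>'. x @ y = \<alpha> @ \<xi> @ \<gamma> \<longrightarrow> c \<in> set \<alpha> \<longrightarrow> c \<notin> set \<xi> \<longrightarrow> c \<notin> set \<gamma> \<longrightarrow>
       \<alpha> @ \<xi>' @ \<gamma> \<in> L \<longrightarrow> length \<xi> \<le> length \<xi>'"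
    have "\<exists>\<alpha> \<beta> \<gamma> Y. x @ y = \<alpha> @ \<beta> @ \<gamma> \<and> c \<in> set \<beta> \<and> c \<notin> set \<gamma> \<and> Y \<in> Syms \<and> yields P Y \<beta> \<and>
      (\<forall>\<beta>'. yields P Y \<beta>' \<longrightarrow> yields P (Nonterminal S) (\<alpha> @ \<beta>' @ \<gamma>)) \<and>
      length \<gamma> \<le> length y \<and> length y \<le> length \<gamma> + M * K"
    proof (rule yields_crossing[OF _ refl xy(2,3) _ _ M])
      fix \<alpha> \<xi> \<gamma> Y
      assume a: "x @ y = \<alpha> @ \<xi> @ \<gamma>" "c \<in> set \<alpha>" "c \<notin> set \<xi>" "c \<notin> set \<gamma>" "Y \<in> Syms" "yields P Y \<xi>"
        and r: "\<And>\<xi>'. yields P Y \<xi>' \<Longrightarrow> yields P (Nonterminal S) (\<alpha> @ \<xi>' @ \<gamma>)"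
      obtain \<xi>' where "yields P Y \<xi>'" "length \<xi>' \<le> K"
        using K[OF a(5,6)] by blast
      moreover from this have "length \<xi> \<le> length \<xi>'"
        using short a r L by blast
      ultimately show "length \<xi> \<le> K"
        by simp
    qed (use xy L in \<open>auto simp: Syms_def\<close>)
    then obtain \<alpha> \<beta> \<gamma> Y where Y: "x @ y = \<alpha> @ \<beta> @ \<gamma>" "c \<in> set \<beta>" "c \<notin> set \<gamma>" "Y \<in> Syms" "yields P Y \<beta>"
      "\<And>\<beta>'. yields P Y \<beta>' \<Longrightarrow> yields P (Nonterminal S) (\<alpha> @ \<beta>' @ \<gamma>)"
      "length \<gamma> \<le> length y" "length y \<le> length \<gamma> + M * K"
      by blast
    obtain \<beta>' where "yields P Y \<beta>'" "length \<beta>' \<le> K"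
      using K[OF Y(4,5)] by blast
    then have "\<alpha> @ \<beta>' @ \<gamma> \<in> L" "length \<beta>' \<le> M * K"
      using Y(6) L order_trans[OF _ KM] by blast+
    then show "\<exists>\<alpha> \<beta> \<gamma> \<beta>'. x @ y = \<alpha> @ \<beta> @ \<gamma> \<and> c \<in> set \<beta> \<and> c \<notin> set \<gamma> \<and> \<alpha> @ \<beta>' @ \<gamma> \<in> L \<and>
       length \<beta>' \<le> M * K \<and> length \<gamma> \<le> length y \<and> length y \<le> length \<gamma> + M * K"
      using Y(1-3,7,8) by blast
  qed
qed

section \<open>From a context-free multiplication table to slim triangles\<close>

definition word_value :: "('a, 'b) monoid_scheme \<Rightarrow> ('c \<Rightarrow> 'a) \<Rightarrow> 'c list \<Rightarrow> 'a" where
  "word_value G val w = gprod G (map val w)"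

text \<open>Factorisations that come from a grammar ignore the separators. This and the following
  lemmas locate their cuts relative to the separators of a table word.\<close>

lemma separator_suffix:
  assumes "None \<notin> set \<rho>" "\<alpha> @ \<rho> = \<pi> @ None # map Some t"
  shows "\<exists>s r. \<alpha> = \<pi> @ None # map Some s \<and> \<rho> = map Some r \<and> t = s @ r"
proof -
  from assms(2) obtain us where "(\<alpha> = \<pi> @ us \<and> us @ \<rho> = None # map Some t) \<or> (\<alpha> @ us = \<pi> \<and> \<rho> = us @ None # map Some t)"
    by (auto simp: append_eq_append_conv2)
  then show ?thesis
  proof
    assume us: "\<alpha> = \<pi> @ us \<and> us @ \<rho> = None # map Some t"
    then obtain vs where vs: "us = None # vs" "vs @ \<rho> = map Some t"
      using assms(1) by (cases us) auto
    then show ?thesis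
      using us by (metis append_eq_map_conv)
  qed (use assms(1) in auto)
qed

lemma separator_prefix:
  "\<alpha> @ \<beta> = map Some u @ None # q \<Longrightarrow>
    (\<exists>a b. \<alpha> = map Some a \<and> u = a @ b \<and> \<beta> = map Some b @ None # q) \<or>
    (\<exists>\<alpha>'. \<alpha> = map Some u @ None # \<alpha>' \<and> \<alpha>' @ \<beta> = q)"
proof (induction u arbitrary: \<alpha>)
  case (Cons x u)
  show ?case
  proof (cases \<alpha>)
    case (Cons y ys)
    then have "ys @ \<beta> = map Some u @ None # q" "y = Some x"
      using Cons.prems by auto
    with Cons.IH[of ys] Cons show ?thesis
      by (auto intro: exI[of _ "x # a" for a])
  qed (use Cons.prems in auto)
qed (auto simp: append_eq_Cons_conv)

lemma separator_prefix_Some: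
  "map Some a @ \<beta> = map Some u @ None # q \<Longrightarrow> \<exists>b. u = a @ b"
proof (induction a arbitrary: u)
  case (Cons x a)
  then show ?case
    by (cases u) auto
qed simp

lemma separator_unique: "map Some u @ None # p = map Some v @ None # q \<Longrightarrow> u = v \<and> p = q"
  by (induction u arbitrary: v) (auto simp: Cons_eq_append_conv split: list.splits elim: list.set_cases)

lemma (in group) mult_eq_mult_imp:
  assumes eq: "p \<otimes> q = g \<otimes> s" and C: "p \<in> carrier G" "q \<in> carrier G" "g \<in> carrier G" "s \<in> carrier G"
  shows "inv g \<otimes> p = s \<otimes> inv q"
proof -
  have "p = (p \<otimes> q) \<otimes> inv q"
    using C by (simp add: m_assoc)
  also have "\<dots> = g \<otimes> (s \<otimes> inv q)"
    unfolding eq using C by (simp add: m_assoc)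
  finally have "inv g \<otimes> p = inv g \<otimes> (g \<otimes> (s \<otimes> inv q))"
    by simp
  then show ?thesis
    using C by simp
qed

text \<open>Stated with \<open>word_value\<close> in place of the homomorphism, so that the empty
  word has a value and all prefixes of combing words can be evaluated as vertices.\<close>

lemma word_hyperbolic_slim:
  fixes G (structure)
  assumes G: "cayley_graph G A" and fin: "finite \<Sigma>" and A: "A = val ` \<Sigma>" and R: "R \<subseteq> lists \<Sigma>"
    and surj: "\<And>g. g \<in> carrier G \<Longrightarrow> \<exists>w\<in>R. word_value G val w = g"
    and T: "T = {map Some u @ [None] @ map Some v @ [None] @ map Some (rev w) | u v w.
        u \<in> R \<and> v \<in> R \<and> w \<in> R \<and> word_value G val u \<otimes>\<^bsub>G\<^esub> word_value G val v = word_value G val w}"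
    and cf: "context_free_language \<Gamma> T"
  shows "\<exists>\<delta>. graph_metric.slim (carrier G) (cayley_dist G A) \<delta>"
proof -
  interpret cayley_graph G A by (rule G)
  let ?F = "word_value G val"
  have val: "val a \<in> carrier G" "norm (val a) \<le> 1" if "a \<in> \<Sigma>" for a
    using norm_gen[of "val a"] A that by blast+
  have F_closed: "?F w \<in> carrier G" if "w \<in> lists \<Sigma>" for w
    using that val by (auto simp: word_value_def intro!: gprod_closed)
  have F_append: "?F (u @ v) = ?F u \<otimes> ?F v" if "u \<in> lists \<Sigma>" "v \<in> lists \<Sigma>" for u v
    using that val gprod_append[of "map val u" "map val v"] by (auto simp: word_value_def)
  have F_norm: "norm (?F w) \<le> length w" if "w \<in> lists \<Sigma>" for w
    using that val norm_gprod[of "map val w"] by (auto simp: word_value_def)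
  define W where "W g = (SOME w. (w \<in> R \<and> ?F w = g) \<and> (\<forall>v. v \<in> R \<and> ?F v = g \<longrightarrow> length w \<le> length v))" for g
  have W_prop: "(W g \<in> R \<and> ?F (W g) = g) \<and> (\<forall>v. v \<in> R \<and> ?F v = g \<longrightarrow> length (W g) \<le> length v)"
    if g: "g \<in> carrier G" for g
  proof -
    obtain w where "w \<in> R \<and> ?F w = g"
      using surj[OF g] by blast
    from ex_has_least_nat[of "\<lambda>w. w \<in> R \<and> ?F w = g", OF this, of length] show ?thesis
      unfolding W_def by (rule someI_ex)
  qed
  have W: "W g \<in> R \<and> ?F (W g) = g" if "g \<in> carrier G" for g
    using W_prop[OF that] by simp
  have W_min: "length (W g) \<le> length w" if "w \<in> R" "?F w = g" for g w
    using W_prop[of g] F_closed[of w] R that by blast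
  have W_lists: "W g \<in> lists \<Sigma>" "take i (W g) \<in> lists \<Sigma>" "drop i (W g) \<in> lists \<Sigma>" if "g \<in> carrier G" for g i
    using W[OF that] R by (auto dest: in_set_takeD in_set_dropD)
  define L where "L x y i = x \<otimes> ?F (take i (W (inv x \<otimes> y)))" for x y i
  define len where "len x y = length (W (inv x \<otimes> y))" for x y
  have L_closed: "L x y i \<in> carrier G" if "x \<in> carrier G" "y \<in> carrier G" for x y i
    using that W_lists F_closed by (simp add: L_def)
  have L_dist: "dist (L x y i) (L x y j) \<le> j - i" if "x \<in> carrier G" "y \<in> carrier G" "i \<le> j" for x y i j
  proof -
    have "inv x \<otimes> y \<in> carrier G"
      using that by simp
    then have "set (map val (W (inv x \<otimes> y))) \<subseteq> {g \<in> carrier G. norm g \<le> 1}"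
      using W_lists(1) val by auto
    from dist_gprod_take[OF this that(1,3)] show ?thesis
      by (simp add: L_def word_value_def take_map)
  qed
  from context_free_crossing[OF cf] obtain K where "\<forall>x y c. x @ y \<in> T \<longrightarrow> c \<in> set x \<longrightarrow> c \<notin> set y \<longrightarrow>
    (\<forall>\<alpha> \<xi> \<gamma> \<xi>'. x @ y = \<alpha> @ \<xi> @ \<gamma> \<longrightarrow> c \<in> set \<alpha> \<longrightarrow> c \<notin> set \<xi> \<longrightarrow> c \<notin> set \<gamma> \<longrightarrow>
       \<alpha> @ \<xi>' @ \<gamma> \<in> T \<longrightarrow> length \<xi> \<le> length \<xi>') \<longrightarrow>
    (\<exists>\<alpha> \<beta> \<gamma> \<beta>'. x @ y = \<alpha> @ \<beta> @ \<gamma> \<and> c \<in> set \<beta> \<and> c \<notin> set \<gamma> \<and> \<alpha> @ \<beta>' @ \<gamma> \<in> T \<and>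
       length \<beta>' \<le> K \<and> length \<gamma> \<le> length y \<and> length y \<le> length \<gamma> + K)" ..
  note K = this[rule_format]
  define c where "c = Max (length ` W ` {g \<in> carrier G. norm g \<le> 1})"
  have L_slim: "(\<exists>j\<le>len x y. dist (L x z i) (L x y j) \<le> 2 * K) \<or> (\<exists>j\<le>len y z. dist (L x z i) (L y z j) \<le> 2 * K)"
    if V: "x \<in> carrier G" "y \<in> carrier G" "z \<in> carrier G" and i: "i \<le> len x z" for x y z i
  proof -
    define u where "u = W (inv x \<otimes> y)"
    define v where "v = W (inv y \<otimes> z)"
    define w where "w = W (inv x \<otimes> z)"
    have uvw: "u \<in> R" "v \<in> R" "w \<in> R" "?F u = inv x \<otimes> y" "?F v = inv y \<otimes> z" "?F w = inv x \<otimes> z"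
      using V W by (auto simp: u_def v_def w_def)
    have lists: "u \<in> lists \<Sigma>" "v \<in> lists \<Sigma>" "w \<in> lists \<Sigma>"
      using uvw R by auto
    have eq: "?F u \<otimes> ?F v = ?F w"
      using uvw V by (simp add: m_assoc)
    \<comment> \<open>The cut is placed so that \<open>Y\<close> is the reversal of the first
      \<open>i\<close> letters of \<open>w\<close>; it corresponds to the vertex
      \<open>L x z i\<close>.\<close>
    define X where "X = map Some u @ None # map Some v @ None # map Some (rev (drop i w))"
    define Y where "Y = map (Some :: _ \<Rightarrow> _ option) (rev (take i w))"
    have XY: "X @ Y = map Some u @ None # map Some v @ None # map Some (rev w)"
      by (simp add: X_def Y_def flip: map_append rev_append)
    have T_iff: "t \<in> T \<longleftrightarrow> (\<exists>u v w. t = map Some u @ None # map Some v @ None # map Some (rev w) \<and>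
       u \<in> R \<and> v \<in> R \<and> w \<in> R \<and> ?F u \<otimes> ?F v = ?F w)" for t
      unfolding T by auto
    have XYT: "X @ Y \<in> T"
      unfolding XY T_iff using uvw eq by blast
    have "\<exists>\<alpha> \<beta> \<gamma> \<beta>'. X @ Y = \<alpha> @ \<beta> @ \<gamma> \<and> None \<in> set \<beta> \<and> None \<notin> set \<gamma> \<and> \<alpha> @ \<beta>' @ \<gamma> \<in> T \<and>
       length \<beta>' \<le> K \<and> length \<gamma> \<le> length Y \<and> length Y \<le> length \<gamma> + K"
    proof (rule K[OF XYT])
      fix \<alpha> \<xi> \<gamma> \<xi>'
      assume a: "X @ Y = \<alpha> @ \<xi> @ \<gamma>" "None \<in> set \<alpha>" "None \<notin> set \<xi>" "None \<notin> set \<gamma>" "\<alpha> @ \<xi>' @ \<gamma> \<in> T"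
        \<comment> \<open>The exchanged factor lies behind both separators, so \<open>u\<close> and
          \<open>v\<close> survive. Hence the new third word represents the same element as
          \<open>w\<close>, and \<open>w\<close> was chosen shortest.\<close>
        have "\<alpha> @ (\<xi> @ \<gamma>) = (map Some u @ None # map Some v) @ None # map Some (rev w)"
          using a(1) XY by simp
        from separator_suffix[OF _ this] a(3,4) obtain s where
          s: "\<alpha> = map Some u @ None # map Some v @ None # map Some s"
          by auto
        obtain u' v' w' where t: "\<alpha> @ \<xi>' @ \<gamma> = map Some u' @ None # map Some v' @ None # map Some (rev w')"
          "u' \<in> R" "v' \<in> R" "w' \<in> R" "?F u' \<otimes> ?F v' = ?F w'"
          using a(5) T_iff by blast
        have "u = u' \<and> map Some v @ None # map Some s @ \<xi>' @ \<gamma> = map Some v' @ None # map Some (rev w')"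
          using t(1) s by (intro separator_unique) simp
        moreover from this have "v = v'"
          using separator_unique by blast
        ultimately have "length w \<le> length w'" "length (\<alpha> @ \<xi>' @ \<gamma>) = length u + length v + length w' + 2"
          using W_min[of w' "inv x \<otimes> z"] t eq uvw by (auto simp: w_def)
        moreover have "length (\<alpha> @ \<xi> @ \<gamma>) = length u + length v + length w + 2"
          unfolding a(1)[symmetric] XY by simp
        ultimately show "length \<xi> \<le> length \<xi>'"
          by simp
    qed (auto simp: X_def Y_def)
    then obtain \<alpha> \<beta> \<gamma> \<beta>' where d: "X @ Y = \<alpha> @ \<beta> @ \<gamma>" "None \<in> set \<beta>" "None \<notin> set \<gamma>" "\<alpha> @ \<beta>' @ \<gamma> \<in> T"
      "length \<beta>' \<le> K" "length \<gamma> \<le> length Y" "length Y \<le> length \<gamma> + K"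
      by blast
    have "(\<alpha> @ \<beta>) @ \<gamma> = (map Some u @ None # map Some v) @ None # map Some (rev w)"
      using d(1) XY by simp
    from separator_suffix[OF d(3) this] obtain s r where
      s: "\<alpha> @ \<beta> = map Some u @ None # map Some v @ None # map Some s" "\<gamma> = map Some r" "rev w = s @ r"
      by auto
    \<comment> \<open>Reversed, the part behind the node is a prefix \<open>g\<close> of
      \<open>w\<close>, whose length lies between \<open>i - K\<close> and \<open>i\<close>. Its
      endpoint is the right end of the node.\<close>
    define g where "g = rev r"
    have w: "w = g @ rev s"
      using s(3) by (simp add: g_def rev_swap)
    have lY: "length Y = i"
      using i by (simp add: Y_def w_def len_def)
    have gi: "length g \<le> i" "i \<le> length g + K"
      using d(6,7) s(2) lY by (auto simp: g_def)
    have g_take: "take (length g) w = g"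
      by (simp add: w)
    have gL: "x \<otimes> ?F g = L x z (length g)"
      using g_take by (simp add: L_def flip: w_def)
    have gi_dist: "dist (L x z i) (L x z (length g)) \<le> K"
      using L_dist[OF V(1,3) gi(1)] gi(2) dist_commute[OF L_closed[OF V(1,3)] L_closed[OF V(1,3)], of i "length g"] by linarith
    have g_lists: "g \<in> lists \<Sigma>"
      using lists(3) w by auto
    obtain u' v' w' where t: "\<alpha> @ \<beta>' @ \<gamma> = map Some u' @ None # map Some v' @ None # map Some (rev w')"
      "u' \<in> R" "v' \<in> R" "w' \<in> R" "?F u' \<otimes> ?F v' = ?F w'"
      using d(4) T_iff by blast
    have lists': "u' \<in> lists \<Sigma>" "v' \<in> lists \<Sigma>" "w' \<in> lists \<Sigma>"
      using t R by auto
    have "(\<alpha> @ \<beta>') @ \<gamma> = (map Some u' @ None # map Some v') @ None # map Some (rev w')"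
      using t(1) by simp
    from separator_suffix[OF d(3) this] obtain s' where "rev w' = s' @ r"
      using s(2) by (auto simp: inj_map_eq_map)
    then have w': "w' = g @ rev s'"
      by (simp add: g_def rev_swap)
    have s'_lists: "rev s' \<in> lists \<Sigma>"
      using lists'(3) w' by auto
    have len': "length \<alpha> + length \<beta>' = length u' + length v' + length s' + 2"
      using arg_cong[OF t(1), of length] s(2) w' by (simp add: g_def)
    \<comment> \<open>Here \<open>p\<close> is the value at the left end of the node,
      \<open>q\<close> is what the new table word spells from there to its second separator, and
      \<open>s'\<close> is the part of its reversed third word before \<gamma>. Both parts come from
      \<beta>', so they have at most \<open>K\<close> letters together. The relation in the new
      table word then bounds the distance from \<open>?F g\<close> to \<open>p\<close> by
      \<open>K\<close>; moving from \<open>i\<close> to \<open>length g\<close> costs another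
      \<open>K\<close>.\<close>
    have key: "dist (L x z i) (x \<otimes> p) \<le> 2 * K"
      if p: "p \<in> carrier G" "p \<otimes> ?F q = ?F w'" "q \<in> lists \<Sigma>" "length q + length s' \<le> K" for p q
    proof -
      have "p \<otimes> ?F q = ?F g \<otimes> ?F (rev s')"
        using p w' F_append[OF g_lists s'_lists] by simp
      then have "inv (?F g) \<otimes> p = ?F (rev s') \<otimes> inv (?F q)"
        using F_closed[OF g_lists] F_closed[OF s'_lists] F_closed[OF p(3)] p(1)
        by (intro mult_eq_mult_imp) auto
      then have "dist (?F g) p \<le> norm (?F (rev s')) + norm (inv (?F q))"
        using F_closed[OF g_lists] F_closed[OF s'_lists] F_closed[OF p(3)] p(1) norm_mult[of "?F (rev s')" "inv (?F q)"]
        by (simp add: dist_norm[of "?F g" p])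
      then have "dist (L x z (length g)) (x \<otimes> p) \<le> K"
        using F_norm[OF s'_lists] F_norm[OF p(3)] p F_closed V g_lists by (simp add: dist_translate flip: gL)
      then show ?thesis
        using dist_triangle_le[of "L x z i" "L x z (length g)" "x \<otimes> p" K K] gi_dist L_closed V p(1) by simp
    qed
    from separator_prefix[OF s(1)] show ?thesis
    proof (elim disjE exE conjE)
      fix a b assume a: "\<alpha> = map Some a" "u = a @ b"
      obtain b' where b': "u' = a @ b'"
        using separator_prefix_Some[OF t(1)[unfolded a(1)]] ..
      have l: "a \<in> lists \<Sigma>" "b' \<in> lists \<Sigma>"
        using lists'(1) b' by auto
      have "dist (L x z i) (x \<otimes> ?F a) \<le> 2 * K"
      proof (rule key)
        show "?F a \<otimes> ?F (b' @ v') = ?F w'"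
          using t(5) b' l lists' F_closed by (simp add: F_append m_assoc)
        show "length (b' @ v') + length s' \<le> K"
          using len' d(5) a b' by simp
      qed (use l lists' F_closed in auto)
      moreover have "x \<otimes> ?F a = L x y (length a)" "length a \<le> len x y"
        using a by (simp_all add: L_def len_def flip: u_def)
      ultimately show ?thesis
        by auto
    next
      fix \<alpha>' assume \<alpha>': "\<alpha> = map Some u @ None # \<alpha>'" "\<alpha>' @ \<beta> = map Some v @ None # map Some s"
      have u': "u = u' \<and> \<alpha>' @ \<beta>' @ \<gamma> = map Some v' @ None # map Some (rev w')"
        using t(1) \<alpha>'(1) by (intro separator_unique) simp
      \<comment> \<open>The node contains a separator, so its left end cannot lie behind the second
        one.\<close>
      have "\<alpha>'' @ \<beta> \<noteq> map Some s" for \<alpha>''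
      proof
        assume "\<alpha>'' @ \<beta> = map Some s"
        then have "set (\<alpha>'' @ \<beta>) = Some ` set s"
          by simp
        then show False
          using d(2) by auto
      qed
      with separator_prefix[OF \<alpha>'(2)] obtain a b where a: "\<alpha>' = map Some a" "v = a @ b"
        by blast
      obtain b' where b': "v' = a @ b'"
        using separator_prefix_Some[OF u'[THEN conjunct2, unfolded a(1)]] ..
      have l: "a \<in> lists \<Sigma>" "b' \<in> lists \<Sigma>"
        using lists'(2) b' by auto
      have "dist (L x z i) (x \<otimes> (?F u \<otimes> ?F a)) \<le> 2 * K"
      proof (rule key)
        show "?F u \<otimes> ?F a \<otimes> ?F b' = ?F w'"
          using t(5) b' u' l lists' F_closed by (simp add: F_append m_assoc)
        show "length b' + length s' \<le> K"
          using len' d(5) a b' u' \<alpha>'(1) by simp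
      qed (use l lists F_closed in auto)
      moreover have "x \<otimes> (?F u \<otimes> ?F a) = L y z (length a)" "length a \<le> len y z"
        using a uvw(4) V l F_closed by (simp_all add: L_def len_def m_assoc flip: v_def)
      ultimately show ?thesis
        by auto
    qed
  qed
  interpret guessed_geodesics "carrier G" dist L len "2 * K" c
  proof
    fix x y i assume V: "x \<in> carrier G" "y \<in> carrier G"
    show "L x y i \<in> carrier G"
      by (rule L_closed[OF V])
    show "L x y 0 = x"
      using V by (simp add: L_def word_value_def)
    show "L x y (len x y) = y"
      using V W by (simp add: L_def len_def)
    show "dist (L x y i) (L x y (Suc i)) \<le> 1"
      using L_dist[OF V, of i "Suc i"] by simp
    show "dist (L x y i) x \<le> c" if "dist x y \<le> 1" "i \<le> len x y"
    proof -
      have "dist (L x y i) x \<le> i"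
        using L_dist[OF V, of 0 i] dist_commute[of x "L x y i"] V L_closed[OF V] by (simp add: L_def word_value_def)
      also have "i \<le> length (W (inv x \<otimes> y))"
        using that by (simp add: len_def)
      also have "\<dots> \<le> c"
        unfolding c_def using that V fin A dist_norm[OF V] by (intro Max_ge finite_imageI finite_ball imageI) auto
      finally show ?thesis .
    qed
  qed (rule L_slim)
  show ?thesis
    by (rule ex_slim)
qed

section \<open>Hyperbolicity of a group with a context-free multiplication table\<close>

theorem word_hyperbolic_imp_hyperbolic:
  fixes G :: "('a, 'b) monoid_scheme" (structure)
  assumes G: "group G" and wh: "word_hyperbolic_semigroup G"
  shows "hyperbolic_group G"
proof -
  interpret group G by (rule G)
  from wh obtain \<Sigma> :: "nat set" and f R where cg: "choice_of_generators G \<Sigma> f" and rc: "regular_combing G \<Sigma> f R"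
    and cf: "context_free_language (insert None (Some ` \<Sigma>)) (multiplication_language G f R)"
    unfolding word_hyperbolic_semigroup_def by blast
  define val where "val a = f [a]" for a
  define A where "A = val ` \<Sigma>"
  have fin: "finite \<Sigma>" and hom: "\<And>u v. u \<in> lists \<Sigma> \<Longrightarrow> v \<in> lists \<Sigma> \<Longrightarrow> u \<noteq> [] \<Longrightarrow> v \<noteq> [] \<Longrightarrow> f (u @ v) = f u \<otimes> f v"
    and surj: "f ` (lists \<Sigma> - {[]}) = carrier G"
    using cg by (auto simp: choice_of_generators_def epi_def hom_def free_semigroup_def)
  have R: "R \<subseteq> lists \<Sigma>" "[] \<notin> R" "f ` R = carrier G"
    using rc by (auto simp: regular_combing_def free_semigroup_def)
  have valC: "val a \<in> carrier G" if "a \<in> \<Sigma>" for a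
    using surj that by (auto simp: val_def)
  \<comment> \<open>The homomorphism law constrains \<open>f\<close> on nonempty words only; on
    these it is the product of the letter values.\<close>
  have fF: "f w = word_value G val w" if "w \<in> lists \<Sigma>" "w \<noteq> []" for w
    using that
  proof (induction w)
    case (Cons a w)
    then show ?case
      using hom[of "[a]" w] valC by (cases "w = []") (auto simp: word_value_def val_def)
  qed simp
  have gen: "word_value G val w \<in> generate G A" if "w \<in> lists \<Sigma>" for w
    using that
  proof (induction w)
    case (Cons a w)
    then show ?case
      by (auto simp: word_value_def A_def intro!: generate.eng[OF generate.incl])
  qed (simp add: word_value_def generate.one)
  interpret cayley_graph G A
  proof
    show AC: "A \<subseteq> carrier G"
      using valC by (auto simp: A_def)
    show "generate G A = carrier G"
    proof
      show "carrier G \<subseteq> generate G A"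
      proof
        fix g assume "g \<in> carrier G"
        then have "g \<in> f ` (lists \<Sigma> - {[]})"
          by (simp only: surj)
        then obtain w where "w \<in> lists \<Sigma>" "w \<noteq> []" "f w = g"
          by (elim imageE DiffE) simp
        then show "g \<in> generate G A"
          using gen[of w] fF[of w] by simp
      qed
    qed (rule generate_incl[OF AC])
  qed
  have "\<exists>\<delta>. slim \<delta>"
  proof (rule word_hyperbolic_slim[OF _ fin A_def R(1) _ _ cf])
    show "\<exists>w\<in>R. word_value G val w = g" if "g \<in> carrier G" for g
    proof -
      have "g \<in> f ` R"
        using \<open>g \<in> carrier G\<close> by (simp only: R(3))
      then obtain w where "w \<in> R" "f w = g"
        by (elim imageE) simp
      moreover from this have "w \<in> lists \<Sigma>" "w \<noteq> []"
        using R(2) subsetD[OF R(1)] by metis+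
      ultimately show ?thesis
        using fF by auto
    qed
    have fR: "f w = word_value G val w" if "w \<in> R" for w
      using fF[of w] R(2) subsetD[OF R(1) that] that by metis
    then show "multiplication_language G f R = {map Some u @ [None] @ map Some v @ [None] @ map Some (rev w) | u v w.
        u \<in> R \<and> v \<in> R \<and> w \<in> R \<and> word_value G val u \<otimes> word_value G val v = word_value G val w}"
      unfolding multiplication_language_def by (simp cong: conj_cong)
  qed unfold_locales
  then obtain \<delta> where \<delta>: "slim \<delta>" ..
  have "finite A"
    using fin by (simp add: A_def)
  then show ?thesis
    unfolding hyperbolic_group_def
    using gens_closed gens_generate slim_triangles[OF \<delta>]
    by (intro exI[of _ A] exI[of _ "real \<delta>"] conjI allI impI) simp_all
qed

section \<open>Regularity of the language of geodesics\<close>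

text \<open>One half of the Myhill-Nerode theorem: the states are the residuals of \<open>L\<close>,
  coded as natural numbers, and a residual accepts if it contains the empty word.\<close>

lemma regular_languageI:
  assumes L: "L \<subseteq> lists \<Sigma>" and fin: "finite ((\<lambda>u. {v \<in> lists \<Sigma>. u @ v \<in> L}) ` lists \<Sigma>)"
  shows "regular_language \<Sigma> L"
proof -
  define res where "res u = {v \<in> lists \<Sigma>. u @ v \<in> L}" for u
  have fin: "finite (res ` lists \<Sigma>)"
    using fin by (simp add: res_def)
  obtain \<iota> :: "'a list set \<Rightarrow> nat" where inj: "inj_on \<iota> (res ` lists \<Sigma>)"
    using finite_imp_inj_to_nat_seg[OF fin] by blast
  define rep where "rep = inv_into (res ` lists \<Sigma>) \<iota>"
  have rep: "rep (\<iota> (res u)) = res u" if "u \<in> lists \<Sigma>" for u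
    using inj that by (simp add: rep_def)
  define \<delta> where "\<delta> q a = \<iota> {v \<in> lists \<Sigma>. a # v \<in> rep q}" for q a
  have step: "\<delta> (\<iota> (res u)) a = \<iota> (res (u @ [a]))" if "u \<in> lists \<Sigma>" "a \<in> \<Sigma>" for u a
    unfolding \<delta>_def rep[OF that(1)] using that(2) by (auto simp: res_def intro!: arg_cong[of _ _ \<iota>])
  have run: "foldl \<delta> (\<iota> (res [])) w = \<iota> (res w)" if "w \<in> lists \<Sigma>" for w
    using that by (induction w rule: rev_induct) (auto simp: step)
  define F where "F = \<iota> ` {X \<in> res ` lists \<Sigma>. [] \<in> X}"
  have F: "\<iota> (res w) \<in> F \<longleftrightarrow> w \<in> L" if "w \<in> lists \<Sigma>" for w
  proof -
    have "\<iota> (res w) \<in> F \<longleftrightarrow> [] \<in> res w"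
      unfolding F_def using inj that by (auto dest: inj_onD)
    then show ?thesis
      by (simp add: res_def)
  qed
  show ?thesis
    unfolding regular_language_def
  proof (intro exI conjI)
    show "finite (\<iota> ` res ` lists \<Sigma>)"
      using fin by simp
    show "\<iota> (res []) \<in> \<iota> ` res ` lists \<Sigma>"
      by blast
    show "F \<subseteq> \<iota> ` res ` lists \<Sigma>"
      unfolding F_def by auto
    show "\<forall>q\<in>\<iota> ` res ` lists \<Sigma>. \<forall>a\<in>\<Sigma>. \<delta> q a \<in> \<iota> ` res ` lists \<Sigma>"
    proof (intro ballI)
      fix q a assume "q \<in> \<iota> ` res ` lists \<Sigma>" "a \<in> \<Sigma>"
      then obtain u where u: "u \<in> lists \<Sigma>" "q = \<iota> (res u)"
        by (elim imageE) simp
      then have "u @ [a] \<in> lists \<Sigma>"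
        using \<open>a \<in> \<Sigma>\<close> by simp
      then show "\<delta> q a \<in> \<iota> ` res ` lists \<Sigma>"
        using step[OF u(1) \<open>a \<in> \<Sigma>\<close>] u(2) by (metis imageI)
    qed
    show "L = {w \<in> lists \<Sigma>. foldl \<delta> (\<iota> (res [])) w \<in> F}"
    proof (intro equalityI subsetI)
      fix w assume "w \<in> L"
      then show "w \<in> {w \<in> lists \<Sigma>. foldl \<delta> (\<iota> (res [])) w \<in> F}"
        using F run subsetD[OF L] by simp
    next
      fix w assume "w \<in> {w \<in> lists \<Sigma>. foldl \<delta> (\<iota> (res [])) w \<in> F}"
      then show "w \<in> L"
        using F[of w] run[of w] by simp
    qed
  qed
qed

text \<open>Applied with tails for \<open>t\<close> and cones for \<open>C\<close>: finitely many
  tails leave only finitely many cones.\<close>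

lemma finite_image_factor:
  assumes fin: "finite (t ` W)" and eq: "\<And>w w'. w \<in> W \<Longrightarrow> w' \<in> W \<Longrightarrow> t w = t w' \<Longrightarrow> C w = C w'"
  shows "finite (C ` W)"
proof (rule finite_subset)
  show "C ` W \<subseteq> (\<lambda>x. C (inv_into W t x)) ` t ` W"
  proof
    fix y assume "y \<in> C ` W"
    then obtain w where w: "w \<in> W" "y = C w"
      by blast
    have "inv_into W t (t w) \<in> W" "t (inv_into W t (t w)) = t w"
      using w by (auto intro: inv_into_into f_inv_into_f)
    then have "C w = C (inv_into W t (t w))"
      using eq[OF w(1)] by metis
    then show "y \<in> (\<lambda>x. C (inv_into W t x)) ` t ` W"
      using w by blast
  qed
qed (use fin in simp)

section \<open>Cone types of geodesic words\<close>

context cayley_graph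
begin

definition geodesic_word :: "'a list \<Rightarrow> bool" where
  "geodesic_word ws \<longleftrightarrow> set ws \<subseteq> A \<union> m_inv G ` A \<and> norm (gprod G ws) = length ws"

lemma gens_word: "set ws \<subseteq> A \<union> m_inv G ` A \<Longrightarrow> set ws \<subseteq> carrier G \<and> set ws \<subseteq> {g \<in> carrier G. norm g \<le> 1}"
  using norm_gen by blast

lemma geod_geodesic_word:
  assumes g: "geodesic_word ws" and x: "x \<in> carrier G"
  shows "geod (\<lambda>i. x \<otimes> gprod G (take i ws)) (length ws) x (x \<otimes> gprod G ws)"
proof -
  let ?P = "\<lambda>i. x \<otimes> gprod G (take i ws)"
  have ws: "set ws \<subseteq> carrier G" "set ws \<subseteq> {g \<in> carrier G. norm g \<le> 1}"
    using g gens_word by (auto simp: geodesic_word_def)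
  have C: "?P i \<in> carrier G" for i
    using ws x by (auto dest!: in_set_takeD intro!: m_closed gprod_closed)
  note le = dist_gprod_take[OF ws(2) x]
  have "dist (?P i) (?P j) = j - i" if "i \<le> j" "j \<le> length ws" for i j
  proof -
    have "length ws = dist (?P 0) (?P (length ws))"
      using g ws x by (simp add: geodesic_word_def dist_mult_right)
    also have "\<dots> \<le> dist (?P 0) (?P i) + dist (?P i) (?P j) + dist (?P j) (?P (length ws))"
      using dist_triangle[OF C[of 0] C[of i] C[of "length ws"]] dist_triangle[OF C[of i] C[of j] C[of "length ws"]] by linarith
    finally show ?thesis
      using le[of 0 i] le[OF that(1)] le[OF that(2)] that by linarith
  qed
  then show ?thesis
    using C x unfolding geod_def by simp
qed

lemma geodesic_word_appendD:
  assumes "geodesic_word (us @ vs)"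
  shows "geodesic_word us"
proof -
  have ws: "set us \<subseteq> A \<union> m_inv G ` A" "set vs \<subseteq> A \<union> m_inv G ` A"
    using assms by (auto simp: geodesic_word_def)
  note C = ws[THEN gens_word]
  have "length us + length vs \<le> norm (gprod G us) + norm (gprod G vs)"
    using assms C norm_mult[of "gprod G us" "gprod G vs"] by (auto simp: geodesic_word_def gprod_append)
  then show ?thesis
    using ws C norm_gprod[of us] norm_gprod[of vs] by (auto simp: geodesic_word_def)
qed

lemma ex_geodesic_word: "g \<in> carrier G \<Longrightarrow> \<exists>ws. geodesic_word ws \<and> gprod G ws = g"
  using norm_word by (fastforce simp: geodesic_word_def)

text \<open>The local information at the endpoint of \<open>us\<close> that determines its geodesic
  continuations. For finite \<open>A\<close> and fixed \<open>r\<close> it is a subset of a finite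
  ball, so only finitely many tails occur.\<close>

definition tail :: "nat \<Rightarrow> 'a list \<Rightarrow> 'a set" where
  "tail r us = {h \<in> carrier G. norm h \<le> r \<and> norm (gprod G us \<otimes> h) \<le> norm (gprod G us)}"

text \<open>
  Cannon's argument: a geodesic that shortens \<open>us' vs a\<close> passes close to the endpoint of \<open>us'\<close>,
  hence through \<open>us' h\<close> for some \<open>h\<close> in the common tail, and the same \<open>h\<close> shortens \<open>us vs a\<close>.
\<close>

lemma geodesic_word_tail:
  assumes slim: "slim \<delta>" and us': "geodesic_word us'" and tail: "tail (2 * (\<delta> + 1)) us = tail (2 * (\<delta> + 1)) us'"
  shows "geodesic_word (us @ vs) \<Longrightarrow> geodesic_word (us' @ vs)"
proof (induction vs rule: rev_induct)
  case (snoc a vs)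
  then have uva: "geodesic_word (us @ vs @ [a])"
    by simp
  have IH: "geodesic_word (us' @ vs)"
    using snoc geodesic_word_appendD[of "us @ vs" "[a]"] by simp
  have gens: "set us \<subseteq> A \<union> m_inv G ` A" "set us' \<subseteq> A \<union> m_inv G ` A" "set vs \<subseteq> A \<union> m_inv G ` A" "set [a] \<subseteq> A \<union> m_inv G ` A"
    using uva us' by (auto simp: geodesic_word_def)
  note C = gens[THEN gens_word]
  define g where "g = gprod G us"
  define g' where "g' = gprod G us'"
  define v where "v = gprod G (vs @ [a])"
  have gC: "g \<in> carrier G" "g' \<in> carrier G" "v \<in> carrier G"
    using C by (auto simp: g_def g'_def v_def intro!: gprod_closed)
  have g': "norm g' = length us'"
    using us' by (simp add: geodesic_word_def g'_def)
  define p where "p = gprod G (us' @ vs)"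
  define q where "q = gprod G (us' @ vs @ [a])"
  have pq: "q = p \<otimes> a" "q = g' \<otimes> v" "p \<in> carrier G" "q \<in> carrier G" "a \<in> carrier G"
    using C gprod_append[of "us' @ vs" "[a]"] gprod_append[of us' "vs @ [a]"]
    by (auto simp: p_def q_def g'_def v_def intro!: gprod_closed)
  have "geodesic_word (us' @ vs @ [a])"
  proof (rule ccontr)
    assume "\<not> geodesic_word (us' @ vs @ [a])"
    moreover have "norm q \<le> length (us' @ vs @ [a])"
      unfolding q_def using C by (intro norm_gprod) auto
    ultimately have short: "norm q \<le> length us' + length vs"
      using gens by (auto simp: geodesic_word_def q_def)
    obtain \<gamma> n where \<gamma>: "geod \<gamma> n \<one> q"
      using geod_exists[of \<one> q] pq by auto
    have n: "n = norm q"
      by (rule geod_length[OF \<gamma>])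
    have \<alpha>: "geod (\<lambda>i. \<one> \<otimes> gprod G (take i (us' @ vs))) (length (us' @ vs)) \<one> (\<one> \<otimes> gprod G (us' @ vs))"
      by (rule geod_geodesic_word[OF IH]) simp
    \<comment> \<open>The vertex of the shorter geodesic at time \<open>length us'\<close>, or its
      end if that comes first; from there at most \<open>length vs\<close> steps lead to
      \<open>q\<close>. Since \<open>p\<close> and \<open>q\<close> are at most 1 apart,
      \<open>fellow_travel\<close> places it within \<open>2 * (\<delta> + 1)\<close> of
      \<open>g'\<close>, which is the radius of the tails.\<close>
    define y where "y = \<gamma> (min n (length us'))"
    have y: "y \<in> carrier G" "norm y \<le> length us'" "dist y q \<le> length vs"
      using geod_in[OF \<gamma>, of "min n (length us')"] geod_dist[OF \<gamma>, of 0 "min n (length us')"]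
        geod_dist[OF \<gamma>, of "min n (length us')" n] geod_ends[OF \<gamma>] short n by (auto simp: y_def)
    have "dist p q \<le> 1"
      using pq C(4) by (simp add: dist_mult_right)
    then have "dist (\<one> \<otimes> gprod G (take (min (length (us' @ vs)) (length us')) (us' @ vs))) (\<gamma> (min n (length us'))) \<le> 2 * (\<delta> + 1)"
      using C by (intro fellow_travel[OF slim \<alpha> \<gamma>]) (simp flip: p_def add: pq)
    then have near: "dist g' y \<le> 2 * (\<delta> + 1)"
      using gC by (simp add: g'_def y_def)
    define h where "h = inv g' \<otimes> y"
    define k where "k = inv y \<otimes> q"
    have hk: "h \<in> carrier G" "k \<in> carrier G" "g' \<otimes> h = y" "norm k \<le> length vs" "norm h \<le> 2 * (\<delta> + 1)"
      using gC y pq near dist_norm[of y q] dist_norm[of g' y] by (auto simp: h_def k_def)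
    have "h \<in> tail (2 * (\<delta> + 1)) us'"
      using hk y g' by (simp add: tail_def flip: g'_def)
    then have gh: "norm (g \<otimes> h) \<le> norm g"
      unfolding tail[symmetric] by (simp add: tail_def g_def)
    have "h \<otimes> k = v"
      using gC y pq(2,4) by (simp add: h_def k_def m_assoc)
    \<comment> \<open>The weak inequality in \<open>tail\<close> is enough: this bound is at most
      \<open>length us + length vs\<close>, one less than the length of the geodesic word
      \<open>us @ vs @ [a]\<close>.\<close>
    then have "norm (g \<otimes> v) \<le> norm g + length vs"
      using norm_mult[of "g \<otimes> h" k] gh hk gC by (auto simp: m_assoc)
    moreover have "norm g \<le> length us"
      unfolding g_def using C by (intro norm_gprod) auto
    moreover have "norm (g \<otimes> v) = length us + length vs + 1"
      using uva C gprod_append[of us "vs @ [a]"] by (simp add: geodesic_word_def g_def v_def)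
    ultimately show False
      by simp
  qed
  then show ?case
    by simp
qed (simp add: us')

lemma regular_geodesics:
  fixes val :: "nat \<Rightarrow> 'a"
  assumes slim: "slim \<delta>" and fin: "finite A" and e: "e \<notin> \<Sigma>"
  shows "regular_language (insert e \<Sigma>) ((#) e ` {w \<in> lists \<Sigma>. geodesic_word (map val w)})"
    (is "regular_language ?\<Sigma> ?R")
proof (rule regular_languageI)
  define r where "r = 2 * (\<delta> + 1)"
  define W where "W = {w \<in> lists \<Sigma>. geodesic_word (map val w)}"
  define cone where "cone w = {v \<in> lists \<Sigma>. geodesic_word (map val (w @ v))}" for w
  have "finite ((\<lambda>w. tail r (map val w)) ` W)"
    by (rule finite_subset[of _ "Pow {g \<in> carrier G. norm g \<le> r}"]) (auto simp: tail_def finite_ball[OF fin])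
  then have "finite (cone ` W)"
  proof (rule finite_image_factor)
    fix w w' assume "w \<in> W" "w' \<in> W" "tail r (map val w) = tail r (map val w')"
    then show "cone w = cone w'"
      unfolding cone_def W_def r_def
      using geodesic_word_tail[OF slim, of "map val w" "map val w'"] geodesic_word_tail[OF slim, of "map val w'" "map val w"]
      by auto
  qed
  then have finite: "finite ({?R, {}} \<union> cone ` W)"
    by simp
  \<comment> \<open>The residual of \<open>e # w\<close> is the cone of \<open>w\<close> if
    \<open>w\<close> is geodesic, and empty otherwise, because geodesic words are closed under
    prefixes.\<close>
  have res: "{v \<in> lists ?\<Sigma>. u @ v \<in> ?R} \<in> {?R, {}} \<union> cone ` W" if "u \<in> lists ?\<Sigma>" for u
  proof (cases u)
    case Nil
    then have "{v \<in> lists ?\<Sigma>. u @ v \<in> ?R} = ?R"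
      by auto
    then show ?thesis
      by simp
  next
    case (Cons a w)
    show ?thesis
    proof (cases "a = e \<and> w \<in> W")
      case True
      then have "{v \<in> lists ?\<Sigma>. u @ v \<in> ?R} = cone w"
        using Cons by (auto simp: cone_def W_def image_iff)
      then show ?thesis
        using True by simp
    next
      case False
      then have "{v \<in> lists ?\<Sigma>. u @ v \<in> ?R} = {}"
        using Cons geodesic_word_appendD[of "map val w"] by (auto simp: W_def)
      then show ?thesis
        by simp
    qed
  qed
  show "finite ((\<lambda>u. {v \<in> lists ?\<Sigma>. u @ v \<in> ?R}) ` lists ?\<Sigma>)"
    by (rule finite_subset[OF image_subsetI[OF res] finite])
  show "?R \<subseteq> lists ?\<Sigma>"
    by auto
qed

end

section \<open>Grammars from triangulated polygons\<close>

text \<open>Each edge carries an input letter and a group element: the letters form the language,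
  the group elements spell the polygon.\<close>

fun labelled_run :: "('s \<times> 'c \<times> 'a \<times> 's) set \<Rightarrow> 's \<Rightarrow> ('c \<times> 'a) list \<Rightarrow> 's \<Rightarrow> bool" where
  "labelled_run \<Delta> p [] q \<longleftrightarrow> p = q"
| "labelled_run \<Delta> p ((c, g) # xs) q \<longleftrightarrow> (\<exists>s. (p, c, g, s) \<in> \<Delta> \<and> labelled_run \<Delta> s xs q)"

lemma labelled_run_append:
  "labelled_run \<Delta> p (xs @ ys) q \<longleftrightarrow> (\<exists>s. labelled_run \<Delta> p xs s \<and> labelled_run \<Delta> s ys q)"
  by (induction \<Delta> p xs q rule: labelled_run.induct) auto

text \<open>A bracketing of the edge labels in which every bracket has its product in
  \<open>B\<close>. For a closed polygon this is a triangulation whose chords are labelled by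
  elements of \<open>B\<close>.\<close>

inductive triangulated :: "('a, 'b) monoid_scheme \<Rightarrow> 'a set \<Rightarrow> 'a list \<Rightarrow> bool" for G B where
  triangulated_single: "g \<in> B \<Longrightarrow> triangulated G B [g]"
| triangulated_append: "triangulated G B xs \<Longrightarrow> triangulated G B ys \<Longrightarrow> gprod G (xs @ ys) \<in> B \<Longrightarrow>
    triangulated G B (xs @ ys)"

context group
begin

lemma triangulated_gprod: "triangulated G B xs \<Longrightarrow> B \<subseteq> carrier G \<Longrightarrow> xs \<noteq> [] \<and> set xs \<subseteq> B \<and> gprod G xs \<in> B"
  by (induction rule: triangulated.induct) auto

text \<open>
  The nonterminal \<open>(p, g, q)\<close> produces the labels of the runs from \<open>p\<close> to \<open>q\<close> with product \<open>g\<close>;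
  its binary productions mirror the construction of \<^const>\<open>triangulated\<close>.
\<close>

lemma context_free_runs:
  fixes \<Delta> :: "('s \<times> 'c \<times> 'a \<times> 's) set"
  assumes fin: "finite \<Delta>" "finite B" and B: "B \<subseteq> carrier G" "\<one> \<in> B"
    and lab: "\<And>p c g q. (p, c, g, q) \<in> \<Delta> \<Longrightarrow> c \<in> \<Gamma>"
    and tri: "\<And>xs. labelled_run \<Delta> p0 xs p1 \<Longrightarrow> gprod G (map snd xs) = \<one> \<Longrightarrow> triangulated G B (map snd xs)"
  shows "context_free_language \<Gamma> {map fst xs | xs. labelled_run \<Delta> p0 xs p1 \<and> set (map snd xs) \<subseteq> carrier G \<and> gprod G (map snd xs) = \<one>}"
proof -
  define Q where "Q = {p0, p1} \<union> (\<lambda>(p, c, g, q). p) ` \<Delta> \<union> (\<lambda>(p, c, g, q). q) ` \<Delta>"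
  have Q: "finite Q" "p0 \<in> Q" "p1 \<in> Q"
    using fin by (auto simp: Q_def)
  have \<Delta>Q: "p \<in> Q" "q \<in> Q" if "(p, c, g, q) \<in> \<Delta>" for p c g q
    using that by (force simp: Q_def)+
  define P1 :: "(('s \<times> 'a \<times> 's) \<times> ('s \<times> 'a \<times> 's, 'c) grammar_symbol list) set"
    where "P1 = (\<lambda>(p, g, s, h, q). ((p, g \<otimes> h, q), [Nonterminal (p, g, s), Nonterminal (s, h, q)])) `
      {(p, g, s, h, q) \<in> Q \<times> B \<times> Q \<times> B \<times> Q. g \<otimes> h \<in> B}"
  define P2 :: "(('s \<times> 'a \<times> 's) \<times> ('s \<times> 'a \<times> 's, 'c) grammar_symbol list) set"
    where "P2 = (\<lambda>(p, c, g, q). ((p, g, q), [Terminal c])) ` {(p, c, g, q) \<in> \<Delta>. g \<in> B}"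
  define P where "P = P1 \<union> P2"
  have P1: "((p, g \<otimes> h, q), [Nonterminal (p, g, s), Nonterminal (s, h, q)]) \<in> P"
    if "p \<in> Q" "g \<in> B" "s \<in> Q" "h \<in> B" "q \<in> Q" "g \<otimes> h \<in> B" for p g s h q
    using that unfolding P_def P1_def by force
  have P2: "((p, g, q), [Terminal c]) \<in> P" if "(p, c, g, q) \<in> \<Delta>" "g \<in> B" for p c g q
    using that unfolding P_def P2_def by force
  have P_cases: "(\<exists>p g s h q. A = (p, g \<otimes> h, q) \<and> \<alpha> = [Nonterminal (p, g, s), Nonterminal (s, h, q)] \<and>
      p \<in> Q \<and> g \<in> B \<and> s \<in> Q \<and> h \<in> B \<and> q \<in> Q \<and> g \<otimes> h \<in> B) \<or>
      (\<exists>p c g q. A = (p, g, q) \<and> \<alpha> = [Terminal c] \<and> (p, c, g, q) \<in> \<Delta> \<and> g \<in> B)" if "(A, \<alpha>) \<in> P" for A \<alpha>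
    using that unfolding P_def P1_def P2_def by fast
  \<comment> \<open>Each production respects both runs and products, so a derivation tree can be
    read as a run.\<close>
  have sound: "\<exists>xs. labelled_run \<Delta> p xs q \<and> map fst xs = w \<and> set (map snd xs) \<subseteq> carrier G \<and> gprod G (map snd xs) = g"
    if "yields P (Nonterminal (p, g, q)) w" for p g q w
    using that
  proof (induction "Nonterminal (p, g, q) :: ('s \<times> 'a \<times> 's, 'c) grammar_symbol" w arbitrary: p g q rule: yields.induct)
    case (yields_Nonterminal \<alpha> ws)
    from P_cases[OF yields_Nonterminal(1)] show ?case
    proof (elim disjE exE conjE)
      fix p' g1 s h q'
      assume e: "(p, g, q) = (p', g1 \<otimes> h, q')" "\<alpha> = [Nonterminal (p', g1, s), Nonterminal (s, h, q')]" "g1 \<in> B" "h \<in> B"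
      from yields_Nonterminal(2) e(2) obtain w1 w2 where ws: "ws = [w1, w2]"
        by (auto simp: list_all2_Cons1)
      obtain xs where xs: "labelled_run \<Delta> p' xs s" "map fst xs = w1" "set (map snd xs) \<subseteq> carrier G" "gprod G (map snd xs) = g1"
        using yields_Nonterminal(2) unfolding e(2) ws by auto
      obtain ys where ys: "labelled_run \<Delta> s ys q'" "map fst ys = w2" "set (map snd ys) \<subseteq> carrier G" "gprod G (map snd ys) = h"
        using yields_Nonterminal(2) unfolding e(2) ws by auto
      show ?thesis
        using xs ys e(1) ws gprod_append[of "map snd xs" "map snd ys"]
        by (intro exI[of _ "xs @ ys"]) (auto simp: labelled_run_append)
    next
      fix p' c g' q'
      assume e: "(p, g, q) = (p', g', q')" "\<alpha> = [Terminal c]" "(p', c, g', q') \<in> \<Delta>" "g' \<in> B"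
      then have "concat ws = [c]"
        using yields_Nonterminal(2) by (auto simp: list_all2_Cons1 elim: yields.cases)
      then show ?thesis
        using e B by (intro exI[of _ "[(c, g')]"]) auto
    qed
  qed
  have runQ: "p \<in> Q \<and> q \<in> Q" if "labelled_run \<Delta> p xs q" "xs \<noteq> []" for p xs q
    using that
  proof (induction xs arbitrary: p)
    case (Cons x xs)
    then show ?case
      using \<Delta>Q by (cases x; cases "xs = []") auto
  qed simp
  \<comment> \<open>The bracketing of the labels prescribes the shape of the derivation tree; the
    intermediate states are those of the run.\<close>
  have complete: "yields P (Nonterminal (p, gprod G gs, q)) (map fst xs)"
    if "triangulated G B gs" "gs = map snd xs" "labelled_run \<Delta> p xs q" for p q xs gs
    using that
  proof (induction arbitrary: p q xs rule: triangulated.induct)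
    case (triangulated_single g)
    then obtain c where xs: "xs = [(c, g)]" "(p, c, g, q) \<in> \<Delta>"
      by (auto simp: Cons_eq_map_conv)
    have "yields P (Nonterminal (p, g, q)) (concat [[c]])"
      using P2[OF xs(2) triangulated_single(1)] by (rule yields.yields_Nonterminal) (auto intro: yields.intros)
    then show ?case
      using xs triangulated_single(1) B by (simp add: subsetD)
  next
    case (triangulated_append gs hs)
    then obtain ys zs where xs: "xs = ys @ zs" "gs = map snd ys" "hs = map snd zs"
      by (auto simp: append_eq_map_conv)
    then obtain s where s: "labelled_run \<Delta> p ys s" "labelled_run \<Delta> s zs q"
      using triangulated_append.prems by (auto simp: labelled_run_append)
    note gB = triangulated_gprod[OF triangulated_append(1) B(1)] triangulated_gprod[OF triangulated_append(2) B(1)]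
    have eq: "gprod G (gs @ hs) = gprod G gs \<otimes> gprod G hs"
      using gB B by (intro gprod_append) auto
    have pq: "p \<in> Q" "s \<in> Q" "q \<in> Q"
      using runQ[OF s(1)] runQ[OF s(2)] gB xs by auto
    have "((p, gprod G gs \<otimes> gprod G hs, q), [Nonterminal (p, gprod G gs, s), Nonterminal (s, gprod G hs, q)]) \<in> P"
      using gB pq triangulated_append(3) eq by (intro P1) auto
    then have "yields P (Nonterminal (p, gprod G gs \<otimes> gprod G hs, q)) (concat [map fst ys, map fst zs])"
      using triangulated_append.IH(1)[OF xs(2) s(1)] triangulated_append.IH(2)[OF xs(3) s(2)]
      by (intro yields.yields_Nonterminal) auto
    then show ?case
      using eq xs by simp
  qed
  show ?thesis
  proof (rule context_freeI)
    show "finite (Q \<times> B \<times> Q)" "(p0, \<one>, p1) \<in> Q \<times> B \<times> Q"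
      using Q fin B by auto
    have "finite (Q \<times> B \<times> Q \<times> B \<times> Q)"
      using Q fin by auto
    then have "finite P1"
      unfolding P1_def by (intro finite_imageI) (rule finite_subset, auto)
    moreover have "finite P2"
      unfolding P2_def using fin by (intro finite_imageI) (rule finite_subset[OF _ fin(1)], auto)
    ultimately show "finite P"
      by (simp add: P_def)
    show "A \<in> Q \<times> B \<times> Q \<and> set \<alpha> \<subseteq> Nonterminal ` (Q \<times> B \<times> Q) \<union> Terminal ` \<Gamma>" if "(A, \<alpha>) \<in> P" for A \<alpha>
      using P_cases[OF that] \<Delta>Q lab by (elim disjE exE conjE) auto
    show "{map fst xs | xs. labelled_run \<Delta> p0 xs p1 \<and> set (map snd xs) \<subseteq> carrier G \<and> gprod G (map snd xs) = \<one>} =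
      {w. yields P (Nonterminal (p0, \<one>, p1)) w}"
    proof (intro equalityI subsetI)
      fix w assume "w \<in> {map fst xs | xs. labelled_run \<Delta> p0 xs p1 \<and> set (map snd xs) \<subseteq> carrier G \<and> gprod G (map snd xs) = \<one>}"
      then obtain xs where xs: "w = map fst xs" "labelled_run \<Delta> p0 xs p1" "gprod G (map snd xs) = \<one>"
        by blast
      then show "w \<in> {w. yields P (Nonterminal (p0, \<one>, p1)) w}"
        using complete[OF tri[OF xs(2,3)] refl xs(2)] by simp
    next
      fix w assume "w \<in> {w. yields P (Nonterminal (p0, \<one>, p1)) w}"
      then show "w \<in> {map fst xs | xs. labelled_run \<Delta> p0 xs p1 \<and> set (map snd xs) \<subseteq> carrier G \<and> gprod G (map snd xs) = \<one>}"
        using sound[of p0 \<one> p1 w] by blast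
    qed
  qed
qed

end

section \<open>From slim triangles to a context-free multiplication table\<close>

text \<open>Three copies of the automaton, numbered 0, 1 and 2, read \<open>u\<close>,
  \<open>v\<close> and the reversal of \<open>w\<close>; the separators lead from one copy to the
  next. In copy 2 the edges run backwards, from a guessed accepting state to \<open>q0\<close>, and
  carry inverses. So the labels of a run multiply to the value of \<open>u\<close> times that of
  \<open>v\<close> times the inverse of that of \<open>w\<close>, which is the identity exactly for
  words of the table.\<close>

lemma (in group) context_free_multiplication:
  fixes \<delta> :: "'s \<Rightarrow> 'c \<Rightarrow> 's" and val :: "'c \<Rightarrow> 'a"
  assumes fin: "finite Q" "finite \<Sigma>" and dfa: "q0 \<in> Q" "F \<subseteq> Q" "\<And>q a. q \<in> Q \<Longrightarrow> a \<in> \<Sigma> \<Longrightarrow> \<delta> q a \<in> Q"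
    and R: "R = {w \<in> lists \<Sigma>. foldl \<delta> q0 w \<in> F}" and val: "\<And>a. a \<in> \<Sigma> \<Longrightarrow> val a \<in> carrier G"
    and B: "finite B" "B \<subseteq> carrier G" "\<one> \<in> B"
    and tri: "\<And>u v w. u \<in> R \<Longrightarrow> v \<in> R \<Longrightarrow> w \<in> R \<Longrightarrow> word_value G val u \<otimes> word_value G val v = word_value G val w \<Longrightarrow>
      triangulated G B (map val u @ [\<one>] @ map val v @ [\<one>] @ rev (map (m_inv G) (map val w)))"
  shows "context_free_language (insert None (Some ` \<Sigma>)) {map Some u @ [None] @ map Some v @ [None] @ map Some (rev w) | u v w.
        u \<in> R \<and> v \<in> R \<and> w \<in> R \<and> word_value G val u \<otimes> word_value G val v = word_value G val w}"
proof -
  define fwd where "fwd k = (\<lambda>(p, a). ((k :: nat, p), Some a, val a, (k, \<delta> p a))) ` (Q \<times> \<Sigma>)" for k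
  define \<Delta> where "\<Delta> = fwd 0 \<union> fwd 1 \<union> (\<lambda>p. ((0, p), None, \<one>, (1, q0))) ` F \<union>
    (\<lambda>(p, q). ((1, p), None, \<one>, (2, q))) ` (F \<times> F) \<union>
    (\<lambda>(p, a). ((2, \<delta> p a), Some a, inv (val a), (2, p))) ` (Q \<times> \<Sigma>)"
  define up where "up u = map (\<lambda>a. (Some a, val a)) u" for u
  define down where "down w = map (\<lambda>a. (Some a, inv (val a))) (rev w)" for w
  have step0: "((0, p), c, g, s) \<in> \<Delta> \<longleftrightarrow> (\<exists>a\<in>\<Sigma>. p \<in> Q \<and> c = Some a \<and> g = val a \<and> s = (0, \<delta> p a)) \<or>
      (p \<in> F \<and> c = None \<and> g = \<one> \<and> s = (1, q0))"
    and step1: "((1, p), c, g, s) \<in> \<Delta> \<longleftrightarrow> (\<exists>a\<in>\<Sigma>. p \<in> Q \<and> c = Some a \<and> g = val a \<and> s = (1, \<delta> p a)) \<or>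
      (\<exists>q\<in>F. p \<in> F \<and> c = None \<and> g = \<one> \<and> s = (2, q))"
    and step2: "((2, p), c, g, s) \<in> \<Delta> \<longleftrightarrow> (\<exists>q\<in>Q. \<exists>a\<in>\<Sigma>. p = \<delta> q a \<and> c = Some a \<and> g = inv (val a) \<and> s = (2, q))" for p c g s
    unfolding \<Delta>_def fwd_def by auto
  have run2: "labelled_run \<Delta> (2, p) xs (2, q0) \<longleftrightarrow> (\<exists>w. w \<in> lists \<Sigma> \<and> foldl \<delta> q0 w = p \<and> xs = down w)" for p xs
  proof
    show "labelled_run \<Delta> (2, p) xs (2, q0) \<Longrightarrow> \<exists>w. w \<in> lists \<Sigma> \<and> foldl \<delta> q0 w = p \<and> xs = down w"
    proof (induction xs arbitrary: p)
      case (Cons x xs)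
      obtain c g where x: "x = (c, g)"
        by (cases x)
      from Cons.prems obtain q a where q: "a \<in> \<Sigma>" "p = \<delta> q a" "c = Some a" "g = inv (val a)" "labelled_run \<Delta> (2, q) xs (2, q0)"
        by (auto simp: x step2)
      from Cons.IH[OF q(5)] obtain w where "w \<in> lists \<Sigma>" "foldl \<delta> q0 w = q" "xs = down w"
        by blast
      then show ?case
        using q x by (intro exI[of _ "w @ [a]"]) (auto simp: down_def)
    qed (auto simp: down_def)
    have "labelled_run \<Delta> (2, foldl \<delta> q0 w) (down w) (2, q0) \<and> foldl \<delta> q0 w \<in> Q" if "w \<in> lists \<Sigma>" for w
      using that
    proof (induction w rule: rev_induct)
      case (snoc a w)
      then have "labelled_run \<Delta> (2, foldl \<delta> q0 w) (down w) (2, q0)" "foldl \<delta> q0 w \<in> Q" "a \<in> \<Sigma>"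
        by auto
      then show ?case
        using dfa by (auto simp: down_def step2)
    qed (simp add: down_def dfa)
    then show "\<exists>w. w \<in> lists \<Sigma> \<and> foldl \<delta> q0 w = p \<and> xs = down w \<Longrightarrow> labelled_run \<Delta> (2, p) xs (2, q0)"
      by blast
  qed
  have run1: "labelled_run \<Delta> (1, p) xs (2, q0) \<longleftrightarrow>
    (\<exists>v w. v \<in> lists \<Sigma> \<and> foldl \<delta> p v \<in> F \<and> w \<in> R \<and> xs = up v @ (None, \<one>) # down w)" if "p \<in> Q" for p xs
  proof
    show "labelled_run \<Delta> (1, p) xs (2, q0) \<Longrightarrow> \<exists>v w. v \<in> lists \<Sigma> \<and> foldl \<delta> p v \<in> F \<and> w \<in> R \<and> xs = up v @ (None, \<one>) # down w"
      using that
    proof (induction xs arbitrary: p)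
      case (Cons x xs)
      obtain c g where x: "x = (c, g)"
        by (cases x)
      from Cons.prems(1) obtain s where s: "((1, p), c, g, s) \<in> \<Delta>" "labelled_run \<Delta> s xs (2, q0)"
        by (auto simp: x)
      from s(1)[unfolded step1] show ?case
      proof (elim disjE bexE conjE)
        fix a assume a: "a \<in> \<Sigma>" "p \<in> Q" "c = Some a" "g = val a" "s = (1, \<delta> p a)"
        from Cons.IH[OF s(2)[unfolded a(5)] dfa(3)[OF a(2,1)]] obtain v w
          where "v \<in> lists \<Sigma>" "foldl \<delta> (\<delta> p a) v \<in> F" "w \<in> R" "xs = up v @ (None, \<one>) # down w"
          by blast
        then show ?case
          using a x by (intro exI[of _ "a # v"] exI[of _ w]) (auto simp: up_def)
      next
        fix q assume q: "q \<in> F" "p \<in> F" "c = None" "g = \<one>" "s = (2, q)"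
        then obtain w where "w \<in> lists \<Sigma>" "foldl \<delta> q0 w = q" "xs = down w"
          using s(2) run2 by blast
        then show ?case
          using q x by (intro exI[of _ "[]"] exI[of _ w]) (auto simp: up_def R)
      qed
    qed simp
    have "labelled_run \<Delta> (1, p) (up v @ (None, \<one>) # down w) (2, q0)" if "v \<in> lists \<Sigma>" "foldl \<delta> p v \<in> F" "w \<in> R" "p \<in> Q" for p v w
      using that
    proof (induction v arbitrary: p)
      case Nil
      then have "labelled_run \<Delta> (2, foldl \<delta> q0 w) (down w) (2, q0)" "foldl \<delta> q0 w \<in> F" "p \<in> F"
        using run2 by (auto simp: R)
      then have "labelled_run \<Delta> (1, p) ((None, \<one>) # down w) (2, q0)"
        unfolding labelled_run.simps step1 by blast
      then show ?case
        by (simp add: up_def)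
    next
      case (Cons a v)
      then have "labelled_run \<Delta> (1, \<delta> p a) (up v @ (None, \<one>) # down w) (2, q0)" "a \<in> \<Sigma>"
        using dfa by auto
      then have "labelled_run \<Delta> (1, p) ((Some a, val a) # up v @ (None, \<one>) # down w) (2, q0)"
        using Cons.prems unfolding labelled_run.simps step1 by blast
      then show ?case
        by (simp add: up_def)
    qed
    then show "\<exists>v w. v \<in> lists \<Sigma> \<and> foldl \<delta> p v \<in> F \<and> w \<in> R \<and> xs = up v @ (None, \<one>) # down w \<Longrightarrow> labelled_run \<Delta> (1, p) xs (2, q0)"
      using that by blast
  qed
  have run0: "labelled_run \<Delta> (0, p) xs (2, q0) \<longleftrightarrow>
    (\<exists>u v w. u \<in> lists \<Sigma> \<and> foldl \<delta> p u \<in> F \<and> v \<in> R \<and> w \<in> R \<and> xs = up u @ (None, \<one>) # up v @ (None, \<one>) # down w)"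
    if "p \<in> Q" for p xs
  proof
    show "labelled_run \<Delta> (0, p) xs (2, q0) \<Longrightarrow>
      \<exists>u v w. u \<in> lists \<Sigma> \<and> foldl \<delta> p u \<in> F \<and> v \<in> R \<and> w \<in> R \<and> xs = up u @ (None, \<one>) # up v @ (None, \<one>) # down w"
      using that
    proof (induction xs arbitrary: p)
      case (Cons x xs)
      obtain c g where x: "x = (c, g)"
        by (cases x)
      from Cons.prems(1) obtain s where s: "((0, p), c, g, s) \<in> \<Delta>" "labelled_run \<Delta> s xs (2, q0)"
        by (auto simp: x)
      from s(1)[unfolded step0] show ?case
      proof (elim disjE bexE conjE)
        fix a assume a: "a \<in> \<Sigma>" "p \<in> Q" "c = Some a" "g = val a" "s = (0, \<delta> p a)"
        from Cons.IH[OF s(2)[unfolded a(5)] dfa(3)[OF a(2,1)]] obtain u v w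
          where "u \<in> lists \<Sigma>" "foldl \<delta> (\<delta> p a) u \<in> F" "v \<in> R" "w \<in> R" "xs = up u @ (None, \<one>) # up v @ (None, \<one>) # down w"
          by blast
        then show ?case
          using a x by (intro exI[of _ "a # u"] exI[of _ v] exI[of _ w]) (auto simp: up_def)
      next
        assume q: "p \<in> F" "c = None" "g = \<one>" "s = (1, q0)"
        then obtain v w where "v \<in> lists \<Sigma>" "foldl \<delta> q0 v \<in> F" "w \<in> R" "xs = up v @ (None, \<one>) # down w"
          using s(2) run1[OF dfa(1)] by blast
        then show ?case
          using q x by (intro exI[of _ "[]"] exI[of _ v] exI[of _ w]) (auto simp: up_def R)
      qed
    qed simp
    have "labelled_run \<Delta> (0, p) (up u @ (None, \<one>) # up v @ (None, \<one>) # down w) (2, q0)"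
      if "u \<in> lists \<Sigma>" "foldl \<delta> p u \<in> F" "v \<in> R" "w \<in> R" "p \<in> Q" for p u v w
      using that
    proof (induction u arbitrary: p)
      case Nil
      then have "labelled_run \<Delta> (1, q0) (up v @ (None, \<one>) # down w) (2, q0)" "p \<in> F"
        using run1[OF dfa(1)] by (auto simp: R)
      then have "labelled_run \<Delta> (0, p) ((None, \<one>) # up v @ (None, \<one>) # down w) (2, q0)"
        unfolding labelled_run.simps step0 by blast
      then show ?case
        by (simp add: up_def)
    next
      case (Cons a u)
      then have "labelled_run \<Delta> (0, \<delta> p a) (up u @ (None, \<one>) # up v @ (None, \<one>) # down w) (2, q0)" "a \<in> \<Sigma>"
        using dfa by auto
      then have "labelled_run \<Delta> (0, p) ((Some a, val a) # up u @ (None, \<one>) # up v @ (None, \<one>) # down w) (2, q0)"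
        using Cons.prems unfolding labelled_run.simps step0 by blast
      then show ?case
        by (simp add: up_def)
    qed
    then show "\<exists>u v w. u \<in> lists \<Sigma> \<and> foldl \<delta> p u \<in> F \<and> v \<in> R \<and> w \<in> R \<and> xs = up u @ (None, \<one>) # up v @ (None, \<one>) # down w \<Longrightarrow>
      labelled_run \<Delta> (0, p) xs (2, q0)"
      using that by blast
  qed
  have run: "labelled_run \<Delta> (0, q0) xs (2, q0) \<longleftrightarrow>
    (\<exists>u v w. u \<in> R \<and> v \<in> R \<and> w \<in> R \<and> xs = up u @ (None, \<one>) # up v @ (None, \<one>) # down w)" for xs
    unfolding run0[OF dfa(1)] unfolding R by blast
  have snd_up: "map snd (up u @ (None, \<one>) # up v @ (None, \<one>) # down w) =
      map val u @ [\<one>] @ map val v @ [\<one>] @ rev (map (m_inv G) (map val w))" for u v w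
    by (simp add: up_def down_def rev_map comp_def)
  have fst_up: "map fst (up u @ (None, \<one>) # up v @ (None, \<one>) # down w) =
      map Some u @ [None] @ map Some v @ [None] @ map Some (rev w)" for u v w
    by (simp add: up_def down_def comp_def)
  have closed: "set (map val u) \<subseteq> carrier G" if "u \<in> R" for u
    using that val by (auto simp: R)
  have run_value: "set (map snd (up u @ (None, \<one>) # up v @ (None, \<one>) # down w)) \<subseteq> carrier G \<and>
      (gprod G (map snd (up u @ (None, \<one>) # up v @ (None, \<one>) # down w)) = \<one> \<longleftrightarrow>
        word_value G val u \<otimes> word_value G val v = word_value G val w)" if uvw: "u \<in> R" "v \<in> R" "w \<in> R" for u v w
  proof -
    note C = uvw[THEN closed] and C' = uvw[THEN closed, THEN gprod_closed]
    have Ci: "set (rev (map (m_inv G) (map val w))) \<subseteq> carrier G"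
      using C(3) by auto
    have "gprod G (map val u @ [\<one>] @ map val v @ [\<one>] @ rev (map (m_inv G) (map val w))) =
        gprod G (map val u) \<otimes> gprod G ([\<one>] @ map val v @ [\<one>] @ rev (map (m_inv G) (map val w)))"
      using C Ci by (intro gprod_append) auto
    also have "gprod G ([\<one>] @ map val v @ [\<one>] @ rev (map (m_inv G) (map val w))) =
        gprod G (map val v) \<otimes> gprod G ([\<one>] @ rev (map (m_inv G) (map val w)))"
      using C Ci gprod_append[of "map val v" "[\<one>] @ rev (map (m_inv G) (map val w))"] gprod_closed[of "map val v"]
        gprod_closed[OF Ci] by simp
    also have "gprod G ([\<one>] @ rev (map (m_inv G) (map val w))) = inv (gprod G (map val w))"
      using gprod_rev_inv[OF C(3)] C'(3) by simp
    finally have eq: "gprod G (map val u @ [\<one>] @ map val v @ [\<one>] @ rev (map (m_inv G) (map val w))) =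
        (gprod G (map val u) \<otimes> gprod G (map val v)) \<otimes> inv (gprod G (map val w))"
      using C' by (simp add: m_assoc)
    have "(gprod G (map val u) \<otimes> gprod G (map val v)) \<otimes> inv (gprod G (map val w)) = \<one> \<longleftrightarrow>
        gprod G (map val u) \<otimes> gprod G (map val v) = gprod G (map val w)"
      using C' by (metis inv_solve_right l_one m_closed one_closed)
    then show ?thesis
      unfolding snd_up eq word_value_def using C Ci by auto
  qed
  have "context_free_language (insert None (Some ` \<Sigma>))
     {map fst xs | xs. labelled_run \<Delta> (0, q0) xs (2, q0) \<and> set (map snd xs) \<subseteq> carrier G \<and> gprod G (map snd xs) = \<one>}"
  proof (rule context_free_runs[OF _ B(1,2,3)])
    show "finite \<Delta>"
      unfolding \<Delta>_def fwd_def using fin finite_subset[OF dfa(2) fin(1)] by simp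
    show "c \<in> insert None (Some ` \<Sigma>)" if "(p, c, g, q) \<in> \<Delta>" for p c g q
      using that unfolding \<Delta>_def fwd_def by (elim UnE imageE) (simp_all split: prod.splits)
    show "triangulated G B (map snd xs)" if r: "labelled_run \<Delta> (0, q0) xs (2, q0)" "gprod G (map snd xs) = \<one>" for xs
    proof -
      obtain u v w where uvw: "u \<in> R" "v \<in> R" "w \<in> R" and xs: "xs = up u @ (None, \<one>) # up v @ (None, \<one>) # down w"
        using r(1) run by blast
      then show ?thesis
        using tri[OF uvw] run_value[OF uvw] r(2) unfolding xs snd_up by simp
    qed
  qed
  also have "{map fst xs | xs. labelled_run \<Delta> (0, q0) xs (2, q0) \<and> set (map snd xs) \<subseteq> carrier G \<and> gprod G (map snd xs) = \<one>} =
      {map Some u @ [None] @ map Some v @ [None] @ map Some (rev w) | u v w.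
        u \<in> R \<and> v \<in> R \<and> w \<in> R \<and> word_value G val u \<otimes> word_value G val v = word_value G val w}" (is "?L = ?T")
  proof (intro equalityI subsetI)
    fix t assume "t \<in> ?L"
    then obtain xs where xs: "t = map fst xs" "labelled_run \<Delta> (0, q0) xs (2, q0)" "gprod G (map snd xs) = \<one>"
      by blast
    obtain u v w where uvw: "u \<in> R" "v \<in> R" "w \<in> R" "xs = up u @ (None, \<one>) # up v @ (None, \<one>) # down w"
      using xs(2) run by blast
    then show "t \<in> ?T"
      using run_value[OF uvw(1-3)] xs(1,3) unfolding uvw(4) fst_up by blast
  next
    fix t assume "t \<in> ?T"
    then obtain u v w where uvw: "u \<in> R" "v \<in> R" "w \<in> R" "word_value G val u \<otimes> word_value G val v = word_value G val w"
      and t: "t = map fst (up u @ (None, \<one>) # up v @ (None, \<one>) # down w)"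
      unfolding fst_up by blast
    then show "t \<in> ?L"
      using run_value[OF uvw(1-3)] run by blast
  qed
  finally show ?thesis .
qed

text \<open>Consumes the two lists in parallel and continues with the longer one alone, as the two
  sides of a corner may differ in length.\<close>

lemma list_induct_both [case_names Nil left right both]:
  assumes "P [] []" "\<And>a x. P x [] \<Longrightarrow> P (a # x) []" "\<And>b y. P [] y \<Longrightarrow> P [] (b # y)"
    and "\<And>a x b y. P x y \<Longrightarrow> P (a # x) (b # y)"
  shows "P x y"
proof (induction x arbitrary: y)
  case Nil
  show ?case
    by (induction y) (use assms in auto)
next
  case (Cons a x)
  then show ?case
    using assms by (cases y) auto
qed

section \<open>Triangulating slim geodesic triangles\<close>

context cayley_graph
begin

abbreviation ball :: "nat \<Rightarrow> 'a set" where
  "ball k \<equiv> {g \<in> carrier G. norm g \<le> k}"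

text \<open>Zips up the two sides \<open>x\<close> and \<open>y\<close>, both listed from the middle
  outwards, by adding one letter on the left and one on the right in turn. The hypothesis controls
  the product after each full round; between the two letters of a round it is off by one letter,
  hence the radius \<open>k + 1\<close>.\<close>

lemma triangulated_surround:
  assumes "triangulated G (ball (k + 1)) m" "set x \<subseteq> ball 1" "set y \<subseteq> ball 1" "set m \<subseteq> carrier G"
    and "\<And>t. norm (gprod G (rev (take t x) @ m @ take t y)) \<le> k"
  shows "triangulated G (ball (k + 1)) (rev x @ m @ y)"
  using assms
proof (induction x y arbitrary: m rule: list_induct_both)
  case (left a x)
  have a: "a \<in> carrier G" "norm a \<le> 1" and mC: "set m \<subseteq> carrier G"
    using left.prems by auto
  have "norm (gprod G ([a] @ m)) \<le> k"
    using left.prems(5)[of 1] by simp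
  then have "triangulated G (ball (k + 1)) ([a] @ m)"
    using left.prems a mC by (intro triangulated.intros) auto
  then have "triangulated G (ball (k + 1)) (rev x @ ([a] @ m) @ [])"
  proof (rule left.IH)
    show "norm (gprod G (rev (take t x) @ ([a] @ m) @ take t [])) \<le> k" for t
      using left.prems(5)[of "Suc t"] by simp
  qed (use left.prems in auto)
  then show ?case
    by simp
next
  case (right b y)
  have b: "b \<in> carrier G" "norm b \<le> 1" and mC: "set m \<subseteq> carrier G"
    using right.prems by auto
  have "norm (gprod G (m @ [b])) \<le> k"
    using right.prems(5)[of 1] by simp
  then have "triangulated G (ball (k + 1)) (m @ [b])"
    using right.prems b mC by (intro triangulated.intros) auto
  then have "triangulated G (ball (k + 1)) (rev [] @ (m @ [b]) @ y)"
  proof (rule right.IH)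
    show "norm (gprod G (rev (take t []) @ (m @ [b]) @ take t y)) \<le> k" for t
      using right.prems(5)[of "Suc t"] by simp
  qed (use right.prems in auto)
  then show ?case
    by simp
next
  case (both a x b y)
  have ab: "a \<in> carrier G" "norm a \<le> 1" "b \<in> carrier G" "norm b \<le> 1" and mC: "set m \<subseteq> carrier G"
    using both.prems by auto
  have amC: "gprod G ([a] @ m) \<in> carrier G" "set ([a] @ m) \<subseteq> carrier G"
    using ab mC by (auto intro!: gprod_closed)
  have amb: "norm (gprod G (([a] @ m) @ [b])) \<le> k"
    using both.prems(5)[of 1] by simp
  have ambC: "gprod G (([a] @ m) @ [b]) \<in> carrier G"
    using ab mC by (intro gprod_closed) auto
  have "gprod G ([a] @ m) = gprod G (([a] @ m) @ [b]) \<otimes> inv b"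
    using gprod_append[OF amC(2), of "[b]"] ab amC by (simp add: m_assoc)
  then have "norm (gprod G ([a] @ m)) \<le> k + 1"
    using norm_mult[OF ambC, of "inv b"] amb ab by simp
  then have "triangulated G (ball (k + 1)) ([a] @ m)"
    using both.prems ab amC by (intro triangulated.intros) auto
  then have "triangulated G (ball (k + 1)) (([a] @ m) @ [b])"
    by (rule triangulated_append[OF _ triangulated_single]) (use amb ambC ab in auto)
  then have "triangulated G (ball (k + 1)) (rev x @ (([a] @ m) @ [b]) @ y)"
  proof (rule both.IH)
    show "norm (gprod G (rev (take t x) @ (([a] @ m) @ [b]) @ take t y)) \<le> k" for t
      using both.prems(5)[of "Suc t"] by simp
  qed (use both.prems in auto)
  then show ?case
    by simp
qed simp

lemma gprod_drop: "set ws \<subseteq> carrier G \<Longrightarrow> gprod G (drop s ws) = inv (gprod G (take s ws)) \<otimes> gprod G ws"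
proof -
  assume ws: "set ws \<subseteq> carrier G"
  have C: "set (take s ws) \<subseteq> carrier G" "set (drop s ws) \<subseteq> carrier G"
    using ws by (auto dest: in_set_takeD in_set_dropD)
  have "gprod G ws = gprod G (take s ws) \<otimes> gprod G (drop s ws)"
    using gprod_append[OF C] by simp
  then show ?thesis
    using C by simp
qed

lemma gprod_drop_take:
  "set ws \<subseteq> carrier G \<Longrightarrow> s \<le> i \<Longrightarrow> gprod G (drop s (take i ws)) = inv (gprod G (take s ws)) \<otimes> gprod G (take i ws)"
  using gprod_drop[of "take i ws" s] by (auto dest: in_set_takeD simp: min_def)

text \<open>The points \<open>\<alpha> i\<close>, \<open>\<beta> j\<close> and
  \<open>\<gamma> k\<close> of a centre cut the triangle into corners at \<open>p\<close>, at
  \<open>q\<close> and at the identity. In \<open>[\<one>, \<one>]\<close> the entries stand for the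
  first separator and for the identity letter that opens the second combing word.\<close>

lemma triangulated_geodesic_triangle:
  assumes slim: "slim \<delta>" and us: "geodesic_word us" and vs: "geodesic_word vs" and ws: "geodesic_word ws"
    and eq: "gprod G us \<otimes> gprod G vs = gprod G ws" and D: "D = \<delta> + 1"
  shows "triangulated G (ball (2 * (\<delta> + 2 * D) + D + 1)) (us @ [\<one>, \<one>] @ vs @ [\<one>] @ rev (map (m_inv G) ws))"
proof -
  \<comment> \<open>Dominates the bounds at all three corners: \<open>2 * (\<delta> + 2 * D)\<close>
    at \<open>p\<close>, where the centre points are only known to be \<open>2 * D\<close> apart,
    \<open>2 * (\<delta> + D)\<close> at \<open>q\<close>, and \<open>2 * (\<delta> + D) + D\<close>
    at the identity.\<close>
  let ?k = "2 * (\<delta> + 2 * D) + D"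
  let ?B = "ball (?k + 1)"
  define l m n where "l = length us" and "m = length vs" and "n = length ws"
  define p q where "p = gprod G us" and "q = gprod G ws"
  have C: "set us \<subseteq> carrier G" "set vs \<subseteq> carrier G" "set ws \<subseteq> carrier G"
    and C1: "set us \<subseteq> ball 1" "set vs \<subseteq> ball 1" "set ws \<subseteq> ball 1"
    using us vs ws gens_word unfolding geodesic_word_def by blast+
  have pq: "p \<in> carrier G" "q \<in> carrier G" "gprod G vs = inv p \<otimes> q"
    using C gprod_closed[OF C(1)] gprod_closed[OF C(2)] by (auto simp: p_def q_def simp flip: eq)
  define \<alpha> where "\<alpha> i = gprod G (take i us)" for i
  define \<beta> where "\<beta> j = p \<otimes> gprod G (take j vs)" for j
  define \<gamma> where "\<gamma> k = gprod G (take k ws)" for k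
  have take_closed: "set (take i us) \<subseteq> carrier G" "set (take i vs) \<subseteq> carrier G" "set (take i ws) \<subseteq> carrier G" for i
    using C by (auto dest: in_set_takeD)
  note gtake = take_closed[THEN gprod_closed]
  have PC: "\<alpha> i \<in> carrier G" "\<beta> i \<in> carrier G" "\<gamma> i \<in> carrier G" for i
    using gtake pq by (auto simp: \<alpha>_def \<beta>_def \<gamma>_def)
  have ga: "geod \<alpha> l \<one> p"
    using geod_geodesic_word[OF us one_closed] gtake pq by (simp add: \<alpha>_def[abs_def] l_def p_def)
  have gb: "geod \<beta> m p q"
    using geod_geodesic_word[OF vs pq(1)] pq by (simp add: \<beta>_def[abs_def] m_def)
  have gc: "geod \<gamma> n \<one> q"
    using geod_geodesic_word[OF ws one_closed] gtake pq by (simp add: \<gamma>_def[abs_def] n_def q_def)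
  obtain i j k where ijk: "i \<le> l" "j \<le> m" "k \<le> n" "dist (\<gamma> k) (\<alpha> i) \<le> D" "dist (\<gamma> k) (\<beta> j) \<le> D"
    using triangle_center[OF slim ga gb gc] D by auto
  have ab: "dist (\<alpha> i) (\<beta> j) \<le> 2 * D"
    using dist_triangle_le[of "\<alpha> i" "\<gamma> k" "\<beta> j" D D] ijk PC dist_commute[of "\<alpha> i" "\<gamma> k"] by simp
  have bc: "dist (\<beta> j) (\<gamma> k) \<le> D" and ac: "dist (\<alpha> i) (\<gamma> k) \<le> D"
    using ijk PC dist_commute by auto
  have drop_u: "gprod G (drop s us) = inv (\<alpha> s) \<otimes> p" for s
    using gprod_drop[OF C(1)] by (simp add: \<alpha>_def p_def)
  have drop_v: "gprod G (drop s vs) = inv (\<beta> s) \<otimes> q" for s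
    using gprod_drop[OF C(2)] gtake pq by (simp add: \<beta>_def inv_mult_group m_assoc)
  have drop_w: "gprod G (drop s ws) = inv (\<gamma> s) \<otimes> q" for s
    using gprod_drop[OF C(3)] by (simp add: \<gamma>_def q_def)
  have take_v: "gprod G (take s vs) = inv p \<otimes> \<beta> s" for s
    using gtake pq by (simp add: \<beta>_def)
  have drop_closed: "set (drop s us) \<subseteq> carrier G" "set (drop s vs) \<subseteq> carrier G" "set (drop s ws) \<subseteq> carrier G" for s
    using C by (auto dest: in_set_dropD)
  have inv_closed: "set (rev (map (m_inv G) xs)) \<subseteq> carrier G" if "set xs \<subseteq> carrier G" for xs
    using that by auto
  have inv_ball: "set (rev (map (m_inv G) xs)) \<subseteq> ball 1" if "set xs \<subseteq> ball 1" for xs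
    using that by auto
  have one: "triangulated G ?B [\<one>]"
    by (rule triangulated_single) simp

  have "triangulated G ?B (rev (rev (drop i us)) @ [\<one>, \<one>] @ take j vs)"
  proof (rule triangulated_surround)
    show "triangulated G ?B [\<one>, \<one>]"
      using triangulated_append[OF one one] by simp
    fix t
    \<comment> \<open>With truncated subtraction this is the larger of \<open>i\<close> and
      \<open>l - t\<close>: going back from \<open>p\<close>, the point stops at the centre.\<close>
    define s where "s = i + (l - i - t)"
    have s: "rev (take t (rev (drop i us))) = drop s us" "l - min (l - i) t = s"
      using ijk(1) by (auto simp: take_rev s_def l_def add.commute min_def)
    have "gprod G (rev (take t (rev (drop i us))) @ [\<one>, \<one>] @ take t (take j vs)) =
        gprod G (drop s us) \<otimes> gprod G ([\<one>, \<one>] @ take (min t j) vs)"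
      unfolding s using drop_closed take_closed by (subst gprod_append) (auto simp: take_take)
    also have "\<dots> = inv (\<alpha> s) \<otimes> \<beta> (min j t)"
      using PC pq gtake by (simp add: drop_u take_v m_assoc min.commute)
    finally have "norm (gprod G (rev (take t (rev (drop i us))) @ [\<one>, \<one>] @ take t (take j vs))) = dist (\<alpha> s) (\<beta> (min j t))"
      using PC dist_norm[of "\<alpha> s" "\<beta> (min j t)"] by simp
    also have "\<dots> \<le> 2 * (\<delta> + 2 * D)"
    proof -
      have "geod (\<lambda>t. \<alpha> (l - t)) (l - i) p (\<alpha> i)"
        using geod_prefix[OF geod_rev[OF ga], of "l - i"] ijk(1) by simp
      from fellow_travel[OF slim this geod_prefix[OF gb ijk(2)] ab, of t] show ?thesis
        by (simp add: s)
    qed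
    finally show "norm (gprod G (rev (take t (rev (drop i us))) @ [\<one>, \<one>] @ take t (take j vs))) \<le> ?k"
      by simp
  qed (use C1 in \<open>auto dest!: in_set_takeD in_set_dropD\<close>)
  then have tri1: "triangulated G ?B (drop i us @ [\<one>, \<one>] @ take j vs)"
    by simp
  have val1: "gprod G (drop i us @ [\<one>, \<one>] @ take j vs) = inv (\<alpha> i) \<otimes> \<beta> j"
    using gprod_append[OF drop_closed(1), of "[\<one>, \<one>] @ take j vs" i] take_closed gtake PC pq
    by (simp add: drop_u take_v m_assoc)

  have "triangulated G ?B (rev (rev (drop j vs)) @ [\<one>] @ rev (map (m_inv G) (drop k ws)))"
  proof (rule triangulated_surround)
    fix t
    define s where "s = j + (m - j - t)"
    define s' where "s' = k + (n - k - t)"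
    have s: "rev (take t (rev (drop j vs))) = drop s vs" "m - min (m - j) t = s"
      using ijk(2) by (auto simp: take_rev s_def m_def add.commute min_def)
    have s': "take t (rev (map (m_inv G) (drop k ws))) = rev (map (m_inv G) (drop s' ws))" "n - min (n - k) t = s'"
      using ijk(3) by (auto simp: take_rev s'_def n_def add.commute min_def drop_map)
    have "gprod G (rev (take t (rev (drop j vs))) @ [\<one>] @ take t (rev (map (m_inv G) (drop k ws)))) =
        gprod G (drop s vs) \<otimes> gprod G ([\<one>] @ rev (map (m_inv G) (drop s' ws)))"
      unfolding s s' using drop_closed inv_closed[OF drop_closed(3)] by (intro gprod_append) auto
    also have "\<dots> = inv (\<beta> s) \<otimes> \<gamma> s'"
      using PC pq gprod_rev_inv[OF drop_closed(3), of s'] by (simp add: drop_v drop_w m_assoc inv_mult_group)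
    finally have "norm (gprod G (rev (take t (rev (drop j vs))) @ [\<one>] @ take t (rev (map (m_inv G) (drop k ws))))) = dist (\<beta> s) (\<gamma> s')"
      using PC dist_norm[of "\<beta> s" "\<gamma> s'"] by simp
    also have "\<dots> \<le> 2 * (\<delta> + D)"
    proof -
      have "geod (\<lambda>t. \<beta> (m - t)) (m - j) q (\<beta> j)" "geod (\<lambda>t. \<gamma> (n - t)) (n - k) q (\<gamma> k)"
        using geod_prefix[OF geod_rev[OF gb], of "m - j"] geod_prefix[OF geod_rev[OF gc], of "n - k"] ijk(2,3) by simp_all
      from fellow_travel[OF slim this bc, of t] show ?thesis
        by (simp add: s s')
    qed
    finally show "norm (gprod G (rev (take t (rev (drop j vs))) @ [\<one>] @ take t (rev (map (m_inv G) (drop k ws))))) \<le> ?k"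
      by simp
  next
    show "set (rev (map (m_inv G) (drop k ws))) \<subseteq> ball 1"
      using C1(3) by (intro inv_ball) (auto dest!: in_set_dropD)
  qed (use C1 one in \<open>auto dest!: in_set_takeD in_set_dropD\<close>)
  then have tri2: "triangulated G ?B (drop j vs @ [\<one>] @ rev (map (m_inv G) (drop k ws)))"
    by simp
  have val2: "gprod G (drop j vs @ [\<one>] @ rev (map (m_inv G) (drop k ws))) = inv (\<beta> j) \<otimes> \<gamma> k"
    using gprod_append[OF drop_closed(2), of "[\<one>] @ rev (map (m_inv G) (drop k ws))" j] inv_closed[OF drop_closed(3)] PC pq
      gprod_rev_inv[OF drop_closed(3), of k]
    by (simp add: drop_v drop_w m_assoc inv_mult_group)

  let ?m = "(drop i us @ [\<one>, \<one>] @ take j vs) @ (drop j vs @ [\<one>] @ rev (map (m_inv G) (drop k ws)))"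
  have mC: "set ?m \<subseteq> carrier G"
    using drop_closed take_closed inv_closed[OF drop_closed(3)] by (auto dest: in_set_dropD in_set_takeD)
  have val3: "gprod G ?m = inv (\<alpha> i) \<otimes> \<gamma> k"
    using mC PC by (subst gprod_append) (simp_all only: val1 val2 set_append Un_subset_iff, simp_all add: m_assoc)
  have tri3: "triangulated G ?B ?m"
    using tri1 tri2
  proof (rule triangulated_append)
    show "gprod G ?m \<in> ?B"
      unfolding val3 using PC ac dist_norm[of "\<alpha> i" "\<gamma> k"] by auto
  qed

  have "triangulated G ?B (rev (rev (take i us)) @ ?m @ rev (map (m_inv G) (take k ws)))"
  proof (rule triangulated_surround[OF tri3 _ _ mC])
    fix t
    have s: "rev (take t (rev (take i us))) = drop (i - t) (take i us)"
      using ijk(1) by (simp add: take_rev l_def min_def)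
    have s': "take t (rev (map (m_inv G) (take k ws))) = rev (map (m_inv G) (drop (k - t) (take k ws)))"
      using ijk(3) by (simp add: take_rev n_def min_def drop_map)
    have C': "set (drop (i - t) (take i us)) \<subseteq> carrier G" "set (drop (k - t) (take k ws)) \<subseteq> carrier G"
      using C by (auto dest!: in_set_takeD in_set_dropD)
    have u: "gprod G (drop (i - t) (take i us)) = inv (\<alpha> (i - t)) \<otimes> \<alpha> i"
      using gprod_drop_take[OF C(1), of "i - t" i] by (simp add: \<alpha>_def)
    have w: "gprod G (rev (map (m_inv G) (drop (k - t) (take k ws)))) = inv (\<gamma> k) \<otimes> \<gamma> (k - t)"
      using gprod_rev_inv[OF C'(2)] gprod_drop_take[OF C(3), of "k - t" k] PC by (simp add: inv_mult_group flip: \<gamma>_def)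
    have "gprod G (rev (take t (rev (take i us))) @ ?m @ take t (rev (map (m_inv G) (take k ws)))) =
        gprod G (drop (i - t) (take i us)) \<otimes> (gprod G ?m \<otimes> gprod G (rev (map (m_inv G) (drop (k - t) (take k ws)))))"
      unfolding s s' using C'(1) mC inv_closed[OF C'(2)]
      by (subst gprod_append) (simp_all only: gprod_append set_append Un_subset_iff simp_thms)
    also have "\<dots> = inv (\<alpha> (i - t)) \<otimes> \<gamma> (k - t)"
      unfolding u w val3 using PC by (simp add: m_assoc)
    finally have "norm (gprod G (rev (take t (rev (take i us))) @ ?m @ take t (rev (map (m_inv G) (take k ws))))) =
        dist (\<alpha> (i - t)) (\<gamma> (k - t))"
      using PC dist_norm[of "\<alpha> (i - t)" "\<gamma> (k - t)"] by simp
    \<comment> \<open>Zipping outwards from the centre compares the times \<open>i - t\<close> and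
      \<open>k - t\<close>, whereas \<open>fellow_travel\<close> compares equal times. Both
      geodesics start at the identity and \<open>\<alpha> i\<close> is within \<open>D\<close> of
      \<open>\<gamma> k\<close>, so the shift is at most \<open>D\<close>.\<close>
    also have "\<dots> \<le> 2 * (\<delta> + D) + D"
    proof (rule dist_triangle_le)
      have "dist (\<alpha> (min i (i - t))) (\<gamma> (min k (i - t))) \<le> 2 * (\<delta> + D)"
        by (rule fellow_travel[OF slim geod_prefix[OF ga ijk(1)] geod_prefix[OF gc ijk(3)] ac])
      then show "dist (\<alpha> (i - t)) (\<gamma> (min k (i - t))) \<le> 2 * (\<delta> + D)"
        by simp
      have "dist \<one> (\<alpha> i) = i" "dist \<one> (\<gamma> k) = k"
        using geod_dist[OF ga, of 0 i] geod_dist[OF gc, of 0 k] geod_ends[OF ga] geod_ends[OF gc] ijk by auto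
      then have "i \<le> k + D" "k \<le> i + D"
        using dist_triangle[of \<one> "\<gamma> k" "\<alpha> i"] dist_triangle[of \<one> "\<alpha> i" "\<gamma> k"] ijk(4) ac PC by auto
      then show "dist (\<gamma> (min k (i - t))) (\<gamma> (k - t)) \<le> D"
        using geod_dist[OF gc, of "min k (i - t)" "k - t"] ijk(3) by auto
    qed (use PC in auto)
    finally show "norm (gprod G (rev (take t (rev (take i us))) @ ?m @ take t (rev (map (m_inv G) (take k ws))))) \<le> ?k"
      by simp
  next
    show "set (rev (map (m_inv G) (take k ws))) \<subseteq> ball 1"
      using C1(3) by (intro inv_ball) (auto dest!: in_set_takeD)
  qed (use C1 in \<open>auto dest!: in_set_takeD\<close>)
  also have "rev (rev (take i us)) @ ?m @ rev (map (m_inv G) (take k ws)) =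
      us @ [\<one>, \<one>] @ vs @ [\<one>] @ rev (map (m_inv G) (take k ws @ drop k ws))"
    by (simp only: rev_rev_ident append.assoc map_append rev_append append_take_drop_id)
      (simp flip: append.assoc, metis append_take_drop_id map_append rev_append)
  finally show ?thesis
    by (simp only: append_take_drop_id)
qed

end

section \<open>Geodesic words as a combing of a hyperbolic group\<close>

theorem hyperbolic_imp_word_hyperbolic:
  fixes G :: "('a, 'b) monoid_scheme" (structure)
  assumes G: "group G" and hyp: "hyperbolic_group G"
  shows "word_hyperbolic_semigroup G"
proof -
  interpret group G by (rule G)
  from hyp obtain A and \<delta>' :: real where A: "finite A" "A \<subseteq> carrier G" "generate G A = carrier G"
    and thin: "\<And>p q r. geodesic_triangle G A p q r \<Longrightarrow> set r \<subseteq> cayley_nbhd G A \<delta>' (set p \<union> set q)"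
    unfolding hyperbolic_group_def by metis
  interpret cayley_graph G A
    using A by unfold_locales
  obtain \<delta> where slim: "slim \<delta>"
    using triangles_slim[OF thin] by blast
  have "finite (A \<union> m_inv G ` A)"
    using A by simp
  then obtain gen and n :: nat where gen: "A \<union> m_inv G ` A = gen ` {i. i < n}"
    using finite_imp_nat_seg_image_inj_on by metis
  \<comment> \<open>The letter 0 denotes the identity and \<open>Suc i\<close> the element number
    \<open>i\<close> of the generating set closed under inverses.\<close>
  define val where "val = case_nat \<one> gen"
  define \<Sigma>' where "\<Sigma>' = Suc ` {i. i < n}"
  define \<Sigma> where "\<Sigma> = insert 0 \<Sigma>'"
  have val0: "val 0 = \<one>" and val_gens: "val ` \<Sigma>' = A \<union> m_inv G ` A"
    by (simp_all add: val_def \<Sigma>'_def gen image_image)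
  have fin: "finite \<Sigma>"
    by (simp add: \<Sigma>_def \<Sigma>'_def)
  have valC: "val a \<in> carrier G" if "a \<in> \<Sigma>" for a
  proof (cases "a = 0")
    case False
    then have "val a \<in> A \<union> m_inv G ` A"
      using that val_gens by (auto simp: \<Sigma>_def)
    then show ?thesis
      using norm_gen by blast
  qed (simp add: val0)
  define f where "f = word_value G val"
  have closed: "set (map val w) \<subseteq> carrier G" if "w \<in> lists \<Sigma>" for w
    using that valC by auto
  define R' where "R' = {w \<in> lists \<Sigma>'. geodesic_word (map val w)}"
  define R where "R = (#) 0 ` R'"
  have f0: "f (0 # w) = gprod G (map val w)" if "w \<in> lists \<Sigma>" for w
    using gprod_closed[OF closed[OF that]] by (simp add: f_def word_value_def val0)
  have lists: "w \<in> lists \<Sigma>" if "w \<in> lists \<Sigma>'" for w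
    using that by (auto simp: \<Sigma>_def)
  have R_sub: "R \<subseteq> lists \<Sigma> - {[]}"
    by (auto simp: R_def R'_def \<Sigma>_def)
  have f_closed: "f w \<in> carrier G" if "w \<in> lists \<Sigma>" for w
    using gprod_closed[OF closed[OF that]] by (simp add: f_def word_value_def)
  have f_append: "f (u @ v) = f u \<otimes> f v" if "u \<in> lists \<Sigma>" "v \<in> lists \<Sigma>" for u v
    using gprod_append[OF closed[OF that(1)] closed[OF that(2)]] by (simp add: f_def word_value_def)
  have f_R: "f ` R = carrier G"
  proof (intro equalityI subsetI)
    fix g assume "g \<in> carrier G"
    then obtain ws where ws: "geodesic_word ws" "gprod G ws = g"
      using ex_geodesic_word by blast
    then have "ws \<in> lists (val ` \<Sigma>')"
      unfolding val_gens by (auto simp: geodesic_word_def)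
    then obtain w where w: "w \<in> lists \<Sigma>'" "ws = map val w"
      unfolding lists_image by (elim imageE)
    then have "0 # w \<in> R" "f (0 # w) = g"
      using ws f0[OF lists[OF w(1)]] by (simp_all add: R_def R'_def)
    then show "g \<in> f ` R"
      by (metis imageI)
  next
    fix g assume "g \<in> f ` R"
    then show "g \<in> carrier G"
      using R_sub f_closed by (elim imageE) (simp add: subset_iff)
  qed
  have regular: "regular_language \<Sigma> R"
    unfolding R_def R'_def \<Sigma>_def using regular_geodesics[OF slim A(1), of 0 \<Sigma>' val] by (simp add: \<Sigma>'_def)
  have choice: "choice_of_generators G \<Sigma> f"
    unfolding choice_of_generators_def epi_def hom_def free_semigroup_def
  proof (intro conjI CollectI)
    show "f ` carrier \<lparr>carrier = lists \<Sigma> - {[]}, mult = (@), one = []\<rparr> = carrier G"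
    proof
      show "carrier G \<subseteq> f ` carrier \<lparr>carrier = lists \<Sigma> - {[]}, mult = (@), one = []\<rparr>"
        unfolding f_R[symmetric] using R_sub by (simp add: image_mono)
    qed (auto intro: f_closed)
  qed (use fin f_closed f_append in auto)
  have combing: "regular_combing G \<Sigma> f R"
    unfolding regular_combing_def free_semigroup_def using R_sub regular f_R by simp
  \<comment> \<open>The radius from \<open>triangulated_geodesic_triangle\<close> for
    \<open>D = \<delta> + 1\<close>.\<close>
  define k where "k = 2 * (\<delta> + 2 * (\<delta> + 1)) + (\<delta> + 1) + 1"
  from regular obtain Q :: "nat set" and q0 F d where dfa: "finite Q" "q0 \<in> Q" "F \<subseteq> Q" "\<forall>q\<in>Q. \<forall>a\<in>\<Sigma>. d q a \<in> Q"
    and R_dfa: "R = {w \<in> lists \<Sigma>. foldl d q0 w \<in> F}"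
    unfolding regular_language_def by (elim exE conjE)
  have "context_free_language (insert None (Some ` \<Sigma>)) {map Some u @ [None] @ map Some v @ [None] @ map Some (rev w) | u v w.
        u \<in> R \<and> v \<in> R \<and> w \<in> R \<and> word_value G val u \<otimes> word_value G val v = word_value G val w}"
  proof (rule context_free_multiplication[OF dfa(1) fin dfa(2,3) _ R_dfa valC finite_ball[OF A(1), of k]])
    show "d q a \<in> Q" if "q \<in> Q" "a \<in> \<Sigma>" for q a
      using dfa(4) that by blast
    fix u v w
    assume uvw: "u \<in> R" "v \<in> R" "w \<in> R" and eq: "word_value G val u \<otimes> word_value G val v = word_value G val w"
    have R_cases: "\<exists>x'. x = 0 # x' \<and> x' \<in> lists \<Sigma> \<and> geodesic_word (map val x') \<and> f x = gprod G (map val x')" if "x \<in> R" for x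
      using that lists f0 unfolding R_def R'_def by (elim imageE) simp
    obtain u' v' w' where u': "u = 0 # u'" "geodesic_word (map val u')" "f u = gprod G (map val u')"
      and v': "v = 0 # v'" "geodesic_word (map val v')" "f v = gprod G (map val v')"
      and w': "w = 0 # w'" "geodesic_word (map val w')" "f w = gprod G (map val w')"
      using R_cases[OF uvw(1)] R_cases[OF uvw(2)] R_cases[OF uvw(3)] by (elim exE conjE)
    \<comment> \<open>The polygon without the identity letter that opens \<open>u\<close> and the
      inverted one that ends the reversal of \<open>w\<close>. Adding these two labels changes no
      product, so the triangulation extends.\<close>
    let ?t = "map val u' @ [\<one>, \<one>] @ map val v' @ [\<one>] @ rev (map (m_inv G) (map val w'))"
    have tri: "triangulated G (ball k) ?t"
      unfolding k_def using eq u'(3) v'(3) w'(3)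
      by (intro triangulated_geodesic_triangle[OF slim u'(2) v'(2) w'(2) _ refl]) (simp add: f_def)
    have one: "triangulated G (ball k) [\<one>]"
      by (rule triangulated_single) simp
    have t: "set ?t \<subseteq> carrier G" "gprod G ?t \<in> ball k"
      using triangulated_gprod[OF tri] by blast+
    have e1: "gprod G ([\<one>] @ ?t) = gprod G ?t"
      using t gprod_append[of "[\<one>]" ?t] by simp
    have e2: "gprod G (([\<one>] @ ?t) @ [\<one>]) = gprod G ?t"
      using t gprod_append[of "[\<one>] @ ?t" "[\<one>]"] by simp
    have "triangulated G (ball k) ([\<one>] @ ?t)"
      by (rule triangulated_append[OF one tri]) (simp only: e1 t(2))
    then have "triangulated G (ball k) (([\<one>] @ ?t) @ [\<one>])"
      by (rule triangulated_append[OF _ one]) (simp only: e2 t(2))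
    then show "triangulated G (ball k) (map val u @ [\<one>] @ map val v @ [\<one>] @ rev (map (m_inv G) (map val w)))"
      by (simp add: u'(1) v'(1) w'(1) val0)
  qed auto
  then have "context_free_language (insert None (Some ` \<Sigma>)) (multiplication_language G f R)"
    by (simp add: multiplication_language_def f_def)
  then show ?thesis
    unfolding word_hyperbolic_semigroup_def using choice combing by blast
qed

theorem corollary4p3:
  fixes G :: "('a, 'b) monoid_scheme"
  assumes "group G"
  shows "word_hyperbolic_semigroup G \<longleftrightarrow> hyperbolic_group G"
  using word_hyperbolic_imp_hyperbolic[OF assms] hyperbolic_imp_word_hyperbolic[OF assms] by (rule iffI)

end
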